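(* Let $(X,d,\mu)$ be a space of homogeneous type with $\mu(X)=\infty$ and $\mu(\{x_0\})=0$ for every $x_0\in X$. Let $1<p<\infty$. There exists a positive constant $C$, depending only on $p$ and $(X,d,\mu)$, such that the following holds. Suppose $\lambda_1,\lambda_2\in A_p$, set $\nu:=\lambda_1^{1/p}\lambda_2^{-1/p}$, and suppose $b\in \mathrm{BMO}_{\nu}(X)$. Then $$\big\|C_b:L^p_{\lambda_1}(X)\to L^p_{\lambda_2}(X)\big\|\le C\Big([\lambda_1]_{A_p}[\lambda_2]_{A_p}\Big)^{\max\{1,\frac1{p-1}\}}\|b\|_{\mathrm{BMO}_{\nu}(X)} .$$
   Context: A space of homogeneous type $(X,d,\mu)$ consists of a set $X$ with a quasi-metric $d$ (that is, $d:X\times X\to[0,\infty)$ is symmetric, $d(x,y)=0$ iff $x=y$, and $d(x,y)\le A_0[d(x,z)+d(z,y)]$ for all $x,y,z$ with some constant $A_0\ge 1$) and a nonzero measure $\mu$ satisfying the doubling condition $\mu(B(x,2r))\le C_\mu\,\mu(B(x,r))<\infty$ for all $x\in X$, $r>0$, where $B(x,r)=\{y\in X: d(x,y)<r\}$ are the quasi-metric balls. "Ball" always means such a ball. Muckenhoupt weights: for $1<p<\infty$, a nonnegative locally integrable function $w$ on $X$ is in $A_p$ if $$[w]_{A_p}:=\sup_B\Big(\frac1{\mu(B)}\int_B w\,d\mu\Big)\Big(\frac1{\mu(B)}\int_B w^{-1/(p-1)}\,d\mu\Big)^{p-1}<\infty,$$ the supremum being over all balls $B\subset X$. For a weight $w$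 write $w(B)=\int_B w\,d\mu$, and let $L^p_w(X)$ be the space of functions with $\|f\|_{L^p_w(X)}=\big(\int_X|f|^p w\,d\mu\big)^{1/p}<\infty$. Weighted BMO: for a weight $w$ in the Muckenhoupt class $A_\infty$ (which contains $\nu$), $b\in L^1_{\rm loc}(X)$ belongs to $\mathrm{BMO}_w(X)$ if $$\|b\|_{\mathrm{BMO}_w(X)}:=\sup_B\frac1{w(B)}\int_B|b(x)-b_B|\,d\mu(x)<\infty,\qquad b_B=\frac1{\mu(B)}\int_B b\,d\mu,$$ the supremum being over all balls $B\subset X$. The maximal commutator with symbol $b$ is $$C_b(f)(x):=\sup_{B\ni x}\frac1{\mu(B)}\int_B|b(x)-b(y)|\,|f(y)|\,d\mu(y),$$ the supremum being over all balls $B\subset X$ containing $x$. For a (not necessarily linear) operator $S$, $\|S:L^p_{\lambda_1}(X)\to L^p_{\lambda_2}(X)\|$ is the least constant $K$ with $\|Sf\|_{L^p_{\lambda_2}(X)}\le K\|f\|_{L^p_{\lambda_1}(X)}$ for all $f\in L^p_{\lambda_1}(X)$.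
   Formalization: The measure is assumed Borel regular, with open sets and balls measurable (Borel regularity is automatic for Borel measures and their completions); on an arbitrary larger sigma-algebra the claimed bound can fail. *)

theory Defs
  imports "HOL-Analysis.Analysis"
begin

section \<open>Spaces of homogeneous type\<close>

definition qball :: "('a \<Rightarrow> 'a \<Rightarrow> real) \<Rightarrow> 'a set \<Rightarrow> 'a \<Rightarrow> real \<Rightarrow> 'a set" where
  "qball d X x r = {y \<in> X. d x y < r}"

definition qopen :: "('a \<Rightarrow> 'a \<Rightarrow> real) \<Rightarrow> 'a set \<Rightarrow> 'a set \<Rightarrow> bool" where
  "qopen d X U \<longleftrightarrow> U \<subseteq> X \<and> (\<forall>x\<in>U. \<exists>r>0. qball d X x r \<subseteq> U)"

text \<open>
  The underlying set is the space of the measure. Open sets and balls are measurable (a quasi-metric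
  ball need not be open, nor even Borel), and, as usual for spaces of homogeneous type, the measure
  is Borel regular: every measurable set is contained in a Borel set of the same measure. This is
  automatic when the sigma-algebra is the Borel one, and it also covers the completed Borel
  measure. On an arbitrary larger sigma-algebra Lebesgue's differentiation theorem, and with it the
  theory of weights and of BMO, would fail.
\<close>

locale space_of_homogeneous_type =
  fixes d :: "'a \<Rightarrow> 'a \<Rightarrow> real" and M :: "'a measure"
  assumes dist_nonneg: "x \<in> space M \<Longrightarrow> y \<in> space M \<Longrightarrow> 0 \<le> d x y"
    and dist_sym: "x \<in> space M \<Longrightarrow> y \<in> space M \<Longrightarrow> d x y = d y x"
    and dist_zero_iff: "x \<in> space M \<Longrightarrow> y \<in> space M \<Longrightarrow> d x y = 0 \<longleftrightarrow> x = y"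
    and quasi_triangle: "\<exists>A\<^sub>0\<ge>1. \<forall>x\<in>space M. \<forall>y\<in>space M. \<forall>z\<in>space M.
      d x y \<le> A\<^sub>0 * (d x z + d z y)"
    and open_measurable: "qopen d (space M) U \<Longrightarrow> U \<in> sets M"
    and ball_measurable: "x \<in> space M \<Longrightarrow> 0 < r \<Longrightarrow> qball d (space M) x r \<in> sets M"
    and borel_regular: "A \<in> sets M \<Longrightarrow>
      \<exists>B \<in> sigma_sets (space M) {U. qopen d (space M) U}. A \<subseteq> B \<and> emeasure M B = emeasure M A"
    and measure_nonzero: "emeasure M (space M) \<noteq> 0"
    and ball_finite: "x \<in> space M \<Longrightarrow> 0 < r \<Longrightarrow> emeasure M (qball d (space M) x r) < \<infinity>"
    and doubling: "\<exists>C\<^sub>\<mu>::real. \<forall>x\<in>space M. \<forall>r>0.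
      emeasure M (qball d (space M) x (2 * r)) \<le> ennreal C\<^sub>\<mu> * emeasure M (qball d (space M) x r)"

definition balls :: "('a \<Rightarrow> 'a \<Rightarrow> real) \<Rightarrow> 'a measure \<Rightarrow> 'a set set" where
  "balls d M = {qball d (space M) x r | x r. x \<in> space M \<and> 0 < r}"


section \<open>Weights and weighted norms\<close>

text \<open>Powers with a positive real exponent of extended nonnegative reals.\<close>

definition epowr :: "ennreal \<Rightarrow> real \<Rightarrow> ennreal" where
  "epowr x a = (if x = \<infinity> then \<infinity> else ennreal (enn2real x powr a))"

definition locally_integrable ::
  "('a \<Rightarrow> 'a \<Rightarrow> real) \<Rightarrow> 'a measure \<Rightarrow> ('a \<Rightarrow> 'b::{banach, second_countable_topology}) \<Rightarrow> bool" where
  "locally_integrable d M f \<longleftrightarrow> (\<forall>B\<in>balls d M. set_integrable M B f)"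

definition Ap_const :: "('a \<Rightarrow> 'a \<Rightarrow> real) \<Rightarrow> 'a measure \<Rightarrow> real \<Rightarrow> ('a \<Rightarrow> real) \<Rightarrow> ennreal" where
  "Ap_const d M p w = (SUP B\<in>balls d M.
     ((\<integral>\<^sup>+y\<in>B. ennreal (w y) \<partial>M) / emeasure M B) *
     epowr ((\<integral>\<^sup>+y\<in>B. ennreal (w y powr (- (1 / (p - 1)))) \<partial>M) / emeasure M B) (p - 1))"

text \<open>
  Positivity almost everywhere is part of the usual notion of a weight. Reading \<open>0\<close> to a negative
  power as \<open>\<infinity>\<close>, finiteness of the supremum already forces it for every weight not vanishing
  almost everywhere; it is stated explicitly because \<open>0 powr a = 0\<close> in HOL.
\<close>

definition Ap :: "('a \<Rightarrow> 'a \<Rightarrow> real) \<Rightarrow> 'a measure \<Rightarrow> real \<Rightarrow> ('a \<Rightarrow> real) set" where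
  "Ap d M p = {w. (\<forall>x\<in>space M. 0 \<le> w x) \<and> (AE x in M. 0 < w x) \<and>
     locally_integrable d M w \<and> Ap_const d M p w < \<infinity>}"

text \<open>
  The maximal commutator is a supremum over uncountably many balls, which need not be open, so it
  may fail to be measurable. For a function that is not measurable, \<open>nn_integral\<close> is a lower
  integral; norms are therefore taken with the upper integral, which is the stronger requirement in
  an upper bound and is the ordinary integral on measurable functions.
\<close>

definition upper_integral :: "'a measure \<Rightarrow> ('a \<Rightarrow> ennreal) \<Rightarrow> ennreal" where
  "upper_integral M g =
     (INF h\<in>{h \<in> borel_measurable M. \<forall>x\<in>space M. g x \<le> h x}. \<integral>\<^sup>+x. h x \<partial>M)"

lemma upper_integral_eq_nn_integral:
  assumes "g \<in> borel_measurable M"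
  shows "upper_integral M g = (\<integral>\<^sup>+x. g x \<partial>M)"
  unfolding upper_integral_def
  by (rule antisym) (auto intro!: INF_lower2[of g] INF_greatest nn_integral_mono assms)

definition Lp_norm :: "'a measure \<Rightarrow> real \<Rightarrow> ('a \<Rightarrow> real) \<Rightarrow> ('a \<Rightarrow> ennreal) \<Rightarrow> ennreal" where
  "Lp_norm M p w g = epowr (upper_integral M (\<lambda>x. epowr (g x) p * ennreal (w x))) (1 / p)"

definition Lp :: "'a measure \<Rightarrow> real \<Rightarrow> ('a \<Rightarrow> real) \<Rightarrow> ('a \<Rightarrow> complex) set" where
  "Lp M p w = {f \<in> borel_measurable M. Lp_norm M p w (\<lambda>x. ennreal (cmod (f x))) < \<infinity>}"

text \<open>The infimum over the empty set is \<open>\<infinity>\<close>, the norm of an unbounded operator.\<close>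

definition operator_norm ::
  "'a measure \<Rightarrow> real \<Rightarrow> ('a \<Rightarrow> real) \<Rightarrow> ('a \<Rightarrow> real) \<Rightarrow> (('a \<Rightarrow> complex) \<Rightarrow> 'a \<Rightarrow> ennreal) \<Rightarrow> ennreal"
  where
  "operator_norm M p w\<^sub>1 w\<^sub>2 S = Inf {K. \<forall>f\<in>Lp M p w\<^sub>1.
     Lp_norm M p w\<^sub>2 (S f) \<le> K * Lp_norm M p w\<^sub>1 (\<lambda>x. ennreal (cmod (f x)))}"


section \<open>Weighted BMO and the maximal commutator\<close>

definition ball_avg :: "'a measure \<Rightarrow> ('a \<Rightarrow> complex) \<Rightarrow> 'a set \<Rightarrow> complex" where
  "ball_avg M b B = (LINT x:B|M. b x) /\<^sub>R measure M B"

definition BMO_norm ::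
  "('a \<Rightarrow> 'a \<Rightarrow> real) \<Rightarrow> 'a measure \<Rightarrow> ('a \<Rightarrow> real) \<Rightarrow> ('a \<Rightarrow> complex) \<Rightarrow> ennreal" where
  "BMO_norm d M w b = (SUP B\<in>balls d M.
     (\<integral>\<^sup>+x\<in>B. ennreal (cmod (b x - ball_avg M b B)) \<partial>M) / (\<integral>\<^sup>+x\<in>B. ennreal (w x) \<partial>M))"

definition BMO :: "('a \<Rightarrow> 'a \<Rightarrow> real) \<Rightarrow> 'a measure \<Rightarrow> ('a \<Rightarrow> real) \<Rightarrow> ('a \<Rightarrow> complex) set" where
  "BMO d M w = {b. locally_integrable d M b \<and> BMO_norm d M w b < \<infinity>}"

definition max_commutator ::
  "('a \<Rightarrow> 'a \<Rightarrow> real) \<Rightarrow> 'a measure \<Rightarrow> ('a \<Rightarrow> complex) \<Rightarrow> ('a \<Rightarrow> complex) \<Rightarrow> 'a \<Rightarrow> ennreal" where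
  "max_commutator d M b f x = (SUP B\<in>{B \<in> balls d M. x \<in> B}.
     (\<integral>\<^sup>+y\<in>B. ennreal (cmod (b x - b y) * cmod (f y)) \<partial>M) / emeasure M B)"

end

theory Submission
  imports Defs
begin

text \<open>
  The idea is to dominate the maximal commutator by compositions of two positive operators with the
  Bloom weight \<open>\<nu>\<close> between them, one acting on \<open>L\<^sup>p(\<lambda>\<^sub>1)\<close> and the other on \<open>L\<^sup>p(\<lambda>\<^sub>2)\<close>. Since \<open>\<nu>\<^sup>p \<lambda>\<^sub>2 = \<lambda>\<^sub>1\<close>,
  multiplication by \<open>\<nu>\<close> is an isometry between the two spaces, and the norm is at most the product of
  two one-weight norms.

  The operators are dyadic maximal operators \<open>M\<close> and sparse operators \<open>A\<close>. Both have norm at most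
  \<open>C [\<lambda>]\<^bsup>max {1, 1/(p-1)}\<^esup>\<close> on \<open>L\<^sup>p(\<lambda>)\<close>. For sparse operators (\<open>sparse_bound\<close>) this is proved for \<open>p \<ge> 2\<close> by
  pairing with a second function, extracting the \<open>A\<^sub>p\<close> characteristic once from each cube, and bounding
  what is left by weighted dyadic maximal functions, whose norms do not depend on the weight; duality
  gives \<open>p < 2\<close>. The maximal operator is dominated by a sparse one (\<open>avg_le_sparse\<close>).

  The domination rests on stopping cubes. Descending from a coarse level, stop whenever the mean
  deviation of \<open>b\<close> from its average on the last stopping cube, or the average of \<open>|f|\<close>, exceeds four times
  its value there. At least half of every stopping cube is free of further stops, so the stopping
  cubes form a sparse family. Along them \<open>|b(x) - b\<^sub>Q|\<close> is bounded by a sum of mean oscillations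
  (\<open>oscillation_domination\<close>), and each oscillation is at most the BMO norm times an average of \<open>\<nu>\<close>.
  Rearranging gives \<open>A(\<nu> M f) + M(\<nu> A f)\<close> (\<open>dyadic_commutator_pointwise\<close>).

  Two features of the space have to be supplied. The hypotheses concern balls while the argument needs
  nested families, and the constant of \<open>\<nu>\<close>-doubling must not enter. Therefore finitely many adjacent
  dyadic systems are used, in which every ball is contained in a cube of comparable measure
  (\<open>adjacent_systems_exist\<close>). They are built from arbitrary nets on each scale above a smallest one. The
  stopping argument consequently controls only averages of \<open>b\<close> on the smallest cubes; as the smallest
  scale tends to zero, these converge to \<open>b\<close> in the mean on balls (\<open>L1_conv_locally_integrable\<close>), which is where
  Borel regularity is used. Passing to a subsequence that converges almost everywhere, Fatou's
  lemma transfers the uniform bound to the maximal commutator.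
\<close>


section \<open>Powers of extended nonnegative reals and Hoelder's inequality\<close>

lemma epowr_ennreal: "0 \<le> r \<Longrightarrow> epowr (ennreal r) a = ennreal (r powr a)"
  by (simp add: epowr_def)

lemma epowr_top [simp]: "epowr \<infinity> a = \<infinity>" "epowr top a = top"
  by (simp_all add: epowr_def)

lemma epowr_zero [simp]: "epowr 0 a = 0"
  by (simp add: epowr_def)

lemma epowr_one [simp]: "epowr 1 a = 1"
  by (simp add: epowr_def)

lemma epowr_less_top [simp]: "epowr x a < top \<longleftrightarrow> x < top" "epowr x a = top \<longleftrightarrow> x = top"
  by (auto simp: epowr_def less_top)

lemma epowr_eq_0 [simp]: "epowr x a = 0 \<longleftrightarrow> x = 0"
  by (cases x) (auto simp: epowr_def)

lemma epowr_by_1 [simp]: "epowr x 1 = x"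
  by (cases x) (auto simp: epowr_def)

lemma epowr_mono: "x \<le> y \<Longrightarrow> 0 \<le> a \<Longrightarrow> epowr x a \<le> epowr y a"
  by (cases x; cases y) (auto simp: epowr_ennreal top_unique intro!: ennreal_leI powr_mono2)

lemma epowr_mult: "epowr (x * y) a = epowr x a * epowr y a"
proof (cases "x = top \<or> y = top")
  case True
  then show ?thesis by (auto simp: ennreal_mult_top ennreal_top_mult)
next
  case False
  then obtain u v where "x = ennreal u" "y = ennreal v" "0 \<le> u" "0 \<le> v"
    by (metis ennreal_cases)
  then show ?thesis by (simp add: epowr_ennreal powr_mult flip: ennreal_mult)
qed

lemma epowr_epowr: "epowr (epowr x a) b = epowr x (a * b)"
  by (cases x) (auto simp: epowr_ennreal powr_powr)

lemma epowr_add: "epowr x (a + b) = epowr x a * epowr x b"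
  by (cases x) (auto simp: epowr_ennreal powr_add simp flip: ennreal_mult)

lemma epowr_inverse: "0 < a \<Longrightarrow> epowr x a \<le> y \<longleftrightarrow> x \<le> epowr y (1 / a)"
  using epowr_mono[of "epowr x a" y "1 / a"] epowr_mono[of x "epowr y (1 / a)" a]
  by (auto simp: epowr_epowr)

lemma epowr_less_iff: "0 < a \<Longrightarrow> y < epowr x a \<longleftrightarrow> epowr y (1 / a) < x"
  by (simp add: epowr_inverse flip: not_le)

lemma epowr_measurable [measurable]:
  assumes [measurable]: "f \<in> borel_measurable M"
  shows "(\<lambda>x. epowr (f x) a) \<in> borel_measurable M"
  unfolding epowr_def by measurable

text \<open>
  A monotone power commutes with lower limits only through continuity; here continuity enters as the
  fact that strict inequalities can be carried through the inverse power.
\<close>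
lemma epowr_liminf_le:
  assumes "0 < a"
  shows "epowr (liminf f) a \<le> liminf (\<lambda>n. epowr (f n) a)"
  unfolding le_Liminf_iff
  using less_LiminfD[of _ sequentially f] by (auto simp: epowr_less_iff assms)

lemma conjugate_exponent:
  fixes p q :: real
  assumes "1 < p" "1 / p + 1 / q = 1"
  shows "q = p / (p - 1)" "1 < q" "(p - 1) * (q - 1) = 1" "q * (p - 1) = p"
proof -
  have "1 / q = (p - 1) / p" using assms by (simp add: field_simps)
  then have "inverse (1 / q) = inverse ((p - 1) / p)" by simp
  then show q: "q = p / (p - 1)" by simp
  show "1 < q" "(p - 1) * (q - 1) = 1" "q * (p - 1) = p"
    using assms(1) by (simp_all add: q field_simps)
qed

lemma Young_ennreal:
  assumes "1 < p" "1 / p + 1 / q = 1"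
  shows "x * y \<le> ennreal (1 / p) * epowr x p + ennreal (1 / q) * epowr y q"
proof -
  note q = conjugate_exponent(2)[OF assms]
  show ?thesis
  proof (cases "x = top \<or> y = top")
    case True
    then show ?thesis using assms q 
      by (auto simp: ennreal_mult_top ennreal_top_mult)
  next
    case False
    then obtain u v where "x = ennreal u" "y = ennreal v" "0 \<le> u" "0 \<le> v"
      by (metis ennreal_cases)
    then show ?thesis using Youngs_inequality[OF _ _ assms(2), of u v] assms q 
      by (simp add: epowr_ennreal mult_ac flip: ennreal_mult ennreal_plus)
  qed
qed

lemma ennreal_mult_divide_cancel:
  fixes x c :: ennreal
  assumes "c \<noteq> 0" "c \<noteq> top"
  shows "c * (x / c) = x" "x / c * c = x" "x * c / c = x" "c * x / c = x"
  using assms ennreal_mult_divide_eq[of c x]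
  by (simp_all add: ennreal_times_divide ennreal_divide_times mult.commute)

lemma Hoelder_nn_integral:
  assumes [measurable]: "f \<in> borel_measurable M" "g \<in> borel_measurable M"
    and p: "1 < p" "1 / p + 1 / q = 1"
  shows "(\<integral>\<^sup>+x. f x * g x \<partial>M) \<le> epowr (\<integral>\<^sup>+x. epowr (f x) p \<partial>M) (1 / p) * epowr (\<integral>\<^sup>+x. epowr (g x) q \<partial>M) (1 / q)"
    (is "?L \<le> epowr ?F _ * epowr ?G _")
proof -
  note q = conjugate_exponent(2)[OF p]
  have 0: "?L = 0" if "?F = 0 \<or> ?G = 0"
  proof -
    have "AE x in M. f x * g x = 0" using that by (auto simp: nn_integral_0_iff_AE)
    then show ?thesis by (auto simp: nn_integral_0_iff_AE)
  qed
  consider "?F = 0 \<or> ?G = 0" | "?F \<noteq> 0" "?G \<noteq> 0" "?F = top \<or> ?G = top" | "?F \<noteq> 0" "?G \<noteq> 0" "?F \<noteq> top" "?G \<noteq> top"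
    by blast
  then show ?thesis
  proof cases
    case 1 then show ?thesis using 0 by simp
  next
    case 2 
    then show ?thesis by (auto simp: ennreal_mult_top ennreal_top_mult)
  next
    case 3
    define F where "F = epowr ?F (1 / p)"
    define G where "G = epowr ?G (1 / q)"
    have F: "F \<noteq> 0" "F \<noteq> top" "epowr F p = ?F" and G: "G \<noteq> 0" "G \<noteq> top" "epowr G q = ?G" 
      using 3 p q by (auto simp: F_def G_def epowr_epowr)
    have *: "f x * g x \<le> F * G * (ennreal (1 / p) * epowr (f x) p / ?F + ennreal (1 / q) * epowr (g x) q / ?G)" for x
    proof -
      have a: "f x = F * (f x / F)" "g x = G * (g x / G)"
        using F G by (simp_all add: ennreal_mult_divide_cancel)
      have b: "epowr (f x / F) p = epowr (f x) p / ?F" "epowr (g x / G) q = epowr (g x) q / ?G"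
        using F G 3 epowr_mult[of F "f x / F" p] epowr_mult[of G "g x / G" q]
        by (simp_all add: ennreal_mult_divide_cancel flip: a)
      have "f x * g x = F * G * ((f x / F) * (g x / G))"
        using a by (metis mult.assoc mult.left_commute)
      also have "\<dots> \<le> F * G * (ennreal (1 / p) * epowr (f x / F) p + ennreal (1 / q) * epowr (g x / G) q)"
        by (intro mult_left_mono Young_ennreal p) auto
      finally show ?thesis unfolding b by (simp add: ennreal_times_divide)
    qed
    have "?L \<le> (\<integral>\<^sup>+x. F * G * (ennreal (1 / p) * epowr (f x) p / ?F + ennreal (1 / q) * epowr (g x) q / ?G) \<partial>M)"
      by (intro nn_integral_mono *)
    also have "\<dots> = F * G * (ennreal (1 / p) * ?F / ?F + ennreal (1 / q) * ?G / ?G)"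
      by (simp add: nn_integral_cmult nn_integral_add nn_integral_divide)
    also have "\<dots> = F * G * (ennreal (1 / p) + ennreal (1 / q))"
      using 3 by (simp add: ennreal_mult_divide_eq)
    also have "\<dots> = F * G" using p q by (simp flip: ennreal_plus)
    finally show ?thesis by (simp add: F_def G_def)
  qed
qed


section \<open>Averages\<close>

definition mean :: "'a measure \<Rightarrow> 'a set \<Rightarrow> ('a \<Rightarrow> ennreal) \<Rightarrow> ennreal" where
  "mean M B f = (\<integral>\<^sup>+y\<in>B. f y \<partial>M) / emeasure M B"

lemma mean_mono: "(\<And>y. y \<in> space M \<Longrightarrow> y \<in> B \<Longrightarrow> f y \<le> g y) \<Longrightarrow> mean M B f \<le> mean M B g"
  unfolding mean_def by (intro divide_right_mono_ennreal nn_integral_mono) (auto split: split_indicator)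

lemma mean_cong: "(\<And>y. y \<in> space M \<Longrightarrow> y \<in> B \<Longrightarrow> f y = g y) \<Longrightarrow> mean M B f = mean M B g"
  by (intro antisym mean_mono) auto

lemma mean_cong_AE: "AE y in M. y \<in> B \<longrightarrow> f y = g y \<Longrightarrow> mean M B f = mean M B g"
  unfolding mean_def by (intro arg_cong[where f="\<lambda>x. x / _"] nn_integral_cong_AE) (auto split: split_indicator)

lemma mean_cmult:
  "B \<in> sets M \<Longrightarrow> f \<in> borel_measurable M \<Longrightarrow> mean M B (\<lambda>y. c * f y) = c * mean M B f"
  unfolding mean_def by (simp add: nn_integral_cmult mult.assoc ennreal_times_divide)

lemma mean_add:
  "B \<in> sets M \<Longrightarrow> f \<in> borel_measurable M \<Longrightarrow> g \<in> borel_measurable M \<Longrightarrow>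
    mean M B (\<lambda>y. f y + g y) = mean M B f + mean M B g"
  unfolding mean_def by (simp add: distrib_right nn_integral_add add_divide_distrib_ennreal)

lemma mean_sum:
  "B \<in> sets M \<Longrightarrow> (\<And>i. i \<in> I \<Longrightarrow> f i \<in> borel_measurable M) \<Longrightarrow>
    mean M B (\<lambda>y. \<Sum>i\<in>I. f i y) = (\<Sum>i\<in>I. mean M B (f i))"
proof (induction I rule: infinite_finite_induct)
  case (insert i I)
  then show ?case by (simp add: mean_add)
qed (auto simp: mean_def)

lemma mean_const:
  "B \<in> sets M \<Longrightarrow> emeasure M B \<noteq> 0 \<Longrightarrow> emeasure M B \<noteq> top \<Longrightarrow> mean M B (\<lambda>y. c) = c"
  unfolding mean_def by (simp add: nn_integral_cmult_indicator ennreal_mult_divide_cancel)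

text \<open>
  Passing from a set to a comparable larger set costs the ratio of the measures. All changes
  between cubes, envelopes and balls are instances of this.
\<close>
lemma mean_subset:
  assumes "B \<subseteq> B'" "emeasure M B' \<le> ennreal C * emeasure M B" "emeasure M B \<noteq> 0" "emeasure M B \<noteq> top"
    "emeasure M B' \<noteq> 0" "0 < C"
  shows "mean M B f \<le> ennreal C * mean M B' f"
proof -
  let ?I = "\<integral>\<^sup>+y\<in>B'. f y \<partial>M"
  have B': "emeasure M B' \<noteq> top"
    using assms by (auto simp: top_unique ennreal_mult_eq_top_iff)
  have "?I / emeasure M B = (?I / emeasure M B') * emeasure M B' / emeasure M B"
    using assms B' by (simp add: ennreal_mult_divide_cancel)
  also have "\<dots> \<le> (?I / emeasure M B') * (ennreal C * emeasure M B) / emeasure M B"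
    by (intro divide_right_mono_ennreal mult_left_mono assms) auto
  also have "\<dots> = ennreal C * mean M B' f"
    unfolding mult.assoc[symmetric] ennreal_mult_divide_cancel(3)[OF assms(3,4)] mean_def
    by (simp add: mult.commute)
  finally have "?I / emeasure M B \<le> ennreal C * mean M B' f" .
  moreover have "mean M B f \<le> ?I / emeasure M B"
    unfolding mean_def using assms(1)
    by (intro divide_right_mono_ennreal nn_integral_mono) (auto split: split_indicator)
  ultimately show ?thesis by simp
qed

lemma mean_Hoelder:
  assumes [measurable]: "B \<in> sets M" "f \<in> borel_measurable M" "g \<in> borel_measurable M"
    and B: "emeasure M B \<noteq> 0" "emeasure M B \<noteq> top" and p: "1 < p" "1 / p + 1 / q = 1"
  shows "mean M B (\<lambda>x. f x * g x) \<le> epowr (mean M B (\<lambda>x. epowr (f x) p)) (1 / p) * epowr (mean M B (\<lambda>x. epowr (g x) q)) (1 / q)"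
proof -
  let ?m = "emeasure M B"
  have ind: "epowr (h x * indicator B x) r = epowr (h x) r * indicator B x" for h :: "'a \<Rightarrow> ennreal" and r x
    by (auto split: split_indicator)
  have scale: "epowr (\<integral>\<^sup>+x\<in>B. h x \<partial>M) r = epowr (mean M B h) r * epowr ?m r" for h r
    unfolding mean_def epowr_mult[symmetric] using B by (simp add: ennreal_mult_divide_cancel)
  have "(\<integral>\<^sup>+x\<in>B. f x * g x \<partial>M) = (\<integral>\<^sup>+x. (f x * indicator B x) * (g x * indicator B x) \<partial>M)"
    by (intro nn_integral_cong) (auto split: split_indicator)
  also have "\<dots> \<le> epowr (\<integral>\<^sup>+x\<in>B. epowr (f x) p \<partial>M) (1 / p) * epowr (\<integral>\<^sup>+x\<in>B. epowr (g x) q \<partial>M) (1 / q)"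
    using Hoelder_nn_integral[OF _ _ p, of "\<lambda>x. f x * indicator B x" M "\<lambda>x. g x * indicator B x"]
    by (simp add: ind)
  also have "\<dots> = (epowr (mean M B (\<lambda>x. epowr (f x) p)) (1 / p) * epowr (mean M B (\<lambda>x. epowr (g x) q)) (1 / q)) * (epowr ?m (1 / p) * epowr ?m (1 / q))"
    unfolding scale by (simp only: mult_ac)
  also have "epowr ?m (1 / p) * epowr ?m (1 / q) = ?m"
    by (simp add: p flip: epowr_add)
  finally have "(\<integral>\<^sup>+x\<in>B. f x * g x \<partial>M) / ?m \<le> (epowr (mean M B (\<lambda>x. epowr (f x) p)) (1 / p) * epowr (mean M B (\<lambda>x. epowr (g x) q)) (1 / q)) * ?m / ?m"
    by (rule divide_right_mono_ennreal)
  then show ?thesis using B by (simp add: ennreal_mult_divide_cancel) (simp add: mean_def)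
qed

section \<open>Nested partitions and conditional expectations\<close>

text \<open>
  Splits an event by the last, that is coarsest, level at which it occurs.
\<close>
lemma indicator_Ex_eq_sum_last:
  fixes P :: "nat \<Rightarrow> 'a \<Rightarrow> bool"
  shows "(indicator {x. \<exists>j<n. P j x} x :: ennreal) = (\<Sum>j<n. indicator {x. P j x \<and> (\<forall>k. j < k \<and> k < n \<longrightarrow> \<not> P k x)} x)"
proof (induction n)
  case (Suc n)
  show ?case
  proof (cases "P n x")
    case True
    have "(\<Sum>j<n. indicator {x. P j x \<and> (\<forall>k. j < k \<and> k < Suc n \<longrightarrow> \<not> P k x)} x :: ennreal) = 0"
      using True by (intro sum.neutral) (auto simp: indicator_def)
    then show ?thesis using True by (auto simp: indicator_def)
  next
    case False
    have "(\<Sum>j<n. indicator {x. P j x \<and> (\<forall>k. j < k \<and> k < Suc n \<longrightarrow> \<not> P k x)} x :: ennreal)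
       = (\<Sum>j<n. indicator {x. P j x \<and> (\<forall>k. j < k \<and> k < n \<longrightarrow> \<not> P k x)} x)"
      using False by (intro sum.cong) (auto simp: indicator_def less_Suc_eq)
    moreover have "(indicator {x. \<exists>j<Suc n. P j x} x :: ennreal) = indicator {x. \<exists>j<n. P j x} x"
      using False by (auto simp: indicator_def less_Suc_eq)
    moreover have "(indicator {x. P n x \<and> (\<forall>k. n < k \<and> k < Suc n \<longrightarrow> \<not> P k x)} x :: ennreal) = 0"
      using False by simp
    ultimately show ?thesis unfolding sum.lessThan_Suc by (simp only: Suc add_0_right)
  qed
qed simp

text \<open>
  The sets \<open>cube j x\<close> are the dyadic cubes of level \<open>j\<close>, given by the point rather than by a name for
  the cube; level \<open>0\<close> is the finest. Averages over cubes are then conditional expectations,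
  written as functions of the point, and sums over families of cubes become sums over levels.
\<close>
locale nested_partitions =
  fixes M :: "'a measure" and cube :: "nat \<Rightarrow> 'a \<Rightarrow> 'a set"
  assumes cube_self: "x \<in> space M \<Longrightarrow> x \<in> cube j x"
    and cube_sets: "x \<in> space M \<Longrightarrow> cube j x \<in> sets M"
    and cube_eq: "x \<in> space M \<Longrightarrow> y \<in> cube j x \<Longrightarrow> cube j y = cube j x"
    and cube_Suc: "x \<in> space M \<Longrightarrow> cube j x \<subseteq> cube (Suc j) x"
    and cube_countable: "countable (cube j ` space M)"
    and cube_pos: "x \<in> space M \<Longrightarrow> emeasure M (cube j x) \<noteq> 0"
    and cube_fin: "x \<in> space M \<Longrightarrow> emeasure M (cube j x) \<noteq> top"
begin

abbreviation avg :: "nat \<Rightarrow> ('a \<Rightarrow> ennreal) \<Rightarrow> 'a \<Rightarrow> ennreal" where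
  "avg j f x \<equiv> mean M (cube j x) f"

text \<open>
  Measurability with respect to the partition of level \<open>j\<close>. Since there are countably many cubes,
  it implies measurability whatever the target space is, which makes all the functions built by
  stopping times measurable without further work.
\<close>
definition adapted :: "nat \<Rightarrow> ('a \<Rightarrow> 'b) \<Rightarrow> bool" where
  "adapted j g \<longleftrightarrow> (\<forall>x\<in>space M. \<forall>y\<in>cube j x. g y = g x)"

lemma cube_space: "x \<in> space M \<Longrightarrow> y \<in> cube j x \<Longrightarrow> y \<in> space M"
  using cube_sets[of x j] sets.sets_into_space[of "cube j x" M] by auto

lemma cube_sym: "x \<in> space M \<Longrightarrow> y \<in> cube j x \<Longrightarrow> x \<in> cube j y"
  using cube_eq[of x y j] cube_self[of x j] by auto

lemma cube_mono: "x \<in> space M \<Longrightarrow> i \<le> j \<Longrightarrow> cube i x \<subseteq> cube j x"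
proof -
  assume "x \<in> space M" and "i \<le> j"
  from \<open>i \<le> j\<close> show ?thesis
    by (induction rule: dec_induct) (use cube_Suc \<open>x \<in> space M\<close> in blast)+
qed

lemma adaptedD: "adapted j g \<Longrightarrow> x \<in> space M \<Longrightarrow> y \<in> cube j x \<Longrightarrow> g y = g x"
  by (auto simp: adapted_def)

lemma cube_eq_above: "x \<in> space M \<Longrightarrow> y \<in> cube j x \<Longrightarrow> j \<le> i \<Longrightarrow> cube i y = cube i x"
  by (rule cube_eq) (auto dest: cube_mono)

lemma adaptedI:
  assumes "\<And>x y. x \<in> space M \<Longrightarrow> y \<in> cube j x \<Longrightarrow> g y = g x"
  shows "adapted j g"
  unfolding adapted_def by (intro ballI assms)

lemma adapted_mono: "adapted j g \<Longrightarrow> i \<le> j \<Longrightarrow> adapted i g"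
  unfolding adapted_def using cube_mono[of _ i j] by (meson subsetD)

lemma adapted_cube: "adapted j (\<lambda>x. F (cube j x))"
  unfolding adapted_def by (auto dest: cube_eq)

lemma adapted_avg: "i \<le> j \<Longrightarrow> adapted i (avg j f)"
  by (rule adapted_mono[OF adapted_cube])

lemma adapted_measurable:
  assumes "adapted j g" "\<And>x. x \<in> space M \<Longrightarrow> g x \<in> space N"
  shows "g \<in> measurable M N"
proof (rule measurableI)
  fix A
  have "g -` A \<inter> space M = \<Union>{C \<in> cube j ` space M. g ` C \<subseteq> A}" (is "?L = ?R")
  proof
    show "?L \<subseteq> ?R"
    proof
      fix x assume x: "x \<in> ?L"
      then have "g ` cube j x \<subseteq> A" using adaptedD[OF assms(1), of x] by auto
      then show "x \<in> ?R" using x cube_self[of x j] by blast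
    qed
    show "?R \<subseteq> ?L" using cube_space by blast
  qed
  moreover have "?R \<in> sets M"
    by (rule sets.countable_Union) (auto simp: cube_sets intro: countable_subset[OF _ cube_countable])
  ultimately show "g -` A \<inter> space M \<in> sets M" by simp
qed (use assms in auto)

lemma avg_measurable [measurable]: "avg j f \<in> borel_measurable M"
  by (rule adapted_measurable[OF adapted_avg]) auto

lemma avg_const: "x \<in> space M \<Longrightarrow> avg j (\<lambda>y. c) x = c"
  by (simp add: mean_const cube_sets cube_pos cube_fin)

lemma avg_pull:
  assumes "adapted j g" "f \<in> borel_measurable M" "x \<in> space M"
  shows "avg j (\<lambda>y. g y * f y) x = g x * avg j f x"
proof -
  have "avg j (\<lambda>y. g y * f y) x = avg j (\<lambda>y. g x * f y) x"
    by (intro mean_cong) (metis adaptedD assms(1,3))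
  then show ?thesis using assms by (simp add: mean_cmult cube_sets)
qed

lemma avg_adapted:
  assumes "adapted j g" "x \<in> space M"
  shows "avg j g x = g x"
proof -
  have "avg j g x = avg j (\<lambda>y. g x) x"
    by (intro mean_cong) (metis adaptedD assms)
  then show ?thesis using assms by (simp add: avg_const)
qed

lemma nn_integral_cubes:
  assumes [measurable]: "f \<in> borel_measurable M"
  shows "(\<integral>\<^sup>+x. f x \<partial>M) = (\<integral>\<^sup>+C. (\<integral>\<^sup>+x\<in>C. f x \<partial>M) \<partial>count_space (cube j ` space M))"
proof -
  have [measurable]: "C \<in> sets M" if "C \<in> cube j ` space M" for C using that cube_sets by auto
  have "f x = (\<integral>\<^sup>+C. f x * indicator C x \<partial>count_space (cube j ` space M))" if x: "x \<in> space M" for x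
  proof -
    have "(\<integral>\<^sup>+C. f x * indicator C x \<partial>count_space (cube j ` space M))
        = (\<integral>\<^sup>+C. f x * indicator {cube j x} C \<partial>count_space (cube j ` space M))"
    proof (intro nn_integral_cong)
      fix C assume "C \<in> space (count_space (cube j ` space M))"
      then obtain y where "y \<in> space M" "C = cube j y" by auto
      then have "x \<in> C \<longleftrightarrow> C = cube j x"
        using cube_eq[of y x j] cube_self[OF x, of j] by auto
      then show "f x * indicator C x = f x * indicator {cube j x} C"
        by (simp add: indicator_def)
    qed
    also have "\<dots> = f x"
      using x by (subst nn_integral_cmult_indicator) (auto simp: emeasure_count_space)
    finally show ?thesis by simp
  qed
  then have "(\<integral>\<^sup>+x. f x \<partial>M) = (\<integral>\<^sup>+x. (\<integral>\<^sup>+C. f x * indicator C x \<partial>count_space (cube j ` space M)) \<partial>M)"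
    by (intro nn_integral_cong) auto
  also have "\<dots> = (\<integral>\<^sup>+C. (\<integral>\<^sup>+x\<in>C. f x \<partial>M) \<partial>count_space (cube j ` space M))"
    by (intro nn_integral_count_space_nn_integral cube_countable) simp
  finally show ?thesis .
qed

lemma nn_integral_avg:
  assumes [measurable]: "f \<in> borel_measurable M"
  shows "(\<integral>\<^sup>+x. avg j f x \<partial>M) = (\<integral>\<^sup>+x. f x \<partial>M)"
proof -
  have "(\<integral>\<^sup>+x\<in>C. avg j f x \<partial>M) = (\<integral>\<^sup>+x\<in>C. f x \<partial>M)" if C: "C \<in> cube j ` space M" for C
  proof -
    obtain x where x: "x \<in> space M" "C = cube j x" using C by auto
    have "(\<integral>\<^sup>+y\<in>C. avg j f y \<partial>M) = (\<integral>\<^sup>+y\<in>C. avg j f x \<partial>M)"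
      using x cube_eq[OF x(1)] by (intro nn_integral_cong) (auto split: split_indicator)
    also have "\<dots> = avg j f x * emeasure M C"
      using x by (simp add: nn_integral_cmult_indicator cube_sets)
    finally show ?thesis using x by (simp add: mean_def ennreal_mult_divide_cancel cube_pos cube_fin)
  qed
  then show ?thesis
    unfolding nn_integral_cubes[OF avg_measurable[of j f], of j] nn_integral_cubes[OF assms, of j]
    by (rule nn_integral_cong) (simp only: space_count_space)
qed

text \<open>
  Averaging over cubes is a conditional expectation, so it can be moved off any factor which is
  constant on the cubes.
\<close>
lemma nn_integral_adapted_mult_avg:
  assumes "adapted j g" and [measurable]: "f \<in> borel_measurable M"
  shows "(\<integral>\<^sup>+x. g x * avg j f x \<partial>M) = (\<integral>\<^sup>+x. g x * f x \<partial>M)"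
proof -
  have [measurable]: "g \<in> borel_measurable M" by (rule adapted_measurable[OF assms(1)]) auto
  have "(\<integral>\<^sup>+x. g x * avg j f x \<partial>M) = (\<integral>\<^sup>+x. avg j (\<lambda>y. g y * f y) x \<partial>M)"
    by (intro nn_integral_cong) (simp add: avg_pull assms)
  then show ?thesis by (simp add: nn_integral_avg)
qed

lemma avg_tower:
  assumes g: "adapted i g" and [measurable]: "f \<in> borel_measurable M" and "i \<le> j" "x \<in> space M"
  shows "avg j (\<lambda>y. g y * avg i f y) x = avg j (\<lambda>y. g y * f y) x"
proof -
  have "adapted i (\<lambda>y. g y * indicator (cube j x) y)"
    unfolding adapted_def
  proof safe
    fix u v assume "u \<in> space M" "v \<in> cube i u"
    moreover from this have "u \<in> cube j x \<longleftrightarrow> v \<in> cube j x"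
      using cube_mono[OF _ \<open>i \<le> j\<close>] cube_eq cube_self cube_space \<open>x \<in> space M\<close> by (metis subsetD)
    ultimately show "g v * indicator (cube j x) v = g u * indicator (cube j x) u"
      using adaptedD[OF g, of u v] by (simp add: indicator_def)
  qed
  from nn_integral_adapted_mult_avg[OF this assms(2)] show ?thesis
    by (simp add: mean_def mult_ac)
qed

lemma avg_le_Suc:
  assumes "x \<in> space M" "emeasure M (cube (Suc j) x) \<le> ennreal C * emeasure M (cube j x)" "0 < C"
  shows "avg j f x \<le> ennreal C * avg (Suc j) f x"
  using assms cube_Suc cube_pos cube_fin by (intro mean_subset) auto

text \<open>
  Doob's weak type inequality for arbitrary stopping rules: on each cube where the rule first fires,
  seen from the coarsest level, the average of \<open>s\<close> is at most that of \<open>f\<close>, and these cubes are disjoint.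
  The weight \<open>g\<close> localizes the statement to a cube of level \<open>n\<close>.
\<close>
lemma maximal_inequality:
  assumes [measurable]: "f \<in> borel_measurable M" "s \<in> borel_measurable M"
    and P: "\<And>j. j < n \<Longrightarrow> adapted j (P j)"
    and le: "\<And>j x. j < n \<Longrightarrow> x \<in> space M \<Longrightarrow> P j x \<Longrightarrow> avg j s x \<le> avg j f x"
    and g: "adapted n g"
  shows "(\<integral>\<^sup>+x. g x * (s x * indicator {x. \<exists>j<n. P j x} x) \<partial>M) \<le> (\<integral>\<^sup>+x. g x * (f x * indicator {x. \<exists>j<n. P j x} x) \<partial>M)"
proof -
  define T where "T j = {x. P j x \<and> (\<forall>k. j < k \<and> k < n \<longrightarrow> \<not> P k x)}" for j
  have ind: "(indicator {x. \<exists>j<n. P j x} x :: ennreal) = (\<Sum>j<n. indicator (T j) x)" for x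
    unfolding T_def by (rule indicator_Ex_eq_sum_last)
  have gT: "adapted j (\<lambda>x. g x * indicator (T j) x)" if "j < n" for j
  proof -
    have "g y = g x" "(y \<in> T j) = (x \<in> T j)" if xy: "x \<in> space M" "y \<in> cube j x" for x y
    proof -
      show "g y = g x" using \<open>j < n\<close> xy adaptedD[OF adapted_mono[OF g, of j], of x y] by simp
      have "P k y = P k x" if "j \<le> k" "k < n" for k
        using xy that adaptedD[OF adapted_mono[OF P, of k j], of x y] by simp
      then show "(y \<in> T j) = (x \<in> T j)" using \<open>j < n\<close> unfolding T_def mem_Collect_eq
        by (meson le_refl less_imp_le)
    qed
    note const = this
    show ?thesis unfolding adapted_def
    proof safe
      fix x y assume "x \<in> space M" "y \<in> cube j x"
      then show "g y * indicator (T j) y = g x * indicator (T j) x"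
        using const[of x y] by (simp add: indicator_def)
    qed
  qed
  have meas: "(\<lambda>x. g x * indicator (T j) x) \<in> borel_measurable M" if "j < n" for j
    by (rule adapted_measurable[OF gT[OF that]]) auto
  have split: "(\<integral>\<^sup>+x. g x * (h x * indicator {x. \<exists>j<n. P j x} x) \<partial>M) = (\<Sum>j<n. \<integral>\<^sup>+x. (g x * indicator (T j) x) * avg j h x \<partial>M)"
    if [measurable]: "h \<in> borel_measurable M" for h
  proof -
    have "(\<integral>\<^sup>+x. g x * (h x * indicator {x. \<exists>j<n. P j x} x) \<partial>M) = (\<integral>\<^sup>+x. (\<Sum>j<n. (g x * indicator (T j) x) * h x) \<partial>M)"
      by (rule nn_integral_cong, subst ind, simp only: sum_distrib_left mult.assoc, simp only: mult.commute[of "h _"])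
    also have "\<dots> = (\<Sum>j<n. \<integral>\<^sup>+x. (g x * indicator (T j) x) * h x \<partial>M)"
      by (rule nn_integral_sum) (simp add: borel_measurable_times_ennreal[OF meas that])
    also have "\<dots> = (\<Sum>j<n. \<integral>\<^sup>+x. (g x * indicator (T j) x) * avg j h x \<partial>M)"
      by (rule sum.cong[OF refl]) (simp only: lessThan_iff nn_integral_adapted_mult_avg[OF gT that])
    finally show ?thesis .
  qed
  show ?thesis unfolding split[OF assms(1)] split[OF assms(2)]
  proof (intro sum_mono nn_integral_mono)
    fix j x assume "j \<in> {..<n}" "x \<in> space M"
    then show "g x * indicator (T j) x * avg j s x \<le> g x * indicator (T j) x * avg j f x"
      using le[of j x] by (cases "x \<in> T j") (auto simp: T_def intro!: mult_left_mono)
  qed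
qed

end


section \<open>The weighted dyadic maximal function\<close>

lemma ennreal_unbounded:
  assumes "\<And>b. 0 \<le> b \<Longrightarrow> ennreal b \<le> x"
  shows "x = top"
proof (cases x)
  case (real c)
  then show ?thesis using assms[of "c + 1"] by simp
qed

text \<open>
  The layer cake formula. For \<open>a < 1\<close> the integrand is unbounded at the origin.
\<close>
lemma nn_integral_powr_layer:
  fixes a :: real and z :: ennreal
  assumes "0 < a"
  shows "(\<integral>\<^sup>+t. ennreal (a * t powr (a - 1)) * indicator {t. 0 < t \<and> ennreal t < z} t \<partial>lborel) = epowr z a"
proof -
  have fin: "(\<integral>\<^sup>+t. ennreal (a * t powr (a - 1)) * indicator {t. 0 < t \<and> ennreal t < ennreal c} t \<partial>lborel) = ennreal (c powr a)"
    if c: "0 \<le> c" for c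
  proof -
    have "((\<lambda>t. a * t powr (a - 1)) has_integral a * (c powr (a - 1 + 1) / (a - 1 + 1))) {0..c}"
      using assms c by (intro has_integral_mult_right has_integral_powr_from_0) auto
    then have "((\<lambda>t. a * t powr (a - 1)) has_integral c powr a) {0..c}"
      using assms by simp
    then have "(\<integral>\<^sup>+t. ennreal (a * t powr (a - 1)) * indicator {0..c} t \<partial>lborel) = ennreal (c powr a)"
      using assms by (intro nn_integral_has_integral_lebesgue' ) (auto simp: )
    moreover have "(\<integral>\<^sup>+t. ennreal (a * t powr (a - 1)) * indicator {t. 0 < t \<and> ennreal t < ennreal c} t \<partial>lborel)
        = (\<integral>\<^sup>+t. ennreal (a * t powr (a - 1)) * indicator {0..c} t \<partial>lborel)"
    proof (intro nn_integral_cong_AE)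
      have "AE t in lborel. t \<noteq> 0 \<and> t \<noteq> c"
        using AE_lborel_singleton[of 0] AE_lborel_singleton[of c] by eventually_elim auto
      then show "AE t in lborel. ennreal (a * t powr (a - 1)) * indicator {t. 0 < t \<and> ennreal t < ennreal c} t
          = ennreal (a * t powr (a - 1)) * indicator {0..c} t"
        by eventually_elim (auto simp: indicator_def ennreal_less_iff)
    qed
    ultimately show ?thesis by simp
  qed
  show ?thesis
  proof (cases z)
    case (real c)
    then show ?thesis using fin[of c] by (simp add: epowr_ennreal)
  next
    case top
    have "ennreal b \<le> (\<integral>\<^sup>+t. ennreal (a * t powr (a - 1)) * indicator {t. 0 < t \<and> ennreal t < z} t \<partial>lborel)" if "0 \<le> b" for b
    proof -
      have "ennreal b = ennreal ((b powr (1 / a)) powr a)" using that assms by (simp add: powr_powr)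
      also have "\<dots> \<le> (\<integral>\<^sup>+t. ennreal (a * t powr (a - 1)) * indicator {t. 0 < t \<and> ennreal t < z} t \<partial>lborel)"
        unfolding fin[of "b powr (1 / a)", OF powr_ge_zero, symmetric] using top
        by (intro nn_integral_mono) (auto simp: indicator_def)
      finally show ?thesis .
    qed
    then have "(\<integral>\<^sup>+t. ennreal (a * t powr (a - 1)) * indicator {t. 0 < t \<and> ennreal t < z} t \<partial>lborel) = top"
      by (rule ennreal_unbounded)
    then show ?thesis using top by simp
  qed
qed

context nested_partitions
begin

lemma sigma_finite: "sigma_finite_measure M"
proof
  show "\<exists>A. countable A \<and> A \<subseteq> sets M \<and> \<Union> A = space M \<and> (\<forall>a\<in>A. emeasure M a \<noteq> \<infinity>)"
  proof (intro exI[of _ "cube 0 ` space M"] conjI ballI)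
    show "\<Union> (cube 0 ` space M) = space M"
      using cube_self[of _ 0] cube_space[of _ _ 0] by blast
  qed (use cube_countable cube_sets cube_fin in auto)
qed

text \<open>
  The maximal operator of the measure \<open>\<sigma> d\<mu>\<close> on a nested family of cubes is bounded on \<open>L\<^sup>p(\<sigma>)\<close> with a
  constant that does not see \<open>\<sigma>\<close>. This independence is the reason for working with cubes: for balls
  the constant would involve the doubling constant of \<open>\<sigma>\<close>, and the sharp power would be lost.
\<close>
lemma Doob_maximal_inequality:
  fixes \<sigma> f :: "'a \<Rightarrow> ennreal" and n :: nat
  assumes [measurable]: "\<sigma> \<in> borel_measurable M" "f \<in> borel_measurable M" and p: "1 < p"
    and fin: "\<And>j x. x \<in> space M \<Longrightarrow> avg j \<sigma> x \<noteq> top"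
  defines "Z \<equiv> \<lambda>x. SUP j\<in>{..<n}. avg j (\<lambda>y. f y * \<sigma> y) x / avg j \<sigma> x"
  shows "(\<integral>\<^sup>+x. epowr (Z x) p * \<sigma> x \<partial>M) \<le> ennreal (2 powr p * (p / (p - 1))) * (\<integral>\<^sup>+x. epowr (f x) p * \<sigma> x \<partial>M)"
proof -
  interpret sigma_finite_measure M by (rule sigma_finite)
  interpret pair_sigma_finite M "lborel :: real measure" ..
  have [measurable]: "Z \<in> borel_measurable M" unfolding Z_def by measurable
  \<comment> \<open>The part of \<open>f\<close> below \<open>t\<close> contributes at most \<open>t\<close> to an average, whence the factor 2.\<close>
  have weak: "ennreal t * (\<integral>\<^sup>+x. \<sigma> x * indicator {x. ennreal t < Z x / 2} x \<partial>M) \<le> (\<integral>\<^sup>+x. f x * \<sigma> x * indicator {x. ennreal t < f x} x \<partial>M)"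
    if t: "0 < t" for t
  proof -
    let ?F = "\<lambda>y. f y * \<sigma> y * indicator {y. ennreal t < f y} y"
    let ?P = "\<lambda>j x. 2 * ennreal t < avg j (\<lambda>y. f y * \<sigma> y) x / avg j \<sigma> x"
    have "(\<integral>\<^sup>+x. 1 * (ennreal t * \<sigma> x * indicator {x. \<exists>j<n. ?P j x} x) \<partial>M) \<le> (\<integral>\<^sup>+x. 1 * (?F x * indicator {x. \<exists>j<n. ?P j x} x) \<partial>M)"
    proof (rule maximal_inequality)
      fix j assume "j < n"
      show "adapted j (?P j)"
        by (rule adapted_cube)
      fix x assume x: "x \<in> space M" and P: "?P j x"
      have pos: "avg j \<sigma> x \<noteq> 0 \<or> avg j (\<lambda>y. f y * \<sigma> y) x \<noteq> 0" using P by auto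
      have "avg j (\<lambda>y. f y * \<sigma> y) x \<le> avg j (\<lambda>y. ennreal t * \<sigma> y + ?F y) x"
        by (intro mean_mono) (auto simp: indicator_def intro!: mult_right_mono)
      also have "\<dots> = ennreal t * avg j \<sigma> x + avg j ?F x"
        using x by (simp add: mean_add mean_cmult cube_sets)
      finally have le: "avg j (\<lambda>y. f y * \<sigma> y) x \<le> ennreal t * avg j \<sigma> x + avg j ?F x" .
      have ge: "2 * ennreal t * avg j \<sigma> x \<le> avg j (\<lambda>y. f y * \<sigma> y) x"
      proof (cases "avg j \<sigma> x = 0")
        case False
        have "2 * ennreal t * avg j \<sigma> x \<le> avg j (\<lambda>y. f y * \<sigma> y) x / avg j \<sigma> x * avg j \<sigma> x"
          using P by (intro mult_right_mono) auto
        then show ?thesis using False fin[OF x] by (simp add: ennreal_mult_divide_cancel)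
      qed simp
      have "ennreal t * avg j \<sigma> x + ennreal t * avg j \<sigma> x \<le> ennreal t * avg j \<sigma> x + avg j ?F x"
        using order_trans[OF ge le] by (simp add: mult_2 distrib_right)
      moreover have "ennreal t * avg j \<sigma> x \<noteq> top" using fin[OF x] by (simp add: ennreal_mult_eq_top_iff)
      ultimately have "ennreal t * avg j \<sigma> x \<le> avg j ?F x" by (simp add: ennreal_add_left_cancel_le)
      then show "avg j (\<lambda>y. ennreal t * \<sigma> y) x \<le> avg j ?F x"
        using x by (simp add: mean_cmult cube_sets)
    qed (auto simp: adapted_def)
    also have "\<dots> \<le> (\<integral>\<^sup>+x. ?F x \<partial>M)"
      by (intro nn_integral_mono) (auto simp: indicator_def)
    finally have "(\<integral>\<^sup>+x. ennreal t * (\<sigma> x * indicator {x. \<exists>j<n. ?P j x} x) \<partial>M) \<le> (\<integral>\<^sup>+x. ?F x \<partial>M)"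
      by (simp add: mult.assoc)
    moreover have "{x. ennreal t < Z x / 2} = {x. \<exists>j<n. ?P j x}"
    proof -
      have "ennreal t < u / 2 \<longleftrightarrow> 2 * ennreal t < u" for u :: ennreal
      proof -
        have "u / 2 \<le> ennreal t \<longleftrightarrow> u \<le> 2 * ennreal t"
        proof
          assume "u / 2 \<le> ennreal t"
          then have "2 * (u / 2) \<le> 2 * ennreal t" by (intro mult_left_mono) auto
          then show "u \<le> 2 * ennreal t" by (simp add: ennreal_mult_divide_cancel)
        next
          assume "u \<le> 2 * ennreal t"
          then have "u / 2 \<le> 2 * ennreal t / 2" by (rule divide_right_mono_ennreal)
          then show "u / 2 \<le> ennreal t" by (simp add: ennreal_mult_divide_cancel)
        qed
        then show ?thesis by (simp flip: not_le)
      qed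
      then show ?thesis by (auto simp: Z_def less_SUP_iff)
    qed
    ultimately show ?thesis by (subst nn_integral_cmult[symmetric]) (simp_all add: )
  qed
  have "(\<integral>\<^sup>+x. epowr (Z x / 2) p * \<sigma> x \<partial>M) = (\<integral>\<^sup>+x. (\<integral>\<^sup>+t. ennreal (p * t powr (p - 1)) * indicator {t. 0 < t \<and> ennreal t < Z x / 2} t \<partial>lborel) * \<sigma> x \<partial>M)"
    using p by (subst nn_integral_powr_layer) auto
  also have "\<dots> = (\<integral>\<^sup>+x. (\<integral>\<^sup>+t. ennreal (p * t powr (p - 1)) * indicator {t. 0 < t \<and> ennreal t < Z x / 2} t * \<sigma> x \<partial>lborel) \<partial>M)"
    by (intro nn_integral_cong nn_integral_multc[symmetric]) measurable
  also have "\<dots> = (\<integral>\<^sup>+t. (\<integral>\<^sup>+x. ennreal (p * t powr (p - 1)) * indicator {t. 0 < t \<and> ennreal t < Z x / 2} t * \<sigma> x \<partial>M) \<partial>lborel)"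
    by (rule Fubini'[symmetric]) measurable
  also have "\<dots> \<le> (\<integral>\<^sup>+t. (\<integral>\<^sup>+x. ennreal (p / (p - 1)) * (f x * \<sigma> x) * (ennreal ((p - 1) * t powr (p - 1 - 1)) * indicator {t. 0 < t \<and> ennreal t < f x} t) \<partial>M) \<partial>lborel)"
  proof (rule nn_integral_mono)
    fix t :: real
    show "(\<integral>\<^sup>+x. ennreal (p * t powr (p - 1)) * indicator {t. 0 < t \<and> ennreal t < Z x / 2} t * \<sigma> x \<partial>M)
      \<le> (\<integral>\<^sup>+x. ennreal (p / (p - 1)) * (f x * \<sigma> x) * (ennreal ((p - 1) * t powr (p - 1 - 1)) * indicator {t. 0 < t \<and> ennreal t < f x} t) \<partial>M)"
    proof (cases "0 < t")
      case True
      have pw: "p * t powr (p - 1) = (p * t powr (p - 2)) * t"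
        using True powr_add[of t "p - 2" 1] by simp
      have "(\<integral>\<^sup>+x. ennreal (p * t powr (p - 1)) * indicator {t. 0 < t \<and> ennreal t < Z x / 2} t * \<sigma> x \<partial>M)
          = (\<integral>\<^sup>+x. ennreal (p * t powr (p - 1)) * (\<sigma> x * indicator {x. ennreal t < Z x / 2} x) \<partial>M)"
        using True by (intro nn_integral_cong) (auto simp: indicator_def)
      also have "\<dots> = ennreal (p * t powr (p - 1)) * (\<integral>\<^sup>+x. \<sigma> x * indicator {x. ennreal t < Z x / 2} x \<partial>M)"
        by (rule nn_integral_cmult) measurable
      also have "\<dots> = ennreal (p * t powr (p - 2)) * (ennreal t * (\<integral>\<^sup>+x. \<sigma> x * indicator {x. ennreal t < Z x / 2} x \<partial>M))"
        unfolding pw using True p by (simp add: ennreal_mult mult.assoc)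
      also have "\<dots> \<le> ennreal (p * t powr (p - 2)) * (\<integral>\<^sup>+x. f x * \<sigma> x * indicator {x. ennreal t < f x} x \<partial>M)"
        by (intro mult_left_mono weak True) auto
      also have "\<dots> = (\<integral>\<^sup>+x. ennreal (p * t powr (p - 2)) * (f x * \<sigma> x * indicator {x. ennreal t < f x} x) \<partial>M)"
        by (rule nn_integral_cmult[symmetric]) measurable
      also have "\<dots> = (\<integral>\<^sup>+x. ennreal (p / (p - 1)) * (f x * \<sigma> x) * (ennreal ((p - 1) * t powr (p - 1 - 1)) * indicator {t. 0 < t \<and> ennreal t < f x} t) \<partial>M)"
      proof (intro nn_integral_cong)
        fix x
        have "ennreal (p * t powr (p - 2)) = ennreal (p / (p - 1)) * ennreal ((p - 1) * t powr (p - 1 - 1))"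
          using p by (simp flip: ennreal_mult)
        then show "ennreal (p * t powr (p - 2)) * (f x * \<sigma> x * indicator {x. ennreal t < f x} x)
           = ennreal (p / (p - 1)) * (f x * \<sigma> x) * (ennreal ((p - 1) * t powr (p - 1 - 1)) * indicator {t. 0 < t \<and> ennreal t < f x} t)"
          using True by (simp add: indicator_def mult_ac)
      qed
      finally show ?thesis .
    qed simp
  qed
  also have "\<dots> = (\<integral>\<^sup>+x. (\<integral>\<^sup>+t. ennreal (p / (p - 1)) * (f x * \<sigma> x) * (ennreal ((p - 1) * t powr (p - 1 - 1)) * indicator {t. 0 < t \<and> ennreal t < f x} t) \<partial>lborel) \<partial>M)"
    by (rule Fubini') measurable
  also have "\<dots> = (\<integral>\<^sup>+x. ennreal (p / (p - 1)) * (f x * \<sigma> x) * epowr (f x) (p - 1) \<partial>M)"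
  proof (rule nn_integral_cong)
    fix x
    show "(\<integral>\<^sup>+t. ennreal (p / (p - 1)) * (f x * \<sigma> x) * (ennreal ((p - 1) * t powr (p - 1 - 1)) * indicator {t. 0 < t \<and> ennreal t < f x} t) \<partial>lborel)
      = ennreal (p / (p - 1)) * (f x * \<sigma> x) * epowr (f x) (p - 1)"
      (is "(\<integral>\<^sup>+t. ?C * ?h t \<partial>lborel) = _")
    proof -
      have "(\<integral>\<^sup>+t. ?C * ?h t \<partial>lborel) = ?C * (\<integral>\<^sup>+t. ?h t \<partial>lborel)"
        by (rule nn_integral_cmult) measurable
      also have "(\<integral>\<^sup>+t. ?h t \<partial>lborel) = epowr (f x) (p - 1)"
        by (rule nn_integral_powr_layer) (use p in simp)
      finally show ?thesis .
    qed
  qed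
  also have "\<dots> = (\<integral>\<^sup>+x. ennreal (p / (p - 1)) * (epowr (f x) p * \<sigma> x) \<partial>M)"
  proof (intro nn_integral_cong)
    fix x
    have "f x * epowr (f x) (p - 1) = epowr (f x) p"
      using epowr_add[of "f x" 1 "p - 1"] by simp
    then show "ennreal (p / (p - 1)) * (f x * \<sigma> x) * epowr (f x) (p - 1) = ennreal (p / (p - 1)) * (epowr (f x) p * \<sigma> x)"
      by (metis mult.assoc mult.commute)
  qed
  also have "\<dots> = ennreal (p / (p - 1)) * (\<integral>\<^sup>+x. epowr (f x) p * \<sigma> x \<partial>M)"
    by (rule nn_integral_cmult) measurable
  finally have half: "(\<integral>\<^sup>+x. epowr (Z x / 2) p * \<sigma> x \<partial>M) \<le> ennreal (p / (p - 1)) * (\<integral>\<^sup>+x. epowr (f x) p * \<sigma> x \<partial>M)" .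
  have "epowr (Z x) p = ennreal (2 powr p) * epowr (Z x / 2) p" for x
  proof -
    have "Z x = 2 * (Z x / 2)" by (simp add: ennreal_mult_divide_cancel)
    then have "epowr (Z x) p = epowr 2 p * epowr (Z x / 2) p" by (metis epowr_mult)
    moreover have "epowr 2 p = ennreal (2 powr p)" using epowr_ennreal[of 2 p] by simp
    ultimately show ?thesis by simp
  qed
  then have "(\<integral>\<^sup>+x. epowr (Z x) p * \<sigma> x \<partial>M) = ennreal (2 powr p) * (\<integral>\<^sup>+x. epowr (Z x / 2) p * \<sigma> x \<partial>M)"
    by (subst nn_integral_cmult[symmetric]) (auto simp: mult.assoc)
  also have "\<dots> \<le> ennreal (2 powr p) * (ennreal (p / (p - 1)) * (\<integral>\<^sup>+x. epowr (f x) p * \<sigma> x \<partial>M))"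
    by (intro mult_left_mono half) auto
  also have "\<dots> = ennreal (2 powr p * (p / (p - 1))) * (\<integral>\<^sup>+x. epowr (f x) p * \<sigma> x \<partial>M)"
  proof -
    have "ennreal (2 powr p * (p / (p - 1))) = ennreal (2 powr p) * ennreal (p / (p - 1))"
      by (rule ennreal_mult) (use p in auto)
    then show ?thesis by (simp only: mult.assoc)
  qed
  finally show ?thesis .
qed

end


section \<open>Sparse operators\<close>

text \<open>
  A crude substitute for the triangle inequality, good enough where the number of summands is a
  constant of the space.
\<close>
lemma epowr_sum_le:
  assumes "finite J" "0 \<le> p"
  shows "epowr (\<Sum>j\<in>J. u j) p \<le> (\<Sum>j\<in>J. epowr (of_nat (card J) * u j) p)"
proof (cases "J = {}")
  case False
  obtain k where k: "k \<in> J" "\<And>j. j \<in> J \<Longrightarrow> u j \<le> u k"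
  proof -
    have fin: "finite (u ` J)" using assms(1) by simp
    from Max_in[OF this] False obtain k where "k \<in> J" "Max (u ` J) = u k" by auto
    then show thesis using that[of k] Max_ge[OF fin] by simp
  qed
  have "(\<Sum>j\<in>J. u j) \<le> of_nat (card J) * u k"
    using sum_mono[of J u "\<lambda>_. u k"] k by simp
  then have "epowr (\<Sum>j\<in>J. u j) p \<le> epowr (of_nat (card J) * u k) p"
    by (rule epowr_mono) fact
  also have "\<dots> \<le> (\<Sum>j\<in>J. epowr (of_nat (card J) * u j) p)"
    by (rule member_le_sum) (use k assms in auto)
  finally show ?thesis .
qed simp

lemma Hoelder_sum:
  assumes "finite J" "1 < p" "1 / p + 1 / q = 1"
  shows "(\<Sum>j\<in>J. u j * v j) \<le> epowr (\<Sum>j\<in>J. epowr (u j) p) (1 / p) * epowr (\<Sum>j\<in>J. epowr (v j) q) (1 / q)"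
  using Hoelder_nn_integral[of u "count_space J" v p q] assms
  by (simp add: nn_integral_count_space_finite)

text \<open>
  The last step of every duality argument: test a form bound with \<open>g = h\<^sup>p\<^sup>-\<^sup>1\<close>, so that the quantity
  \<open>I\<close> to be estimated reappears on the right with a power below one, and divide it out. Division is
  legitimate only once \<open>I\<close> is known to be finite.
\<close>
lemma ennreal_power_absorb:
  fixes I A :: ennreal
  assumes "I \<le> A * epowr I (1 / q)" "I \<noteq> top" "1 / p + 1 / q = 1"
  shows "epowr I (1 / p) \<le> A"
proof (cases "I = 0")
  case False
  have "epowr I (1 / p) * epowr I (1 / q) \<le> A * epowr I (1 / q)"
    using assms by (simp flip: epowr_add)
  then have "epowr I (1 / p) * epowr I (1 / q) / epowr I (1 / q) \<le> A * epowr I (1 / q) / epowr I (1 / q)"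
    by (rule divide_right_mono_ennreal)
  then show ?thesis using False assms by (simp add: ennreal_mult_divide_cancel)
qed simp

context nested_partitions
begin

text \<open>
  The sets \<open>G j\<close> will be pairwise disjoint, and a cube of level \<open>j\<close> contributes if \<open>G j\<close> fills at least
  the fraction \<open>c\<close> of it. This is the usual sparse operator, except that the family of cubes is
  recovered from the major subsets instead of the other way round; the sets \<open>G j\<close> may therefore
  come from another dyadic system.
\<close>
definition sparse :: "nat \<Rightarrow> real \<Rightarrow> (nat \<Rightarrow> 'a set) \<Rightarrow> ('a \<Rightarrow> ennreal) \<Rightarrow> 'a \<Rightarrow> ennreal" where
  "sparse n c G f x = (\<Sum>j<n. indicator {x. ennreal c \<le> avg j (indicator (G j)) x} x * avg j f x)"

lemma adapted_sparse_set: "adapted j (\<lambda>x. indicator {x. ennreal c \<le> avg j (indicator (G j)) x} x)"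
  using adapted_cube[of j "\<lambda>C. indicator {C. ennreal c \<le> mean M C (indicator (G j))} C"]
  by (simp add: indicator_def)

lemma sparse_measurable [measurable]: "sparse n c G f \<in> borel_measurable M"
proof -
  have "(\<lambda>x. \<Sum>j<n. indicator {x. ennreal c \<le> avg j (indicator (G j)) x} x * avg j f x) \<in> borel_measurable M"
    by (intro borel_measurable_sum borel_measurable_times_ennreal avg_measurable
        adapted_measurable[OF adapted_sparse_set]) auto
  then show ?thesis unfolding sparse_def[abs_def] .
qed

lemma nn_integral_sparse_mult:
  assumes [measurable]: "f \<in> borel_measurable M" "g \<in> borel_measurable M"
  shows "(\<integral>\<^sup>+x. sparse n c G f x * g x \<partial>M)
    = (\<integral>\<^sup>+x. (\<Sum>j<n. indicator {x. ennreal c \<le> avg j (indicator (G j)) x} x * (avg j f x * avg j g x)) \<partial>M)"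
proof -
  have ad: "adapted j (\<lambda>x. indicator {x. ennreal c \<le> avg j (indicator (G j)) x} x * avg j f x)" for j
    using adapted_cube[of j "\<lambda>C. indicator {C. ennreal c \<le> mean M C (indicator (G j))} C * mean M C f"]
    by (simp add: indicator_def)
  note [measurable] = adapted_measurable[OF ad, where N = borel, simplified]
  have "(\<integral>\<^sup>+x. sparse n c G f x * g x \<partial>M) = (\<integral>\<^sup>+x. (\<Sum>j<n. (indicator {x. ennreal c \<le> avg j (indicator (G j)) x} x * avg j f x) * g x) \<partial>M)"
    by (simp only: sparse_def sum_distrib_right)
  also have "\<dots> = (\<Sum>j<n. (\<integral>\<^sup>+x. (indicator {x. ennreal c \<le> avg j (indicator (G j)) x} x * avg j f x) * g x \<partial>M))"
    by (rule nn_integral_sum) measurable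
  also have "\<dots> = (\<Sum>j<n. (\<integral>\<^sup>+x. (indicator {x. ennreal c \<le> avg j (indicator (G j)) x} x * avg j f x) * avg j g x \<partial>M))"
    by (rule sum.cong[OF refl], rule nn_integral_adapted_mult_avg[OF ad, symmetric]) measurable
  also have "\<dots> = (\<integral>\<^sup>+x. (\<Sum>j<n. (indicator {x. ennreal c \<le> avg j (indicator (G j)) x} x * avg j f x) * avg j g x) \<partial>M)"
    by (rule nn_integral_sum[symmetric]) measurable
  finally show ?thesis by (simp only: mult.assoc)
qed

text \<open>
  The weighted averages are dominated by the maximal function, and each point lies in at most one
  of the sets \<open>G j\<close>.
\<close>
lemma Carleson_embedding:
  assumes [measurable]: "\<sigma> \<in> borel_measurable M" "f \<in> borel_measurable M" and p: "1 < p"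
    and fin: "\<And>j x. x \<in> space M \<Longrightarrow> avg j \<sigma> x \<noteq> top"
    and [measurable]: "\<And>j. G j \<in> sets M" and disj: "disjoint_family G"
  shows "(\<Sum>j<n. \<integral>\<^sup>+x. epowr (avg j (\<lambda>y. f y * \<sigma> y) x / avg j \<sigma> x) p * avg j (\<lambda>y. indicator (G j) y * \<sigma> y) x \<partial>M)
    \<le> ennreal (2 powr p * (p / (p - 1))) * (\<integral>\<^sup>+x. epowr (f x) p * \<sigma> x \<partial>M)"
proof -
  let ?X = "\<lambda>j x. avg j (\<lambda>y. f y * \<sigma> y) x / avg j \<sigma> x"
  define Z where "Z x = (SUP j\<in>{..<n}. ?X j x)" for x
  have [measurable]: "Z \<in> borel_measurable M" unfolding Z_def by measurable
  have "(\<Sum>j<n. \<integral>\<^sup>+x. epowr (?X j x) p * avg j (\<lambda>y. indicator (G j) y * \<sigma> y) x \<partial>M)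
      = (\<Sum>j<n. \<integral>\<^sup>+x. epowr (?X j x) p * (indicator (G j) x * \<sigma> x) \<partial>M)"
    by (rule sum.cong[OF refl], rule nn_integral_adapted_mult_avg[OF adapted_cube]) measurable
  also have "\<dots> \<le> (\<Sum>j<n. \<integral>\<^sup>+x. epowr (Z x) p * \<sigma> x * indicator (G j) x \<partial>M)"
  proof (intro sum_mono)
    fix j assume j: "j \<in> {..<n}"
    show "(\<integral>\<^sup>+x. epowr (?X j x) p * (indicator (G j) x * \<sigma> x) \<partial>M) \<le> (\<integral>\<^sup>+x. epowr (Z x) p * \<sigma> x * indicator (G j) x \<partial>M)"
    proof (rule nn_integral_mono)
      fix x
      have "epowr (?X j x) p \<le> epowr (Z x) p"
        unfolding Z_def using p by (intro epowr_mono SUP_upper j) auto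
      then show "epowr (?X j x) p * (indicator (G j) x * \<sigma> x) \<le> epowr (Z x) p * \<sigma> x * indicator (G j) x"
        by (auto simp: indicator_def intro!: mult_right_mono)
    qed
  qed
  also have "\<dots> = (\<integral>\<^sup>+x. (\<Sum>j<n. epowr (Z x) p * \<sigma> x * indicator (G j) x) \<partial>M)"
    by (rule nn_integral_sum[symmetric]) measurable
  also have "\<dots> = (\<integral>\<^sup>+x. epowr (Z x) p * \<sigma> x * indicator (\<Union>j<n. G j) x \<partial>M)"
    using disjoint_family_on_mono[OF _ disj, of "{..<n}"]
    by (simp add: sum_distrib_left[symmetric] indicator_UN_disjoint)
  also have "\<dots> \<le> (\<integral>\<^sup>+x. epowr (Z x) p * \<sigma> x \<partial>M)"
    by (intro nn_integral_mono) (auto simp: indicator_def)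
  also have "\<dots> \<le> ennreal (2 powr p * (p / (p - 1))) * (\<integral>\<^sup>+x. epowr (f x) p * \<sigma> x \<partial>M)"
    unfolding Z_def by (rule Doob_maximal_inequality[OF assms(1-3) fin])
  finally show ?thesis .
qed

definition Doob_const :: "real \<Rightarrow> ennreal" where
  "Doob_const p = ennreal (2 powr p * (p / (p - 1)))"

text \<open>
  The proof of the sharp weighted bound for sparse operators by testing against a second function.
  With averages \<open>a\<close> of \<open>\<sigma>\<close> and \<open>v\<close> of \<open>w\<close>, and \<open>\<alpha>\<close>, \<open>\<beta>\<close> those restricted to \<open>G j\<close>, Hoelder's inequality gives
  \<open>c \<le> \<beta>\<^bsup>1/p\<^esup> \<alpha>\<^bsup>1/q\<^esup>\<close>, hence \<open>c\<^bsup>p-1\<^esup> \<le> \<beta>\<^bsup>1/q\<^esup> \<alpha>\<^bsup>p-2\<^esup> \<alpha>\<^bsup>1/p\<^esup>\<close>. For \<open>p \<ge> 2\<close> one may replace \<open>\<alpha>\<^bsup>p-2\<^esup>\<close> by \<open>a\<^bsup>p-2\<^esup>\<close>, and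
  the factor \<open>v a\<close> of the form turns into \<open>v a\<^bsup>p-1\<^esup> \<le> W\<close>: the weight characteristic enters once. What
  remains is a sum over the disjoint sets \<open>G j\<close>, ready for Carleson embedding.
\<close>
lemma sparse_form_bound:
  fixes \<sigma> w f g :: "'a \<Rightarrow> ennreal" and p q c :: real
  assumes [measurable]: "\<sigma> \<in> borel_measurable M" "w \<in> borel_measurable M" "f \<in> borel_measurable M" "g \<in> borel_measurable M"
    and p: "2 \<le> p" "1 / p + 1 / q = 1" and c: "0 < c"
    and sig: "\<And>j x. x \<in> space M \<Longrightarrow> avg j \<sigma> x \<noteq> 0 \<and> avg j \<sigma> x \<noteq> top"
    and w: "\<And>j x. x \<in> space M \<Longrightarrow> avg j w x \<noteq> 0 \<and> avg j w x \<noteq> top"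
    and W: "\<And>j x. x \<in> space M \<Longrightarrow> avg j w x * epowr (avg j \<sigma> x) (p - 1) \<le> W"
    and dual: "AE x in M. 1 \<le> epowr (w x) (1 / p) * epowr (\<sigma> x) (1 / q)"
    and G [measurable]: "\<And>j. G j \<in> sets M" and disj: "disjoint_family G"
  shows "ennreal (c powr (p - 1)) * (\<integral>\<^sup>+x. (\<Sum>j<n. indicator {x. ennreal c \<le> avg j (indicator (G j)) x} x
      * (avg j (\<lambda>y. f y * \<sigma> y) x * avg j (\<lambda>y. g y * w y) x)) \<partial>M)
    \<le> W * (epowr (Doob_const p * (\<integral>\<^sup>+x. epowr (f x) p * \<sigma> x \<partial>M)) (1 / p) * epowr (Doob_const q * (\<integral>\<^sup>+x. epowr (g x) q * w x \<partial>M)) (1 / q))"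
proof -
  have p1: "1 < p" using p by simp
  note q = conjugate_exponent[OF p1 p(2)]
  let ?S = "\<lambda>j x. indicator {x. ennreal c \<le> avg j (indicator (G j)) x} x :: ennreal"
  let ?a = "\<lambda>j. avg j \<sigma>" and ?v = "\<lambda>j. avg j w"
  let ?\<alpha> = "\<lambda>j. avg j (\<lambda>y. indicator (G j) y * \<sigma> y)" and ?\<beta> = "\<lambda>j. avg j (\<lambda>y. indicator (G j) y * w y)"
  let ?X = "\<lambda>j x. avg j (\<lambda>y. f y * \<sigma> y) x / ?a j x" and ?Y = "\<lambda>j x. avg j (\<lambda>y. g y * w y) x / ?v j x"
  note [measurable] = adapted_measurable[OF adapted_sparse_set, where N = borel, simplified]
  \<comment> \<open>Weighted averages; Hoelder is applied to \<open>u\<close> and \<open>z\<close>, first in the sum and then in the integral.\<close>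
  let ?u = "\<lambda>j x. ?X j x * epowr (?\<alpha> j x) (1 / p)" and ?z = "\<lambda>j x. ?Y j x * epowr (?\<beta> j x) (1 / q)"
  have key: "ennreal (c powr (p - 1)) * (?S j x * (avg j (\<lambda>y. f y * \<sigma> y) x * avg j (\<lambda>y. g y * w y) x)) \<le> W * (?u j x * ?z j x)"
    if x: "x \<in> space M" for j x
  proof (cases "ennreal c \<le> avg j (indicator (G j)) x")
    case True
    have Q [simp]: "cube j x \<in> sets M" using x by (rule cube_sets)
    have "avg j (indicator (G j)) x \<le> avg j (\<lambda>y. epowr (indicator (G j) y * w y) (1 / p) * epowr (indicator (G j) y * \<sigma> y) (1 / q)) x"
      unfolding mean_def
    proof (intro divide_right_mono_ennreal nn_integral_mono_AE)
      show "AE y in M. indicator (G j) y * indicator (cube j x) y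
         \<le> epowr (indicator (G j) y * w y) (1 / p) * epowr (indicator (G j) y * \<sigma> y) (1 / q) * indicator (cube j x) y"
        using dual by eventually_elim (auto simp: indicator_def)
    qed
    also have "\<dots> \<le> epowr (?\<beta> j x) (1 / p) * epowr (?\<alpha> j x) (1 / q)"
      using mean_Hoelder[of "cube j x" M "\<lambda>y. epowr (indicator (G j) y * w y) (1 / p)" "\<lambda>y. epowr (indicator (G j) y * \<sigma> y) (1 / q)" p q]
        p p1 q cube_pos[OF x] cube_fin[OF x] by (simp add: epowr_epowr)
    finally have "ennreal c \<le> epowr (?\<beta> j x) (1 / p) * epowr (?\<alpha> j x) (1 / q)"
      using True by simp
    then have "epowr (ennreal c) (p - 1) \<le> epowr (epowr (?\<beta> j x) (1 / p) * epowr (?\<alpha> j x) (1 / q)) (p - 1)"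
      using p by (intro epowr_mono) auto
    also have "\<dots> = epowr (?\<beta> j x) (1 / q) * epowr (?\<alpha> j x) (p - 2 + 1 / p)"
    proof -
      have "1 / p * (p - 1) = 1 / q" "1 / q * (p - 1) = p - 2 + 1 / p"
        using p1 by (simp_all add: q(1) field_simps power2_eq_square)
      then show ?thesis by (simp only: epowr_mult epowr_epowr)
    qed
    also have "\<dots> \<le> epowr (?\<beta> j x) (1 / q) * (epowr (?a j x) (p - 2) * epowr (?\<alpha> j x) (1 / p))"
      unfolding epowr_add using p by (intro mult_left_mono mult_right_mono epowr_mono mean_mono) (auto simp: indicator_def)
    finally have cle: "ennreal (c powr (p - 1)) \<le> epowr (?\<beta> j x) (1 / q) * (epowr (?a j x) (p - 2) * epowr (?\<alpha> j x) (1 / p))"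
      using c by (simp add: epowr_ennreal)
    have a1: "?a j x * epowr (?a j x) (p - 2) = epowr (?a j x) (p - 1)"
      using epowr_add[of "?a j x" 1 "p - 2"] by simp
    have fX: "avg j (\<lambda>y. f y * \<sigma> y) x = ?X j x * ?a j x" and gY: "avg j (\<lambda>y. g y * w y) x = ?Y j x * ?v j x"
      using sig[OF x, of j] w[OF x, of j] by (simp_all add: ennreal_mult_divide_cancel)
    have "ennreal (c powr (p - 1)) * (avg j (\<lambda>y. f y * \<sigma> y) x * avg j (\<lambda>y. g y * w y) x)
        \<le> epowr (?\<beta> j x) (1 / q) * (epowr (?a j x) (p - 2) * epowr (?\<alpha> j x) (1 / p)) * (?X j x * ?a j x * (?Y j x * ?v j x))"
      unfolding fX[symmetric] gY[symmetric] by (intro mult_right_mono cle) auto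
    also have "\<dots> = ?v j x * (?a j x * epowr (?a j x) (p - 2)) * (?u j x * ?z j x)"
      by (simp only: mult_ac)
    also have "\<dots> \<le> W * (?u j x * ?z j x)"
      unfolding a1 by (intro mult_right_mono W x) auto
    finally show ?thesis using True by simp
  qed simp
  have "ennreal (c powr (p - 1)) * (\<integral>\<^sup>+x. (\<Sum>j<n. ?S j x * (avg j (\<lambda>y. f y * \<sigma> y) x * avg j (\<lambda>y. g y * w y) x)) \<partial>M)
      = (\<integral>\<^sup>+x. ennreal (c powr (p - 1)) * (\<Sum>j<n. ?S j x * (avg j (\<lambda>y. f y * \<sigma> y) x * avg j (\<lambda>y. g y * w y) x)) \<partial>M)"
    by (rule nn_integral_cmult[symmetric]) measurable
  also have "\<dots> \<le> (\<integral>\<^sup>+x. W * (epowr (\<Sum>j<n. epowr (?X j x) p * ?\<alpha> j x) (1 / p) * epowr (\<Sum>j<n. epowr (?Y j x) q * ?\<beta> j x) (1 / q)) \<partial>M)"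
  proof (rule nn_integral_mono)
    fix x assume x: "x \<in> space M"
    have "ennreal (c powr (p - 1)) * (\<Sum>j<n. ?S j x * (avg j (\<lambda>y. f y * \<sigma> y) x * avg j (\<lambda>y. g y * w y) x))
        \<le> (\<Sum>j<n. W * (?u j x * ?z j x))"
      unfolding sum_distrib_left by (intro sum_mono key x)
    also have "\<dots> = W * (\<Sum>j<n. ?u j x * ?z j x)" by (rule sum_distrib_left[symmetric])
    also have "(\<Sum>j<n. ?u j x * ?z j x) \<le> epowr (\<Sum>j<n. epowr (?u j x) p) (1 / p) * epowr (\<Sum>j<n. epowr (?z j x) q) (1 / q)"
      by (rule Hoelder_sum) (use p1 p in auto)
    finally show "ennreal (c powr (p - 1)) * (\<Sum>j<n. ?S j x * (avg j (\<lambda>y. f y * \<sigma> y) x * avg j (\<lambda>y. g y * w y) x))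
        \<le> W * (epowr (\<Sum>j<n. epowr (?X j x) p * ?\<alpha> j x) (1 / p) * epowr (\<Sum>j<n. epowr (?Y j x) q * ?\<beta> j x) (1 / q))"
      using p1 q(2) by (simp add: epowr_mult epowr_epowr mult_left_mono)
  qed
  also have "\<dots> = W * (\<integral>\<^sup>+x. epowr (\<Sum>j<n. epowr (?X j x) p * ?\<alpha> j x) (1 / p) * epowr (\<Sum>j<n. epowr (?Y j x) q * ?\<beta> j x) (1 / q) \<partial>M)"
    by (rule nn_integral_cmult) measurable
  also have "\<dots> \<le> W * (epowr (\<integral>\<^sup>+x. (\<Sum>j<n. epowr (?X j x) p * ?\<alpha> j x) \<partial>M) (1 / p) * epowr (\<integral>\<^sup>+x. (\<Sum>j<n. epowr (?Y j x) q * ?\<beta> j x) \<partial>M) (1 / q))"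
  proof (rule mult_left_mono)
    show "(\<integral>\<^sup>+x. epowr (\<Sum>j<n. epowr (?X j x) p * ?\<alpha> j x) (1 / p) * epowr (\<Sum>j<n. epowr (?Y j x) q * ?\<beta> j x) (1 / q) \<partial>M)
      \<le> epowr (\<integral>\<^sup>+x. (\<Sum>j<n. epowr (?X j x) p * ?\<alpha> j x) \<partial>M) (1 / p) * epowr (\<integral>\<^sup>+x. (\<Sum>j<n. epowr (?Y j x) q * ?\<beta> j x) \<partial>M) (1 / q)"
      using Hoelder_nn_integral[of "\<lambda>x. epowr (\<Sum>j<n. epowr (?X j x) p * ?\<alpha> j x) (1 / p)" M "\<lambda>x. epowr (\<Sum>j<n. epowr (?Y j x) q * ?\<beta> j x) (1 / q)" p q]
        p1 p(2) q(2) by (simp add: epowr_epowr)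
  qed simp
  also have "\<dots> \<le> W * (epowr (Doob_const p * (\<integral>\<^sup>+x. epowr (f x) p * \<sigma> x \<partial>M)) (1 / p) * epowr (Doob_const q * (\<integral>\<^sup>+x. epowr (g x) q * w x \<partial>M)) (1 / q))"
  proof (intro mult_left_mono mult_mono epowr_mono)
    show "(\<integral>\<^sup>+x. (\<Sum>j<n. epowr (?X j x) p * ?\<alpha> j x) \<partial>M) \<le> Doob_const p * (\<integral>\<^sup>+x. epowr (f x) p * \<sigma> x \<partial>M)"
      unfolding Doob_const_def
      by (subst nn_integral_sum) (measurable, intro Carleson_embedding disj p1, use sig in auto)
    show "(\<integral>\<^sup>+x. (\<Sum>j<n. epowr (?Y j x) q * ?\<beta> j x) \<partial>M) \<le> Doob_const q * (\<integral>\<^sup>+x. epowr (g x) q * w x \<partial>M)"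
      unfolding Doob_const_def
      by (subst nn_integral_sum) (measurable, intro Carleson_embedding disj q(2), use w in auto)
  qed (use p1 q(2) in auto)
  finally show ?thesis .
qed

end


section \<open>Weighted norms and the sharp bound for sparse operators\<close>

definition wnorm :: "'a measure \<Rightarrow> real \<Rightarrow> ('a \<Rightarrow> ennreal) \<Rightarrow> ('a \<Rightarrow> ennreal) \<Rightarrow> ennreal" where
  "wnorm M p w f = epowr (\<integral>\<^sup>+x. epowr (f x) p * w x \<partial>M) (1 / p)"

lemma wnorm_mono_AE: "0 < p \<Longrightarrow> AE x in M. f x \<le> g x \<Longrightarrow> wnorm M p w f \<le> wnorm M p w g"
  unfolding wnorm_def
  by (intro epowr_mono nn_integral_mono_AE) (auto elim!: eventually_mono intro!: mult_right_mono epowr_mono)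

lemma wnorm_mono: "0 < p \<Longrightarrow> (\<And>x. x \<in> space M \<Longrightarrow> f x \<le> g x) \<Longrightarrow> wnorm M p w f \<le> wnorm M p w g"
  by (rule wnorm_mono_AE) auto

lemma wnorm_cmult:
  assumes "0 < p" and [measurable]: "f \<in> borel_measurable M" "w \<in> borel_measurable M"
  shows "wnorm M p w (\<lambda>x. c * f x) = c * wnorm M p w f"
proof -
  have "(\<integral>\<^sup>+x. epowr (c * f x) p * w x \<partial>M) = epowr c p * (\<integral>\<^sup>+x. epowr (f x) p * w x \<partial>M)"
    by (simp add: epowr_mult mult.assoc nn_integral_cmult)
  then show ?thesis using assms(1) by (simp add: wnorm_def epowr_mult epowr_epowr)
qed

lemma wnorm_sum_le:
  assumes "finite J" "0 < p" and [measurable]: "w \<in> borel_measurable M" "\<And>t. t \<in> J \<Longrightarrow> f t \<in> borel_measurable M"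
    and bound: "\<And>t. t \<in> J \<Longrightarrow> wnorm M p w (f t) \<le> A"
  shows "wnorm M p w (\<lambda>x. \<Sum>t\<in>J. f t x) \<le> epowr (of_nat (card J)) (1 / p) * of_nat (card J) * A"
proof -
  have *: "(\<integral>\<^sup>+x. epowr (f t x) p * w x \<partial>M) \<le> epowr A p" if "t \<in> J" for t
    using bound[OF that] \<open>0 < p\<close> by (simp add: wnorm_def epowr_inverse)
  have "(\<integral>\<^sup>+x. epowr (\<Sum>t\<in>J. f t x) p * w x \<partial>M) \<le> (\<integral>\<^sup>+x. (\<Sum>t\<in>J. epowr (of_nat (card J)) p * (epowr (f t x) p * w x)) \<partial>M)"
  proof (rule nn_integral_mono)
    fix x
    have "epowr (\<Sum>t\<in>J. f t x) p * w x \<le> (\<Sum>t\<in>J. epowr (of_nat (card J) * f t x) p) * w x"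
      using assms by (intro mult_right_mono epowr_sum_le) auto
    then show "epowr (\<Sum>t\<in>J. f t x) p * w x \<le> (\<Sum>t\<in>J. epowr (of_nat (card J)) p * (epowr (f t x) p * w x))"
      by (simp add: epowr_mult sum_distrib_right mult.assoc)
  qed
  also have "\<dots> = (\<Sum>t\<in>J. epowr (of_nat (card J)) p * (\<integral>\<^sup>+x. epowr (f t x) p * w x \<partial>M))"
    by (subst nn_integral_sum) (auto intro!: sum.cong nn_integral_cmult)
  also have "\<dots> \<le> (\<Sum>t\<in>J. epowr (of_nat (card J)) p * epowr A p)"
    by (intro sum_mono mult_left_mono *) auto
  also have "\<dots> = of_nat (card J) * (epowr (of_nat (card J)) p * epowr A p)" by simp
  finally have "wnorm M p w (\<lambda>x. \<Sum>t\<in>J. f t x) \<le> epowr (of_nat (card J) * (epowr (of_nat (card J)) p * epowr A p)) (1 / p)"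
    unfolding wnorm_def using assms(2) by (intro epowr_mono) auto
  then show ?thesis using assms(2) by (simp add: epowr_mult epowr_epowr mult.assoc)
qed

text \<open>
  The product of the two maximal function constants of \<open>p\<close> and its conjugate exponent
  \<open>p / (p - 1)\<close>, times the loss from the sparseness fraction \<open>c\<close>.
\<close>
definition sparse_const :: "real \<Rightarrow> real \<Rightarrow> ennreal" where
  "sparse_const p c = ennreal (c powr (- max (p - 1) (1 / (p - 1))))
    * (epowr (ennreal (2 powr p * (p / (p - 1)))) (1 / p) * epowr (ennreal (2 powr (p / (p - 1)) * p)) ((p - 1) / p))"

lemma sparse_const_finite: "sparse_const p c \<noteq> top" and sparse_const_pos: "1 < p \<Longrightarrow> 0 < c \<Longrightarrow> sparse_const p c \<noteq> 0"
  by (auto simp: sparse_const_def ennreal_mult_eq_top_iff)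

context nested_partitions
begin

text \<open>
  The \<open>A\<^sub>p\<close> condition on cubes for a weight together with its dual weight. Keeping \<open>\<sigma>\<close> as a separate
  function makes the condition symmetric under exchanging \<open>(p, w)\<close> with \<open>(q, \<sigma>)\<close>. Bounds on \<open>W\<close> and on
  the averages exclude the products of zero and infinity.
\<close>
definition dyadic_Ap :: "real \<Rightarrow> ('a \<Rightarrow> ennreal) \<Rightarrow> ('a \<Rightarrow> ennreal) \<Rightarrow> ennreal \<Rightarrow> bool" where
  "dyadic_Ap p w \<sigma> W \<longleftrightarrow> w \<in> borel_measurable M \<and> \<sigma> \<in> borel_measurable M \<and>
    (AE x in M. w x * epowr (\<sigma> x) (p - 1) = 1) \<and>
    (\<forall>j. \<forall>x\<in>space M. avg j w x \<noteq> 0 \<and> avg j w x \<noteq> top \<and> avg j \<sigma> x \<noteq> 0 \<and> avg j \<sigma> x \<noteq> top \<and>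
      avg j w x * epowr (avg j \<sigma> x) (p - 1) \<le> W) \<and> W \<noteq> 0 \<and> W \<noteq> top"

text \<open>
  For \<open>p \<ge> 2\<close> the form bound applies as it stands. For \<open>p < 2\<close> it is applied to the conjugate exponent
  with the two weights exchanged: the form is symmetric, and the characteristic of \<open>\<sigma>\<close> is the power
  \<open>1 / (p - 1)\<close> of that of \<open>w\<close>. This is where the exponent of the theorem comes from.
\<close>
lemma sparse_bound:
  assumes Ap: "dyadic_Ap p w \<sigma> W" and p: "1 < p" and c: "0 < c"
    and G [measurable]: "\<And>j. G j \<in> sets M" and disj: "disjoint_family G"
    and F [measurable]: "F \<in> borel_measurable M"
  shows "wnorm M p w (sparse n c G F) \<le> sparse_const p c * epowr W (max 1 (1 / (p - 1))) * wnorm M p w F"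
proof -
  define q where "q = p / (p - 1)"
  have pq: "1 / p + 1 / q = 1" using p by (simp add: q_def field_simps)
  note q = conjugate_exponent[OF p pq]
  have q1: "q - 1 = 1 / (p - 1)" "1 / q = (p - 1) / p" "q / (q - 1) = p"
    using p by (simp_all add: q_def field_simps)
  have [measurable]: "w \<in> borel_measurable M" "\<sigma> \<in> borel_measurable M"
    and dual: "AE x in M. w x * epowr (\<sigma> x) (p - 1) = 1"
    and fin: "\<And>j x. x \<in> space M \<Longrightarrow> avg j w x \<noteq> 0 \<and> avg j w x \<noteq> top"
      "\<And>j x. x \<in> space M \<Longrightarrow> avg j \<sigma> x \<noteq> 0 \<and> avg j \<sigma> x \<noteq> top"
    and W: "\<And>j x. x \<in> space M \<Longrightarrow> avg j w x * epowr (avg j \<sigma> x) (p - 1) \<le> W" and W0: "W \<noteq> 0" "W \<noteq> top"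
    using Ap by (auto simp: dyadic_Ap_def)
  \<comment> \<open>The norm of \<open>F\<close> with weight \<open>w\<close> is that of \<open>f\<close> with weight \<open>\<sigma>\<close>.\<close>
  define f where "f x = F x / \<sigma> x" for x
  have [measurable]: "f \<in> borel_measurable M" unfolding f_def by measurable
  have ae: "AE x in M. f x * \<sigma> x = F x \<and> epowr (f x) p * \<sigma> x = epowr (F x) p * w x"
    using dual
  proof eventually_elim
    case (elim x)
    have s: "\<sigma> x \<noteq> 0" "\<sigma> x \<noteq> top" using elim p by (auto simp: ennreal_mult_top split: if_splits)
    have F: "f x * \<sigma> x = F x" using s by (simp add: f_def ennreal_mult_divide_cancel)
    have "epowr (F x) p * w x = epowr (f x) p * (w x * (epowr (\<sigma> x) (p - 1) * \<sigma> x))"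
      using epowr_add[of "\<sigma> x" "p - 1" 1] by (simp add: F[symmetric] epowr_mult mult_ac)
    also have "\<dots> = epowr (f x) p * \<sigma> x" using elim by (simp flip: mult.assoc)
    finally show ?case using F by simp
  qed
  let ?N = "\<integral>\<^sup>+x. epowr (f x) p * \<sigma> x \<partial>M"
  have norm_F: "wnorm M p w F = epowr ?N (1 / p)"
    unfolding wnorm_def using ae by (intro arg_cong[where f = "\<lambda>x. epowr x _"] nn_integral_cong_AE) auto
  have avg_F: "avg j F x = avg j (\<lambda>y. f y * \<sigma> y) x" for j x
    using ae by (intro mean_cong_AE) auto
  define h where "h = sparse n c G F"
  have [measurable]: "h \<in> borel_measurable M" unfolding h_def by measurable
  define I where "I = (\<integral>\<^sup>+x. epowr (h x) p * w x \<partial>M)"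
  define g where "g x = epowr (h x) (p - 1)" for x
  have [measurable]: "g \<in> borel_measurable M" unfolding g_def by measurable
  let ?L = "\<integral>\<^sup>+x. (\<Sum>j<n. indicator {x. ennreal c \<le> avg j (indicator (G j)) x} x
      * (avg j (\<lambda>y. f y * \<sigma> y) x * avg j (\<lambda>y. g y * w y) x)) \<partial>M"
  have "I = (\<integral>\<^sup>+x. h x * (g x * w x) \<partial>M)"
    unfolding I_def
  proof (intro nn_integral_cong)
    fix x
    show "epowr (h x) p * w x = h x * (g x * w x)"
      using epowr_add[of "h x" 1 "p - 1"] by (simp add: g_def mult.assoc)
  qed
  then have I_form: "I = ?L"
    unfolding h_def by (simp add: nn_integral_sparse_mult avg_F)
  have gq: "(\<integral>\<^sup>+x. epowr (g x) q * w x \<partial>M) = I"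
    using q(4) by (simp add: I_def g_def epowr_epowr mult.commute)
  have dual': "AE x in M. 1 \<le> epowr (w x) (1 / p) * epowr (\<sigma> x) (1 / q)"
    using dual
  proof eventually_elim
    case (elim x)
    have "epowr (w x) (1 / p) * epowr (\<sigma> x) (1 / q) = epowr (w x * epowr (\<sigma> x) (p - 1)) (1 / p)"
      using p by (simp add: epowr_mult epowr_epowr q1)
    then show ?case using elim by simp
  qed
  \<comment> \<open>Testing against \<open>g = h\<^sup>p\<^sup>-\<^sup>1\<close> reproduces the norm of \<open>h\<close> on both sides.\<close>
  have form: "ennreal (c powr max (p - 1) (1 / (p - 1))) * I
      \<le> epowr W (max 1 (1 / (p - 1))) * (epowr (Doob_const p * ?N) (1 / p) * epowr (Doob_const q * I) (1 / q))"
  proof (cases "2 \<le> p")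
    case True
    then have m: "max (p - 1) (1 / (p - 1)) = p - 1" "max 1 (1 / (p - 1)) = 1"
      by (auto simp: max_def field_simps)
    from sparse_form_bound[where f = f and g = g and n = n, OF _ _ _ _ True pq c fin(2) fin(1) W dual' G disj]
    show ?thesis unfolding m I_form[symmetric] gq by simp
  next
    case False
    have m: "max (p - 1) (1 / (p - 1)) = q - 1" "max 1 (1 / (p - 1)) = q - 1"
    proof -
      have "1 \<le> 1 / (p - 1)" using False p by (simp add: field_simps)
      then show "max (p - 1) (1 / (p - 1)) = q - 1" "max 1 (1 / (p - 1)) = q - 1"
        using False unfolding q1 by (auto simp: max_def)
    qed
    have "2 \<le> q" using False p by (simp add: q_def field_simps)
    have W': "avg j \<sigma> x * epowr (avg j w x) (q - 1) \<le> epowr W (q - 1)" if "x \<in> space M" for j x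
      using epowr_mono[OF W[OF that, of j], of "q - 1"] q by (simp add: epowr_mult epowr_epowr mult.commute)
    have swap: "?L = (\<integral>\<^sup>+x. (\<Sum>j<n. indicator {x. ennreal c \<le> avg j (indicator (G j)) x} x
      * (avg j (\<lambda>y. g y * w y) x * avg j (\<lambda>y. f y * \<sigma> y) x)) \<partial>M)"
      by (simp only: mult.commute[of "avg _ (\<lambda>y. f y * \<sigma> y) _"])
    have dual'': "AE x in M. 1 \<le> epowr (\<sigma> x) (1 / q) * epowr (w x) (1 / p)"
      using dual' by (simp add: mult.commute)
    have "1 / q + 1 / p = 1" using pq by simp
    note sparse_form_bound[where f = g and g = f and n = n, OF _ _ _ _ \<open>2 \<le> q\<close> this c fin(1) fin(2) W' dual'' G disj]
    then have "ennreal (c powr (q - 1)) * I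
        \<le> epowr W (q - 1) * (epowr (Doob_const q * I) (1 / q) * epowr (Doob_const p * ?N) (1 / p))"
      unfolding I_form[unfolded swap, symmetric] gq by simp
    then show ?thesis unfolding m by (simp only: mult.commute[of "epowr (Doob_const q * I) (1 / q)"])
  qed
  show ?thesis
  proof (cases "?N = top")
    case True
    then show ?thesis
      using sparse_const_pos[OF p c] W0 by (simp add: norm_F ennreal_mult_eq_top_iff ennreal_mult_top)
  next
    case False
    \<comment> \<open>A crude bound, only to know that \<open>I\<close> is finite before it is divided out.\<close>
    have "I \<le> (\<integral>\<^sup>+x. (\<Sum>j<n. epowr (of_nat n * avg j F x) p * w x) \<partial>M)"
      unfolding I_def
    proof (rule nn_integral_mono)
      fix x
      have "h x \<le> (\<Sum>j<n. avg j F x)"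
        unfolding h_def sparse_def by (intro sum_mono) (auto simp: indicator_def)
      then have "epowr (h x) p \<le> epowr (\<Sum>j<n. avg j F x) p" using p by (intro epowr_mono) auto
      also have "\<dots> \<le> (\<Sum>j<n. epowr (of_nat n * avg j F x) p)"
        using epowr_sum_le[of "{..<n}" p "\<lambda>j. avg j F x"] p by simp
      finally have "epowr (h x) p * w x \<le> (\<Sum>j<n. epowr (of_nat n * avg j F x) p) * w x"
        by (rule mult_right_mono) simp
      then show "epowr (h x) p * w x \<le> (\<Sum>j<n. epowr (of_nat n * avg j F x) p * w x)"
        by (simp only: sum_distrib_right)
    qed
    also have "\<dots> = (\<Sum>j<n. \<integral>\<^sup>+x. epowr (of_nat n * avg j F x) p * w x \<partial>M)"
      by (rule nn_integral_sum) measurable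
    also have "\<dots> < top"
    proof -
      have "(\<integral>\<^sup>+x. epowr (of_nat n * avg j F x) p * w x \<partial>M) < top" if "j < n" for j
      proof -
        let ?X = "\<lambda>x. avg j (\<lambda>y. f y * \<sigma> y) x / avg j \<sigma> x"
        have "(\<integral>\<^sup>+x. epowr (of_nat n * avg j F x) p * w x \<partial>M) = (\<integral>\<^sup>+x. epowr (of_nat n * avg j F x) p * avg j w x \<partial>M)"
          by (rule nn_integral_adapted_mult_avg[OF adapted_cube, symmetric]) measurable
        also have "\<dots> \<le> (\<integral>\<^sup>+x. (epowr (of_nat n) p * W) * (epowr (?X x) p * avg j \<sigma> x) \<partial>M)"
        proof (rule nn_integral_mono)
          fix x assume x: "x \<in> space M"
          have F: "avg j F x = ?X x * avg j \<sigma> x"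
            unfolding avg_F using fin(2)[OF x, of j] by (simp add: ennreal_mult_divide_cancel)
          have "epowr (of_nat n * avg j F x) p * avg j w x
              = epowr (of_nat n) p * (epowr (?X x) p * avg j \<sigma> x) * (avg j w x * epowr (avg j \<sigma> x) (p - 1))"
            using epowr_add[of "avg j \<sigma> x" 1 "p - 1"] unfolding F by (simp add: epowr_mult mult_ac)
          also have "\<dots> \<le> epowr (of_nat n) p * (epowr (?X x) p * avg j \<sigma> x) * W"
            by (intro mult_left_mono W x) simp
          finally show "epowr (of_nat n * avg j F x) p * avg j w x \<le> (epowr (of_nat n) p * W) * (epowr (?X x) p * avg j \<sigma> x)"
            by (simp only: mult_ac)
        qed
        also have "\<dots> = (epowr (of_nat n) p * W) * (\<integral>\<^sup>+x. epowr (?X x) p * avg j \<sigma> x \<partial>M)"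
          by (rule nn_integral_cmult) measurable
        also have "(\<integral>\<^sup>+x. epowr (?X x) p * avg j \<sigma> x \<partial>M) = (\<integral>\<^sup>+x. epowr (?X x) p * \<sigma> x \<partial>M)"
          by (rule nn_integral_adapted_mult_avg[OF adapted_cube]) measurable
        also have "\<dots> \<le> (\<integral>\<^sup>+x. epowr (SUP j\<in>{..<n}. avg j (\<lambda>y. f y * \<sigma> y) x / avg j \<sigma> x) p * \<sigma> x \<partial>M)"
          using that p by (intro nn_integral_mono mult_right_mono epowr_mono SUP_upper) auto
        also have "\<dots> \<le> ennreal (2 powr p * (p / (p - 1))) * ?N"
          using fin(2) by (intro Doob_maximal_inequality p) auto
        finally have le: "(\<integral>\<^sup>+x. epowr (of_nat n * avg j F x) p * w x \<partial>M)
            \<le> (epowr (of_nat n) p * W) * (ennreal (2 powr p * (p / (p - 1))) * ?N)"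
          by (simp add: mult_left_mono)
        have "(epowr (of_nat n) p * W) * (ennreal (2 powr p * (p / (p - 1))) * ?N) < top"
          using False W0 by (simp add: ennreal_mult_less_top less_top of_nat_less_top)
        with le show ?thesis by (rule le_less_trans)
      qed
      then show ?thesis by (simp add: less_top)
    qed
    finally have "I \<noteq> top" by simp
    have "I = ennreal (c powr (- max (p - 1) (1 / (p - 1)))) * (ennreal (c powr max (p - 1) (1 / (p - 1))) * I)"
      using c by (simp add: ennreal_mult[symmetric] mult.assoc[symmetric] powr_minus)
    also have "\<dots> \<le> ennreal (c powr (- max (p - 1) (1 / (p - 1)))) * (epowr W (max 1 (1 / (p - 1))) * (epowr (Doob_const p * ?N) (1 / p) * epowr (Doob_const q * I) (1 / q)))"
      by (intro mult_left_mono form) auto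
    also have "\<dots> = (sparse_const p c * epowr W (max 1 (1 / (p - 1))) * epowr ?N (1 / p)) * epowr I (1 / q)"
    proof -
      have "Doob_const q = ennreal (2 powr (p / (p - 1)) * p)"
        unfolding Doob_const_def q1(3) by (simp add: q_def)
      then show ?thesis
        by (simp only: sparse_const_def Doob_const_def[of p] epowr_mult q1(2) mult_ac)
    qed
    finally have "epowr I (1 / p) \<le> sparse_const p c * epowr W (max 1 (1 / (p - 1))) * epowr ?N (1 / p)"
      by (rule ennreal_power_absorb[OF _ \<open>I \<noteq> top\<close> pq])
    then show ?thesis unfolding norm_F by (simp add: wnorm_def I_def h_def)
  qed
qed

end


section \<open>Stopping cubes\<close>

text \<open>
  Stopping times run from the coarsest level \<open>N\<close> down to \<open>0\<close>. After \<open>k\<close> steps the value is the level of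
  the last stop; the rule \<open>st i j\<close> decides whether to stop at level \<open>j\<close> when the last stop was at \<open>i\<close>.
\<close>
primrec stop_rec :: "(nat \<Rightarrow> nat \<Rightarrow> 'a \<Rightarrow> bool) \<Rightarrow> nat \<Rightarrow> nat \<Rightarrow> 'a \<Rightarrow> nat" where
  "stop_rec st N 0 x = N"
| "stop_rec st N (Suc k) x =
    (if st (stop_rec st N k x) (N - Suc k) x then N - Suc k else stop_rec st N k x)"

definition stop_level :: "(nat \<Rightarrow> nat \<Rightarrow> 'a \<Rightarrow> bool) \<Rightarrow> nat \<Rightarrow> nat \<Rightarrow> 'a \<Rightarrow> nat" where
  "stop_level st N j x = stop_rec st N (N - j) x"

lemma stop_level_top [simp]: "stop_level st N N x = N"
  by (simp add: stop_level_def)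

lemma stop_level_step:
  assumes "j < N"
  shows "stop_level st N j x = (if st (stop_level st N (Suc j) x) j x then j else stop_level st N (Suc j) x)"
proof -
  have "N - j = Suc (N - Suc j)" "N - Suc (N - Suc j) = j" using assms by auto
  then show ?thesis by (simp add: stop_level_def)
qed

lemma stop_level_bounds: "j \<le> N \<Longrightarrow> j \<le> stop_level st N j x \<and> stop_level st N j x \<le> N"
  by (induction rule: inc_induct) (auto simp: stop_level_step[of _ N])

lemma stop_level_mono: "i \<le> j \<Longrightarrow> j \<le> N \<Longrightarrow> stop_level st N i x \<le> stop_level st N j x"
proof (induction rule: inc_induct)
  case (step n)
  then show ?case using stop_level_bounds[of "Suc n" N st x] by (auto simp: stop_level_step[of n N])
qed simp

lemma stop_level_idem: "j \<le> N \<Longrightarrow> stop_level st N (stop_level st N j x) x = stop_level st N j x"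
proof (induction rule: inc_induct)
  case (step n)
  then show ?case by (auto simp: stop_level_step[of n N])
qed simp

lemma stop_level_between:
  assumes "j \<le> l" "l \<le> stop_level st N j x" "j \<le> N"
  shows "stop_level st N l x = stop_level st N j x"
proof -
  have "stop_level st N j x \<le> N" using stop_level_bounds[OF assms(3), of st x] by (rule conjunct2)
  then have "stop_level st N l x \<le> stop_level st N (stop_level st N j x) x"
    using assms(2) by (rule stop_level_mono[rotated])
  moreover have "stop_level st N j x \<le> stop_level st N l x"
    using assms \<open>stop_level st N j x \<le> N\<close> by (intro stop_level_mono) linarith+
  ultimately show ?thesis unfolding stop_level_idem[OF assms(3)] by (rule antisym)
qed

lemma not_stopped:
  assumes "j < stop_level st N j x" "j \<le> N"
  shows "\<not> st (stop_level st N j x) j x"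
proof -
  have "j < N" using assms stop_level_bounds[of j N st x] by auto
  then show ?thesis using assms by (auto simp: stop_level_step[of j N] split: if_splits)
qed

lemma stop_level_never:
  assumes "stop_level st N i x = i" "\<And>j. j < i \<Longrightarrow> \<not> st i j x" "j \<le> i" "i \<le> N"
  shows "stop_level st N j x = i"
  using assms(3)
proof (induction rule: inc_induct)
  case (step n)
  then show ?case using assms(2)[of n] assms(4) by (simp add: stop_level_step[of n N])
qed (rule assms(1))

context nested_partitions
begin

text \<open>
  The principal cubes of \<open>f\<close> and of a family \<open>F i\<close> that may change with the last stop: stop as soon
  as one of the two averages exceeds four times its value at the last stop. For the commutator,
  \<open>F i = |b - b\<^sub>i|\<close>, where \<open>b\<^sub>i\<close> is the average of \<open>b\<close> on the cube of level \<open>i\<close>; for the maximal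
  operator, \<open>F i = f\<close>.
\<close>
definition stops :: "(nat \<Rightarrow> 'a \<Rightarrow> ennreal) \<Rightarrow> ('a \<Rightarrow> ennreal) \<Rightarrow> nat \<Rightarrow> nat \<Rightarrow> 'a \<Rightarrow> bool" where
  "stops F f i j x \<longleftrightarrow> 4 * avg i (F i) x < avg j (F i) x \<or> 4 * avg i f x < avg j f x"

text \<open>
  The points whose chain of stops ends at level \<open>i\<close>. These sets partition the space, and they are the
  major subsets of the stopping cubes.
\<close>
definition last_stop_set :: "(nat \<Rightarrow> 'a \<Rightarrow> ennreal) \<Rightarrow> ('a \<Rightarrow> ennreal) \<Rightarrow> nat \<Rightarrow> nat \<Rightarrow> 'a set" where
  "last_stop_set F f N i = {x \<in> space M. stop_level (stops F f) N 0 x = i}"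

text \<open>
  The weak type inequality inside one cube. If the average over the cube vanishes, so do all averages
  over smaller cubes, and if it is infinite, nothing can exceed it.
\<close>
lemma avg_exceeds_quarter:
  assumes [measurable]: "f \<in> borel_measurable M" and x: "x \<in> space M"
  shows "avg i (indicator {y. \<exists>j<i. 4 * avg i f y < avg j f y}) x \<le> ennreal (1 / 4)"
proof -
  let ?U = "{y. \<exists>j<i. 4 * avg i f y < avg j f y}"
  have ad: "adapted j (\<lambda>y. 4 * avg i f y < avg j f y)" if "j < i" for j
  proof (rule adaptedI)
    fix z y assume z: "z \<in> space M" "y \<in> cube j z"
    have "cube i y = cube i z" "cube j y = cube j z"
      using cube_eq_above[OF z] that by simp_all
    then show "(4 * avg i f y < avg j f y) = (4 * avg i f z < avg j f z)" by simp
  qed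
  have [measurable]: "Measurable.pred M (\<lambda>y. \<exists>j<i. 4 * avg i f y < avg j f y)" by measurable
  let ?g = "indicator (cube i x) :: 'a \<Rightarrow> ennreal"
  have g: "adapted i ?g"
  proof (rule adaptedI)
    fix u v assume u: "u \<in> space M" and v: "v \<in> cube i u"
    have vs: "v \<in> space M" using cube_space[OF u v] .
    have "u \<in> cube i x \<longleftrightarrow> cube i u = cube i x" "v \<in> cube i x \<longleftrightarrow> cube i v = cube i x"
      using cube_eq[OF x, of u i] cube_eq[OF x, of v i] cube_self[OF u, of i] cube_self[OF vs, of i] by auto
    then have "u \<in> cube i x \<longleftrightarrow> v \<in> cube i x" using cube_eq[OF u v] by simp
    then show "?g v = ?g u" by (simp add: indicator_def)
  qed
  have max: "(\<integral>\<^sup>+y. ?g y * (4 * avg i f y * indicator ?U y) \<partial>M) \<le> (\<integral>\<^sup>+y. ?g y * (f y * indicator ?U y) \<partial>M)"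
  proof (rule maximal_inequality[OF _ _ ad _ g])
    fix j y assume j: "j < i" and y: "y \<in> space M" and P: "4 * avg i f y < avg j f y"
    have "avg j (\<lambda>y. 4 * avg i f y) y = 4 * avg i f y"
    proof (rule avg_adapted[OF _ y])
      show "adapted j (\<lambda>y. 4 * avg i f y)"
        using cube_eq_above[of _ _ j i] j by (intro adaptedI) simp
    qed
    then show "avg j (\<lambda>y. 4 * avg i f y) y \<le> avg j f y" using P by simp
  qed simp_all
  let ?a = "avg i f x" and ?m = "emeasure M (cube i x)" and ?V = "\<integral>\<^sup>+y. indicator ?U y * ?g y \<partial>M"
  note [measurable] = cube_sets[OF x, of i]
  have "4 * ?a * ?V = (\<integral>\<^sup>+y. ?g y * (4 * avg i f y * indicator ?U y) \<partial>M)"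
  proof -
    have "4 * ?a * ?V = (\<integral>\<^sup>+y. 4 * ?a * (indicator ?U y * ?g y) \<partial>M)"
      by (rule nn_integral_cmult[symmetric]) measurable
    also have "\<dots> = (\<integral>\<^sup>+y. ?g y * (4 * avg i f y * indicator ?U y) \<partial>M)"
    proof (rule nn_integral_cong)
      fix y
      have "avg i f y = ?a" if "y \<in> cube i x" using cube_eq[OF x that] by simp
      then show "4 * ?a * (indicator ?U y * ?g y) = ?g y * (4 * avg i f y * indicator ?U y)"
        by (auto simp: indicator_def)
    qed
    finally show ?thesis .
  qed
  also have "\<dots> \<le> (\<integral>\<^sup>+y\<in>cube i x. f y \<partial>M)"
    by (rule order_trans[OF max], rule nn_integral_mono) (auto simp: indicator_def)
  also have "\<dots> = ?a * ?m"
    using cube_pos[OF x] cube_fin[OF x] by (simp add: mean_def ennreal_mult_divide_cancel)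
  finally have main: "4 * ?a * ?V \<le> ?a * ?m" .
  have "?V \<le> ennreal (1 / 4) * ?m"
  proof -
    consider "?a = 0" | "?a = top" | "?a \<noteq> 0" "?a \<noteq> top" by blast
    then show ?thesis
    proof cases
      case 1
      have "y \<notin> ?U" if y: "y \<in> cube i x" for y
      proof
        assume "y \<in> ?U"
        then obtain j where j: "j < i" "4 * avg i f y < avg j f y" by auto
        have ys: "y \<in> space M" using cube_space[OF x y] .
        have 0: "(\<integral>\<^sup>+z\<in>cube i x. f z \<partial>M) = 0"
          using 1 cube_fin[OF x, of i] by (simp add: mean_def ennreal_divide_eq_0_iff)
        have "(\<integral>\<^sup>+z\<in>cube j y. f z \<partial>M) \<le> (\<integral>\<^sup>+z\<in>cube i x. f z \<partial>M)"
          using cube_mono[OF ys, of j i] j(1) cube_eq[OF x y] by (intro nn_integral_mono) (auto simp: indicator_def)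
        then have "avg j f y = 0" using 0 by (simp add: mean_def)
        then show False using j by simp
      qed
      then have "?V = (\<integral>\<^sup>+y. 0 \<partial>M)" by (intro nn_integral_cong) (auto simp: indicator_def)
      then show ?thesis by simp
    next
      case 2
      have "y \<notin> ?U" if y: "y \<in> cube i x" for y
        using 2 cube_eq[OF x y] by (simp add: ennreal_mult_top)
      then have "?V = (\<integral>\<^sup>+y. 0 \<partial>M)" by (intro nn_integral_cong) (auto simp: indicator_def)
      then show ?thesis by simp
    next
      case 3
      have "?a * (4 * ?V) / ?a \<le> ?a * ?m / ?a"
        using main by (intro divide_right_mono_ennreal) (simp add: mult_ac)
      then have "4 * ?V \<le> ?m" using 3 by (simp add: ennreal_mult_divide_cancel)
      then have "ennreal (1 / 4) * (4 * ?V) \<le> ennreal (1 / 4) * ?m" by (rule mult_left_mono) simp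
      moreover have "ennreal (1 / 4) * (4 * ?V) = ?V"
      proof -
        have "ennreal (1 / 4) * 4 = ennreal (1 / 4 * 4)" by (subst ennreal_mult) auto
        then show ?thesis by (simp flip: mult.assoc)
      qed
      ultimately show ?thesis by simp
    qed
  qed
  then have "?V / ?m \<le> ennreal (1 / 4) * ?m / ?m" by (rule divide_right_mono_ennreal)
  then show ?thesis using cube_pos[OF x] cube_fin[OF x]
    by (simp only: mean_def ennreal_mult_divide_cancel(3) not_False_eq_True)
qed

context
  fixes F :: "nat \<Rightarrow> 'a \<Rightarrow> ennreal" and f :: "'a \<Rightarrow> ennreal" and N :: nat
  assumes F [measurable]: "\<And>i. F i \<in> borel_measurable M" and f [measurable]: "f \<in> borel_measurable M"
begin

abbreviation "lev j x \<equiv> stop_level (stops F f) N j x"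

lemma lev_adapted: "j \<le> N \<Longrightarrow> adapted j (lev j)"
proof (induction rule: inc_induct)
  case base
  then show ?case by (simp add: adapted_def)
next
  case (step n)
  show ?case
  proof (rule adaptedI)
    fix x y assume x: "x \<in> space M" and y: "y \<in> cube n x"
    have 1: "lev (Suc n) y = lev (Suc n) x"
      using adaptedD[OF step.IH x] cube_Suc[OF x, of n] y by blast
    let ?i = "lev (Suc n) x"
    have "n \<le> ?i" using stop_level_bounds[of "Suc n" N "stops F f" x] step by simp
    then have "cube ?i y = cube ?i x" "cube n y = cube n x"
      using cube_eq_above[OF x y] by simp_all
    then have "stops F f ?i n y = stops F f ?i n x" by (simp add: stops_def)
    then show "lev n y = lev n x" using 1 step by (simp add: stop_level_step[of n N])
  qed
qed

lemma last_stop_set_sets [measurable]: "last_stop_set F f N i \<in> sets M"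
proof -
  have "lev 0 \<in> measurable M (count_space UNIV)"
    by (rule adapted_measurable[OF lev_adapted]) auto
  then have "{x \<in> space M. lev 0 x = i} \<in> sets M" by measurable
  then show ?thesis by (simp add: last_stop_set_def)
qed

lemma last_stop_set_disjoint: "disjoint_family (last_stop_set F f N)"
  by (auto simp: disjoint_family_on_def last_stop_set_def)

text \<open>
  Two stopping rules, each firing on at most a quarter of the cube, leave at least half of it.
\<close>
lemma avg_last_stop_set:
  assumes x: "x \<in> space M" and i: "i \<le> N" "lev i x = i"
  shows "ennreal (1 / 2) \<le> avg i (indicator (last_stop_set F f N i)) x"
proof -
  let ?U = "{y. \<exists>j<i. 4 * avg i (F i) y < avg j (F i) y}" and ?V = "{y. \<exists>j<i. 4 * avg i f y < avg j f y}"
  have [measurable]: "Measurable.pred M (\<lambda>y. \<exists>j<i. 4 * avg i (F i) y < avg j (F i) y)"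
     "Measurable.pred M (\<lambda>y. \<exists>j<i. 4 * avg i f y < avg j f y)" by measurable
  let ?G = "last_stop_set F f N i"
  have "1 = avg i (\<lambda>y. 1) x" using x by (simp add: avg_const)
  also have "\<dots> \<le> avg i (\<lambda>y. (indicator ?U y + indicator ?V y) + indicator ?G y) x"
  proof (rule mean_mono)
    fix y assume y: "y \<in> space M" "y \<in> cube i x"
    have "lev i y = i" using adaptedD[OF lev_adapted[OF i(1)] x y(2)] i by simp
    then have "y \<in> ?U \<union> ?V \<union> ?G"
      using stop_level_never[of "stops F f" N i y 0] i y by (auto simp: stops_def last_stop_set_def)
    then show "1 \<le> (indicator ?U y + indicator ?V y) + (indicator ?G y :: ennreal)"
      by (auto simp: indicator_def)
  qed
  also have "\<dots> = (avg i (indicator ?U) x + avg i (indicator ?V) x) + avg i (indicator ?G) x"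
    using x by (subst mean_add; (subst mean_add)?) (auto simp: cube_sets)
  also have "\<dots> \<le> (ennreal (1 / 4) + ennreal (1 / 4)) + avg i (indicator ?G) x"
    by (intro add_mono avg_exceeds_quarter x F f order_refl)
  also have "ennreal (1 / 4) + ennreal (1 / 4) = ennreal (1 / 2)"
    by (subst ennreal_plus[symmetric]) auto
  finally have "ennreal (1 / 2) + ennreal (1 / 2) \<le> ennreal (1 / 2) + avg i (indicator ?G) x"
    by (subst ennreal_plus[symmetric]) auto
  then show ?thesis by (simp add: ennreal_add_left_cancel_le)
qed

lemma avg_le_stop_avg:
  assumes "x \<in> space M" "j \<le> N"
  shows "avg j f x \<le> 4 * avg (lev j x) f x" "avg j (F (lev j x)) x \<le> 4 * avg (lev j x) (F (lev j x)) x"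
proof -
  have four: "u \<le> 4 * u" for u :: ennreal using mult_right_mono[of 1 4 u] by simp
  consider "lev j x = j" | "\<not> stops F f (lev j x) j x"
    using not_stopped[of j "stops F f" N x] stop_level_bounds[of j N "stops F f" x] assms by linarith
  then have "avg j f x \<le> 4 * avg (lev j x) f x \<and> avg j (F (lev j x)) x \<le> 4 * avg (lev j x) (F (lev j x)) x"
  proof cases
    case 1
    then show ?thesis using four by simp
  qed (simp add: stops_def not_less)
  then show "avg j f x \<le> 4 * avg (lev j x) f x" "avg j (F (lev j x)) x \<le> 4 * avg (lev j x) (F (lev j x)) x"
    by simp_all
qed

lemma stop_sum_le_sparse:
  assumes "x \<in> space M" "\<And>l. l \<le> N \<Longrightarrow> h l \<le> avg l g x"
  shows "(\<Sum>l\<le>N. (if lev l x = l then h l else 0)) \<le> sparse (Suc N) (1 / 2) (last_stop_set F f N) g x"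
  unfolding sparse_def lessThan_Suc_atMost
  using assms avg_last_stop_set[OF assms(1)] by (intro sum_mono) (auto simp: indicator_def)

end

text \<open>
  Every average is at most four times the average over the last stopping cube. Hence the maximal
  operator inherits the bound of the sparse operators.
\<close>
lemma avg_le_sparse:
  assumes [measurable]: "f \<in> borel_measurable M" and x: "x \<in> space M" and j: "j \<le> N"
  shows "avg j f x \<le> 4 * sparse (Suc N) (1 / 2) (last_stop_set (\<lambda>i. f) f N) f x"
proof -
  define i where "i = stop_level (stops (\<lambda>i. f) f) N j x"
  have i: "i \<le> N" "stop_level (stops (\<lambda>i. f) f) N i x = i"
    unfolding i_def by (simp_all only: stop_level_bounds[OF j] stop_level_idem[OF j])
  have "avg j f x \<le> 4 * avg i f x"
    unfolding i_def by (rule avg_le_stop_avg[OF _ _ x j]) auto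
  also have "avg i f x = (if stop_level (stops (\<lambda>i. f) f) N i x = i then avg i f x else 0)" using i by simp
  also have "\<dots> \<le> (\<Sum>l\<le>N. (if stop_level (stops (\<lambda>i. f) f) N l x = l then avg l f x else 0))"
    by (rule member_le_sum[of i "{..N}" "\<lambda>l. if stop_level (stops (\<lambda>i. f) f) N l x = l then avg l f x else 0"])
      (use i in auto)
  also have "\<dots> \<le> sparse (Suc N) (1 / 2) (last_stop_set (\<lambda>i. f) f N) f x"
    by (rule stop_sum_le_sparse) (use x in auto)
  finally show ?thesis by (simp add: mult_left_mono)
qed

lemma maximal_bound:
  assumes Ap: "dyadic_Ap p w \<sigma> W" and p: "1 < p" and [measurable]: "f \<in> borel_measurable M"
  shows "wnorm M p w (\<lambda>x. SUP j\<in>{..N}. avg j f x) \<le> 4 * (sparse_const p (1 / 2) * epowr W (max 1 (1 / (p - 1)))) * wnorm M p w f"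
proof -
  let ?A = "sparse (Suc N) (1 / 2) (last_stop_set (\<lambda>i. f) f N) f"
  have [measurable]: "w \<in> borel_measurable M" using Ap by (simp add: dyadic_Ap_def)
  have "wnorm M p w (\<lambda>x. SUP j\<in>{..N}. avg j f x) \<le> wnorm M p w (\<lambda>x. 4 * ?A x)"
    using p by (intro wnorm_mono SUP_least avg_le_sparse) auto
  also have "\<dots> = 4 * wnorm M p w ?A" using p by (simp add: wnorm_cmult)
  also have "\<dots> \<le> 4 * (sparse_const p (1 / 2) * epowr W (max 1 (1 / (p - 1))) * wnorm M p w f)"
    by (intro mult_left_mono sparse_bound[OF Ap p]) (auto intro: last_stop_set_sets last_stop_set_disjoint)
  finally show ?thesis by (simp only: mult.assoc)
qed

text \<open>
  The commutator on one dyadic system, with \<open>b\<close> replaced by its averages on the finest cubes. Along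
  the chain of stopping cubes above \<open>x\<close> the averages of \<open>b\<close> change by at most a multiple of the
  oscillation at each stop, so \<open>|b\<^sub>0(x) - b\<^sub>i(x)|\<close> is bounded by the sum of the oscillations below \<open>i\<close>. For
  an arbitrary cube \<open>Q\<close> take \<open>i\<close> to be the level of its last stop. The first sum on the right collects
  the part with \<open>b(x)\<close>, where the average of \<open>f\<close> over \<open>Q\<close> is comparable with that over the stopping
  cube; this comparison is the reason for letting \<open>f\<close> take part in the stopping rule. The second
  collects the part with \<open>b(y)\<close>, where only the oscillations inside \<open>Q\<close> survive.
\<close>
lemma oscillation_domination:
  fixes B :: "nat \<Rightarrow> 'a \<Rightarrow> complex" and b :: "'a \<Rightarrow> complex" and f :: "'a \<Rightarrow> ennreal" and C :: real
  defines "F \<equiv> \<lambda>i y. ennreal (cmod (b y - B i y))"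
  assumes [measurable]: "b \<in> borel_measurable M" and f [measurable]: "f \<in> borel_measurable M"
    and B: "\<And>i. adapted i (B i)"
    and B_diff: "\<And>i j x. x \<in> space M \<Longrightarrow> j \<le> i \<Longrightarrow> ennreal (cmod (B j x - B i x)) \<le> avg j (F i) x"
    and C: "1 \<le> C" and doubling: "\<And>j x f. x \<in> space M \<Longrightarrow> avg j f x \<le> ennreal C * avg (Suc j) f x"
    and x: "x \<in> space M" and j: "j \<le> N"
  defines "osc \<equiv> \<lambda>l y. if stop_level (stops F f) N l y = l then avg l (F l) y else 0"
  shows "avg j (\<lambda>y. ennreal (cmod (B 0 x - B 0 y)) * f y) x
    \<le> ennreal (32 * C) * ((\<Sum>l\<le>N. osc l x * (SUP i\<in>{l..N}. avg i f x)) + avg j (\<lambda>y. \<Sum>l\<le>j. osc l y * avg l f y) x)"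
proof -
  let ?lev = "stop_level (stops F f) N"
  have Bm [measurable]: "B i \<in> borel_measurable M" for i
    by (rule adapted_measurable[OF B]) auto
  have F [measurable]: "F i \<in> borel_measurable M" for i unfolding F_def by measurable
  have lev: "k \<le> N \<Longrightarrow> adapted k (?lev k)" for k by (rule lev_adapted[OF F f])
  have osc: "l \<le> N \<Longrightarrow> adapted l (osc l)" for l
  proof -
    assume "l \<le> N"
    show "adapted l (osc l)"
    proof (rule adaptedI)
      fix x y assume x: "x \<in> space M" and y: "y \<in> cube l x"
      show "osc l y = osc l x"
        using adaptedD[OF lev[OF \<open>l \<le> N\<close>] x y] cube_eq[OF x y] by (simp add: osc_def)
    qed
  qed
  have oscm [measurable]: "l \<le> N \<Longrightarrow> osc l \<in> borel_measurable M" for l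
    by (rule adapted_measurable[OF osc]) auto
  have C0: "ennreal C \<noteq> 0" using C by auto
  have C1: "u \<le> ennreal C * u" for u using mult_right_mono[of 1 "ennreal C" u] C by simp
  \<comment> \<open>Between consecutive stops the average changes at most by the last average before the stop, which is controlled by doubling.\<close>
  have chain: "ennreal (cmod (B (?lev k y) y - B 0 y)) \<le> ennreal (4 * C) * (\<Sum>l\<le>?lev k y. osc l y)"
    if y: "y \<in> space M" and "k \<le> N" for y k
    using \<open>k \<le> N\<close>
  proof (induction k)
    case 0
    let ?i = "?lev 0 y"
    have i: "?i \<le> N" "?lev ?i y = ?i"
      using stop_level_bounds[of 0 N] stop_level_idem[of 0 N] by simp_all
    have "ennreal (cmod (B ?i y - B 0 y)) \<le> avg 0 (F ?i) y"
      using B_diff[OF y, of 0 ?i] by (simp add: norm_minus_commute)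
    also have "\<dots> \<le> 4 * osc ?i y"
      using avg_le_stop_avg(2)[OF F f y, of 0 N] i by (simp add: osc_def)
    also have "\<dots> \<le> 4 * (ennreal C * osc ?i y)" by (intro mult_left_mono C1) auto
    also have "\<dots> = ennreal (4 * C) * osc ?i y" using C by (simp add: ennreal_mult mult.assoc)
    also have "\<dots> \<le> ennreal (4 * C) * (\<Sum>l\<le>?i. osc l y)" by (intro mult_left_mono member_le_sum) auto
    finally show ?case .
  next
    case (Suc k)
    let ?i = "?lev (Suc k) y"
    have i: "Suc k \<le> ?i" "?i \<le> N" "?lev ?i y = ?i"
      by (simp_all only: stop_level_bounds[OF Suc.prems] stop_level_idem[OF Suc.prems])
    show ?case
    proof (cases "stops F f ?i k y")
      case False
      then have "?lev k y = ?i" using Suc.prems by (simp add: stop_level_step[of k N])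
      then show ?thesis using Suc by simp
    next
      case True
      then have k: "?lev k y = k" using Suc.prems by (simp add: stop_level_step[of k N])
      have "ennreal (cmod (B ?i y - B k y)) \<le> avg k (F ?i) y"
        using B_diff[OF y, of k ?i] i by (simp add: norm_minus_commute)
      also have "\<dots> \<le> ennreal C * avg (Suc k) (F ?i) y" by (rule doubling[OF y])
      also have "\<dots> \<le> ennreal C * (4 * osc ?i y)"
        using avg_le_stop_avg(2)[OF F f y Suc.prems] i by (intro mult_left_mono) (auto simp: osc_def)
      also have "\<dots> = ennreal (4 * C) * osc ?i y" using C by (simp add: ennreal_mult mult_ac)
      finally have 1: "ennreal (cmod (B ?i y - B k y)) \<le> ennreal (4 * C) * osc ?i y" .
      have 2: "ennreal (cmod (B k y - B 0 y)) \<le> ennreal (4 * C) * (\<Sum>l\<le>k. osc l y)"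
        using Suc k by simp
      have "ennreal (cmod (B ?i y - B 0 y)) \<le> ennreal (cmod (B ?i y - B k y) + cmod (B k y - B 0 y))"
        using norm_triangle_ineq[of "B ?i y - B k y" "B k y - B 0 y"] by (intro ennreal_leI) simp
      also have "\<dots> = ennreal (cmod (B ?i y - B k y)) + ennreal (cmod (B k y - B 0 y))" by simp
      also have "\<dots> \<le> ennreal (4 * C) * osc ?i y + ennreal (4 * C) * (\<Sum>l\<le>k. osc l y)"
        by (rule add_mono[OF 1 2])
      also have "\<dots> = ennreal (4 * C) * (\<Sum>l\<in>insert ?i {..k}. osc l y)"
        using i by (simp add: distrib_left)
      also have "\<dots> \<le> ennreal (4 * C) * (\<Sum>l\<le>?i. osc l y)"
        using i by (intro mult_left_mono sum_mono2) auto
      finally show ?thesis .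
    qed
  qed
  define i where "i = ?lev j x"
  have i: "j \<le> i" "i \<le> N" "?lev i x = i"
    unfolding i_def by (simp_all only: stop_level_bounds[OF j] stop_level_idem[OF j])
  have favg: "avg j f x \<le> 4 * avg i f x"
    unfolding i_def by (rule avg_le_stop_avg(1)[OF F f x j])
  let ?First = "\<Sum>l\<le>N. osc l x * (SUP i\<in>{l..N}. avg i f x)"
  let ?Second = "avg j (\<lambda>y. \<Sum>l\<le>j. osc l y * avg l f y) x"
  have first: "(\<Sum>l\<le>i. osc l x) * avg i f x \<le> ?First"
  proof -
    have "(\<Sum>l\<le>i. osc l x) * avg i f x = (\<Sum>l\<le>i. osc l x * avg i f x)" by (rule sum_distrib_right)
    also have "\<dots> \<le> (\<Sum>l\<le>i. osc l x * (SUP i\<in>{l..N}. avg i f x))"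
      using i by (intro sum_mono mult_left_mono SUP_upper) auto
    also have "\<dots> \<le> ?First" using i by (intro sum_mono2) auto
    finally show ?thesis .
  qed
  have pt: "ennreal (cmod (B 0 x - B 0 y)) * f y
      \<le> ennreal (4 * C) * ((\<Sum>l\<le>i. osc l x) * f y + (osc i x * f y + (\<Sum>l\<le>j. osc l y * f y)))"
    if y: "y \<in> cube j x" for y
  proof -
    have ys: "y \<in> space M" using cube_space[OF x y] .
    have levy: "?lev j y = i" using adaptedD[OF lev[OF j] x y] by (simp add: i_def)
    have yi: "y \<in> cube i x" using cube_mono[OF x i(1)] y by blast
    have Bi: "B i y = B i x" using adaptedD[OF B x yi] .
    have "ennreal (cmod (B 0 x - B 0 y)) \<le> ennreal (cmod (B i x - B 0 x) + cmod (B i y - B 0 y))"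
      using norm_triangle_ineq4[of "B i y - B 0 y" "B i x - B 0 x"] by (intro ennreal_leI) (simp add: Bi)
    also have "\<dots> = ennreal (cmod (B i x - B 0 x)) + ennreal (cmod (B i y - B 0 y))" by simp
    also have "\<dots> \<le> ennreal (4 * C) * (\<Sum>l\<le>i. osc l x) + ennreal (4 * C) * (\<Sum>l\<le>i. osc l y)"
      using chain[OF x j] chain[OF ys j] levy by (intro add_mono) (auto simp: i_def)
    also have "(\<Sum>l\<le>i. osc l y) \<le> osc i x + (\<Sum>l\<le>j. osc l y)"
    proof -
      have "(\<Sum>l\<le>i. osc l y) = (\<Sum>l\<in>insert i {..j}. osc l y)"
      proof (rule sum.mono_neutral_right)
        \<comment> \<open>There is no stop strictly between the levels \<open>j\<close> and \<open>i\<close>.\<close>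
        show "\<forall>l\<in>{..i} - insert i {..j}. osc l y = 0"
        proof
          fix l assume "l \<in> {..i} - insert i {..j}"
          then have "j \<le> l" "l < i" by auto
          then have "?lev l y = i" using stop_level_between[of j l "stops F f" N y] levy j by simp
          then show "osc l y = 0" using \<open>l < i\<close> by (simp add: osc_def)
        qed
      qed (use i in auto)
      also have "\<dots> \<le> osc i y + (\<Sum>l\<le>j. osc l y)" by (cases "i \<in> {..j}") (auto simp: insert_absorb)
      also have "osc i y = osc i x" using adaptedD[OF osc[OF i(2)] x yi] .
      finally show ?thesis .
    qed
    finally have "ennreal (cmod (B 0 x - B 0 y)) \<le> ennreal (4 * C) * (\<Sum>l\<le>i. osc l x) + ennreal (4 * C) * (osc i x + (\<Sum>l\<le>j. osc l y))"
      by (simp add: mult_left_mono)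
    then have "ennreal (cmod (B 0 x - B 0 y)) * f y \<le> (ennreal (4 * C) * (\<Sum>l\<le>i. osc l x) + ennreal (4 * C) * (osc i x + (\<Sum>l\<le>j. osc l y))) * f y"
      by (rule mult_right_mono) simp
    also have "\<dots> = ennreal (4 * C) * ((\<Sum>l\<le>i. osc l x) * f y + (osc i x * f y + (\<Sum>l\<le>j. osc l y * f y)))"
      by (simp only: distrib_left distrib_right mult.assoc sum_distrib_right)
    finally show ?thesis .
  qed
  have Q: "cube j x \<in> sets M" using x by (rule cube_sets)
  have oscm': "l \<in> {..j} \<Longrightarrow> osc l \<in> borel_measurable M" for l using oscm[of l] j by simp
  have "avg j (\<lambda>y. ennreal (cmod (B 0 x - B 0 y)) * f y) x
      \<le> avg j (\<lambda>y. ennreal (4 * C) * ((\<Sum>l\<le>i. osc l x) * f y + (osc i x * f y + (\<Sum>l\<le>j. osc l y * f y)))) x"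
    by (rule mean_mono) (rule pt)
  also have "\<dots> = ennreal (4 * C) * ((\<Sum>l\<le>i. osc l x) * avg j f x + (osc i x * avg j f x + avg j (\<lambda>y. \<Sum>l\<le>j. osc l y * f y) x))"
  proof -
    have m: "(\<lambda>y. \<Sum>l\<le>j. osc l y * f y) \<in> borel_measurable M"
      by (intro borel_measurable_sum borel_measurable_times_ennreal oscm' f)
    then show ?thesis using Q by (simp add: mean_cmult mean_add)
  qed
  also have "avg j (\<lambda>y. \<Sum>l\<le>j. osc l y * f y) x = ?Second"
  proof -
    have "avg j (\<lambda>y. \<Sum>l\<le>j. osc l y * f y) x = (\<Sum>l\<le>j. avg j (\<lambda>y. osc l y * f y) x)"
      using Q by (intro mean_sum borel_measurable_times_ennreal oscm' f)
    also have "\<dots> = (\<Sum>l\<le>j. avg j (\<lambda>y. osc l y * avg l f y) x)"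
      using j x by (intro sum.cong refl avg_tower[symmetric] osc f) auto
    also have "\<dots> = ?Second"
      using Q by (intro mean_sum[symmetric] borel_measurable_times_ennreal oscm' avg_measurable)
    finally show ?thesis .
  qed
  also have "(\<Sum>l\<le>i. osc l x) * avg j f x + (osc i x * avg j f x + ?Second) \<le> 4 * ?First + (4 * ?First + ?Second)"
  proof (intro add_mono order_refl)
    have "(\<Sum>l\<le>i. osc l x) * avg j f x \<le> (\<Sum>l\<le>i. osc l x) * (4 * avg i f x)"
      by (intro mult_left_mono favg) auto
    also have "\<dots> = 4 * ((\<Sum>l\<le>i. osc l x) * avg i f x)" by (simp only: mult_ac)
    also have "\<dots> \<le> 4 * ?First" by (intro mult_left_mono first) auto
    finally show le: "(\<Sum>l\<le>i. osc l x) * avg j f x \<le> 4 * ?First" .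
    have "osc i x * avg j f x \<le> (\<Sum>l\<le>i. osc l x) * avg j f x"
      by (intro mult_right_mono member_le_sum) auto
    with le show "osc i x * avg j f x \<le> 4 * ?First" by (rule order_trans[rotated])
  qed
  also have "4 * ?First + (4 * ?First + ?Second) \<le> 8 * (?First + ?Second)"
  proof -
    have "4 * ?First + (4 * ?First + ?Second) = 8 * ?First + ?Second"
      by (simp only: add.assoc[symmetric] distrib_right[symmetric]) simp
    also have "\<dots> \<le> 8 * ?First + 8 * ?Second"
      using mult_right_mono[of 1 8 ?Second] by (intro add_left_mono) simp
    finally show ?thesis by (simp only: distrib_left)
  qed
  finally have "avg j (\<lambda>y. ennreal (cmod (B 0 x - B 0 y)) * f y) x \<le> ennreal (4 * C) * (8 * (?First + ?Second))"
    by (simp add: mult_left_mono)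
  also have "\<dots> = ennreal (32 * C) * (?First + ?Second)"
  proof -
    have "ennreal (4 * C) * 8 = ennreal (4 * C * 8)" using C by (subst ennreal_mult) auto
    also have "\<dots> = ennreal (32 * C)" by simp
    finally show ?thesis by (simp only: mult.assoc[symmetric])
  qed
  finally show ?thesis .
qed

end


section \<open>Adjacent dyadic systems and the dyadic maximal commutator\<close>

lemma wnorm_add_le:
  assumes "0 < p" and [measurable]: "w \<in> borel_measurable M" "f \<in> borel_measurable M" "g \<in> borel_measurable M"
    and "wnorm M p w f \<le> A" "wnorm M p w g \<le> A"
  shows "wnorm M p w (\<lambda>x. f x + g x) \<le> epowr 2 (1 / p) * 2 * A"
  using wnorm_sum_le[of "{True, False}" p w M "\<lambda>t. if t then f else g" A] assms by simp

text \<open>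
  Multiplication by Bloom's weight maps the norm of one weight to that of the other. It is placed
  between two operators, each of which is bounded with respect to one weight only.
\<close>
lemma wnorm_Bloom:
  assumes "0 < p" "AE x in M. epowr (\<nu> x) p * w2 x = w1 x"
  shows "wnorm M p w2 (\<lambda>x. \<nu> x * h x) = wnorm M p w1 h"
proof -
  have "(\<integral>\<^sup>+x. epowr (\<nu> x * h x) p * w2 x \<partial>M) = (\<integral>\<^sup>+x. epowr (h x) p * w1 x \<partial>M)"
  proof (rule nn_integral_cong_AE)
    show "AE x in M. epowr (\<nu> x * h x) p * w2 x = epowr (h x) p * w1 x"
      using assms(2)
    proof eventually_elim
      case (elim x)
      have "epowr (\<nu> x * h x) p * w2 x = epowr (h x) p * (epowr (\<nu> x) p * w2 x)"
        by (simp only: epowr_mult mult_ac)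
      then show ?case by (simp only: elim)
    qed
  qed
  then show ?thesis by (simp add: wnorm_def)
qed

text \<open>
  Finitely many dyadic systems such that the envelope of every cube, a ball around it, is contained
  in a cube of comparable size of one of them. Hypotheses on balls can be used on envelopes, and
  averages over envelopes can be estimated by averages over cubes. Enlarging a cube in
  this way matters for \<open>BMO\<^sub>\<nu>\<close>: the quotient of \<open>\<nu>\<close>-measures of an envelope and its cube is not
  bounded by a constant of the space.
\<close>
locale adjacent_systems =
  fixes M :: "'a measure" and K :: nat and cube env :: "nat \<Rightarrow> nat \<Rightarrow> 'a \<Rightarrow> 'a set" and C0 :: real
  assumes grid: "t < K \<Longrightarrow> nested_partitions M (cube t)"
    and C0: "1 \<le> C0"
    and cube_env: "t < K \<Longrightarrow> x \<in> space M \<Longrightarrow> cube t j x \<subseteq> env t j x"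
    and env_sets: "t < K \<Longrightarrow> x \<in> space M \<Longrightarrow> env t j x \<in> sets M"
    and env_eq: "t < K \<Longrightarrow> x \<in> space M \<Longrightarrow> y \<in> cube t j x \<Longrightarrow> env t j y = env t j x"
    and env_Suc: "t < K \<Longrightarrow> x \<in> space M \<Longrightarrow> env t j x \<subseteq> env t (Suc j) x"
    and cube_doubling: "t < K \<Longrightarrow> x \<in> space M \<Longrightarrow> emeasure M (cube t (Suc j) x) \<le> ennreal C0 * emeasure M (cube t j x)"
    and env_cover: "t < K \<Longrightarrow> x \<in> space M \<Longrightarrow>
      \<exists>s<K. env t j x \<subseteq> cube s (Suc j) x \<and> emeasure M (cube s (Suc j) x) \<le> ennreal C0 * emeasure M (cube t j x)"
begin

lemma env_mono: "t < K \<Longrightarrow> x \<in> space M \<Longrightarrow> i \<le> j \<Longrightarrow> env t i x \<subseteq> env t j x"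
proof -
  assume "t < K" "x \<in> space M" "i \<le> j"
  from \<open>i \<le> j\<close> show ?thesis
    by (induction rule: dec_induct) (use env_Suc[OF \<open>t < K\<close> \<open>x \<in> space M\<close>] in blast)+
qed

lemma env_self: "t < K \<Longrightarrow> x \<in> space M \<Longrightarrow> x \<in> env t j x"
  using cube_env[of t x j] nested_partitions.cube_self[OF grid, of t x j] by auto

lemma emeasure_cube_le_env: "t < K \<Longrightarrow> x \<in> space M \<Longrightarrow> emeasure M (cube t j x) \<le> emeasure M (env t j x)"
  by (intro emeasure_mono cube_env env_sets)

lemma emeasure_env_le: "t < K \<Longrightarrow> x \<in> space M \<Longrightarrow> emeasure M (env t j x) \<le> ennreal C0 * emeasure M (cube t j x)"
proof -
  assume t: "t < K" and x: "x \<in> space M"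
  obtain s where s: "s < K" "env t j x \<subseteq> cube s (Suc j) x" "emeasure M (cube s (Suc j) x) \<le> ennreal C0 * emeasure M (cube t j x)"
    using env_cover[OF t x] by blast
  have "emeasure M (env t j x) \<le> emeasure M (cube s (Suc j) x)"
    using s(2) by (rule emeasure_mono) (rule nested_partitions.cube_sets[OF grid[OF s(1)] x])
  then show ?thesis using s(3) by (rule order_trans)
qed

lemma emeasure_env: "t < K \<Longrightarrow> x \<in> space M \<Longrightarrow> emeasure M (env t j x) \<noteq> 0 \<and> emeasure M (env t j x) \<noteq> top"
proof -
  assume t: "t < K" and x: "x \<in> space M"
  note np = nested_partitions.cube_pos[OF grid[OF t] x, of j] nested_partitions.cube_fin[OF grid[OF t] x, of j]
  have "ennreal C0 * emeasure M (cube t j x) \<noteq> top" using np by (simp add: ennreal_mult_eq_top_iff)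
  then show ?thesis using np emeasure_cube_le_env[OF t x, of j] emeasure_env_le[OF t x, of j]
    by (auto simp: top_unique)
qed

lemma mean_cube_le_env: "t < K \<Longrightarrow> x \<in> space M \<Longrightarrow> mean M (cube t j x) f \<le> ennreal C0 * mean M (env t j x) f"
  using C0 nested_partitions.cube_pos[OF grid, of t x j] nested_partitions.cube_fin[OF grid, of t x j]
  by (intro mean_subset cube_env emeasure_env_le) (auto simp: emeasure_env)

lemma env_adjacent_cube:
  assumes t: "t < K" and x: "x \<in> space M"
  obtains s where "s < K" "\<And>y. y \<in> env t j x \<Longrightarrow> cube s (Suc j) y = cube s (Suc j) x"
    "env t j x \<subseteq> cube s (Suc j) x"
    "emeasure M (cube s (Suc j) x) \<le> ennreal C0 * emeasure M (cube t j x)"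
    "\<And>f. mean M (env t j x) f \<le> ennreal C0 * mean M (cube s (Suc j) x) f"
proof -
  obtain s where s: "s < K" "env t j x \<subseteq> cube s (Suc j) x" "emeasure M (cube s (Suc j) x) \<le> ennreal C0 * emeasure M (cube t j x)"
    using env_cover[OF t x] by blast
  interpret s: nested_partitions M "cube s" by (rule grid[OF s(1)])
  show thesis
  proof (rule that[OF s(1) _ s(2,3)])
    show "cube s (Suc j) y = cube s (Suc j) x" if "y \<in> env t j x" for y
      using that s(2) by (intro s.cube_eq x) auto
    have "ennreal C0 * emeasure M (cube t j x) \<le> ennreal C0 * emeasure M (env t j x)"
      by (intro mult_left_mono emeasure_cube_le_env t x) auto
    then show "mean M (env t j x) f \<le> ennreal C0 * mean M (cube s (Suc j) x) f" for f
      using C0 emeasure_env[OF t x, of j] s.cube_pos[OF x] by (intro mean_subset s(2) order_trans[OF s(3)]) auto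
  qed
qed

text \<open>
  The level \<open>Suc N\<close> is included because an envelope of level \<open>N\<close> is covered by a cube of the next
  level.
\<close>
definition max_all :: "nat \<Rightarrow> ('a \<Rightarrow> ennreal) \<Rightarrow> 'a \<Rightarrow> ennreal" where
  "max_all N f x = (\<Sum>t<K. SUP j\<in>{..Suc N}. mean M (cube t j x) f)"

text \<open>
  The shift by \<open>case_nat {}\<close> has the same reason: the major subset \<open>G l\<close> of a cube of level \<open>l\<close> in one
  system serves the cube of level \<open>Suc l\<close> which covers its envelope in another system, and it
  fills at least \<open>1 / (2 C\<^sub>0)\<close> of that cube if it fills half of the first.
\<close>
definition sparse_all :: "nat \<Rightarrow> (nat \<Rightarrow> 'a set) \<Rightarrow> ('a \<Rightarrow> ennreal) \<Rightarrow> 'a \<Rightarrow> ennreal" where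
  "sparse_all N G f x = (\<Sum>s<K. nested_partitions.sparse M (cube s) (Suc (Suc N)) (1 / (2 * C0)) (case_nat {} G) f x)"

definition sparse_term :: "(nat \<Rightarrow> 'a set) \<Rightarrow> ('a \<Rightarrow> ennreal) \<Rightarrow> nat \<Rightarrow> 'a \<Rightarrow> ennreal" where
  "sparse_term G f l x = (\<Sum>s<K. indicator {x. ennreal (1 / (2 * C0)) \<le> mean M (cube s (Suc l) x) (indicator (G l))} x * mean M (cube s (Suc l) x) f)"

lemma max_all_measurable [measurable]: "max_all N f \<in> borel_measurable M"
proof -
  have "(\<lambda>x. SUP j\<in>{..Suc N}. mean M (cube t j x) f) \<in> borel_measurable M" if "t < K" for t
  proof -
    interpret nested_partitions M "cube t" by (rule grid[OF that])
    show ?thesis by measurable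
  qed
  then show ?thesis unfolding max_all_def[abs_def] by (intro borel_measurable_sum) auto
qed

lemma sparse_all_measurable [measurable]: "sparse_all N G f \<in> borel_measurable M"
  unfolding sparse_all_def[abs_def]
  by (intro borel_measurable_sum nested_partitions.sparse_measurable grid) auto

lemma sparse_term_measurable [measurable]: "sparse_term G f l \<in> borel_measurable M"
proof -
  have "(\<lambda>x. indicator {x. ennreal (1 / (2 * C0)) \<le> mean M (cube s (Suc l) x) (indicator (G l))} x * mean M (cube s (Suc l) x) f) \<in> borel_measurable M"
    (is "?h \<in> _") if "s < K" for s
  proof -
    interpret nested_partitions M "cube s" by (rule grid[OF that])
    have "adapted (Suc l) ?h"
      using adapted_cube[of "Suc l" "\<lambda>C. indicator {C. ennreal (1 / (2 * C0)) \<le> mean M C (indicator (G l))} C * mean M C f"]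
      by (simp add: indicator_def)
    then show ?thesis by (rule adapted_measurable) auto
  qed
  then show ?thesis unfolding sparse_term_def[abs_def] by (intro borel_measurable_sum) auto
qed

lemma sum_sparse_term_le:
  assumes "j \<le> N"
  shows "(\<Sum>l\<le>j. sparse_term G f l x) \<le> sparse_all N G f x"
proof -
  let ?h = "\<lambda>s k. indicator {x. ennreal (1 / (2 * C0)) \<le> mean M (cube s k x) (indicator (case_nat {} G k))} x * mean M (cube s k x) f"
  have "(\<Sum>l\<le>j. sparse_term G f l x) \<le> (\<Sum>l\<le>N. sparse_term G f l x)"
    using assms by (intro sum_mono2) auto
  also have "\<dots> = (\<Sum>s<K. \<Sum>l\<le>N. ?h s (Suc l))"
    unfolding sparse_term_def by (subst sum.swap) simp
  also have "\<dots> \<le> (\<Sum>s<K. \<Sum>k<Suc (Suc N). ?h s k)"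
  proof (rule sum_mono)
    fix s
    have "(\<Sum>k<Suc (Suc N). ?h s k) = ?h s 0 + (\<Sum>l\<le>N. ?h s (Suc l))"
      by (subst sum.lessThan_Suc_shift) (simp only: lessThan_Suc_atMost)
    then show "(\<Sum>l\<le>N. ?h s (Suc l)) \<le> (\<Sum>k<Suc (Suc N). ?h s k)"
      by (simp only: add_increasing zero_le order_refl)
  qed
  also have "\<dots> = sparse_all N G f x"
    unfolding sparse_all_def using grid by (intro sum.cong refl) (simp add: nested_partitions.sparse_def)
  finally show ?thesis .
qed

lemma mean_env_le_sparse_term:
  assumes t: "t < K" and x: "x \<in> space M" and half: "ennreal (1 / 2) \<le> mean M (cube t l x) (indicator (G l))"
    and y: "y \<in> env t l x"
  shows "mean M (env t l x) f \<le> ennreal C0 * sparse_term G f l y"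
proof -
  obtain s where s: "s < K" "cube s (Suc l) y = cube s (Suc l) x" "env t l x \<subseteq> cube s (Suc l) x"
    "emeasure M (cube s (Suc l) x) \<le> ennreal C0 * emeasure M (cube t l x)"
    "mean M (env t l x) f \<le> ennreal C0 * mean M (cube s (Suc l) x) f"
    using env_adjacent_cube[OF t x, of l] y by metis
  interpret t: nested_partitions M "cube t" by (rule grid[OF t])
  interpret s: nested_partitions M "cube s" by (rule grid[OF s(1)])
  have "mean M (cube t l x) (indicator (G l)) \<le> ennreal C0 * mean M (cube s (Suc l) x) (indicator (G l))"
    using C0 cube_env[OF t x, of l] s(3)
    by (intro mean_subset s(4) t.cube_pos t.cube_fin s.cube_pos x) auto
  with half have "ennreal (1 / C0) * ennreal (1 / 2) \<le> ennreal (1 / C0) * (ennreal C0 * mean M (cube s (Suc l) x) (indicator (G l)))"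
    by (intro mult_left_mono) auto
  also have "\<dots> = mean M (cube s (Suc l) x) (indicator (G l))"
    using C0 by (simp add: mult.assoc[symmetric] ennreal_mult[symmetric])
  also have "ennreal (1 / C0) * ennreal (1 / 2) = ennreal (1 / (2 * C0))"
    using C0 by (subst ennreal_mult[symmetric]) auto
  finally have big: "ennreal (1 / (2 * C0)) \<le> mean M (cube s (Suc l) y) (indicator (G l))" unfolding s(2) .
  have le: "mean M (cube s (Suc l) x) f \<le> sparse_term G f l y"
    unfolding sparse_term_def using big s(1)
    by (intro order_trans[OF _ member_le_sum[of s]]) (auto simp: s(2))
  show ?thesis by (rule order_trans[OF s(5) mult_left_mono[OF le]]) simp
qed

lemma mean_env_le_max_all:
  assumes t: "t < K" and x: "x \<in> space M" and y: "y \<in> env t j x" and j: "j \<le> N"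
  shows "mean M (env t j x) f \<le> ennreal C0 * max_all N f y"
proof -
  obtain s where s: "s < K" "cube s (Suc j) y = cube s (Suc j) x"
    "mean M (env t j x) f \<le> ennreal C0 * mean M (cube s (Suc j) x) f"
    using env_adjacent_cube[OF t x, of j] y by metis
  have "mean M (cube s (Suc j) x) f \<le> (SUP k\<in>{..Suc N}. mean M (cube s k y) f)"
    unfolding s(2)[symmetric] using j by (intro SUP_upper) auto
  also have "\<dots> \<le> max_all N f y"
    unfolding max_all_def using s(1) by (intro member_le_sum[of s "{..<K}" "\<lambda>s. SUP k\<in>{..Suc N}. mean M (cube s k y) f"]) auto
  finally have le: "mean M (cube s (Suc j) x) f \<le> max_all N f y" .
  show ?thesis by (rule order_trans[OF s(3) mult_left_mono[OF le]]) simp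
qed

definition const_max :: "real \<Rightarrow> ennreal" where
  "const_max p = epowr (of_nat K) (1 / p) * of_nat K * (4 * sparse_const p (1 / 2))"

definition const_sparse :: "real \<Rightarrow> ennreal" where
  "const_sparse p = epowr (of_nat K) (1 / p) * of_nat K * sparse_const p (1 / (2 * C0))"

context
  fixes p w \<sigma> W
  assumes p: "1 < p" and Ap: "\<And>t. t < K \<Longrightarrow> nested_partitions.dyadic_Ap M (cube t) p w \<sigma> W"
    and w: "w \<in> borel_measurable M"
begin

lemma max_all_bound:
  assumes "f \<in> borel_measurable M"
  shows "wnorm M p w (max_all N f) \<le> const_max p * epowr W (max 1 (1 / (p - 1))) * wnorm M p w f"
proof -
  have "wnorm M p w (max_all N f) \<le> epowr (of_nat (card {..<K})) (1 / p) * of_nat (card {..<K})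
      * (4 * (sparse_const p (1 / 2) * epowr W (max 1 (1 / (p - 1)))) * wnorm M p w f)"
    unfolding max_all_def[abs_def]
  proof (rule wnorm_sum_le[OF _ _ w])
    fix t assume t: "t \<in> {..<K}"
    interpret nested_partitions M "cube t" using t grid by simp
    show "(\<lambda>x. SUP j\<in>{..Suc N}. mean M (cube t j x) f) \<in> borel_measurable M" by measurable
    show "wnorm M p w (\<lambda>x. SUP j\<in>{..Suc N}. avg j f x) \<le> 4 * (sparse_const p (1 / 2) * epowr W (max 1 (1 / (p - 1)))) * wnorm M p w f"
      by (rule maximal_bound[OF Ap p assms]) (use t in simp)
  qed (use p in auto)
  then show ?thesis by (simp add: const_max_def mult.assoc)
qed

lemma sparse_all_bound:
  assumes "f \<in> borel_measurable M" "\<And>l. G l \<in> sets M" "disjoint_family G"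
  shows "wnorm M p w (sparse_all N G f) \<le> const_sparse p * epowr W (max 1 (1 / (p - 1))) * wnorm M p w f"
proof -
  have "wnorm M p w (sparse_all N G f) \<le> epowr (of_nat (card {..<K})) (1 / p) * of_nat (card {..<K})
      * (sparse_const p (1 / (2 * C0)) * epowr W (max 1 (1 / (p - 1))) * wnorm M p w f)"
    unfolding sparse_all_def[abs_def]
  proof (rule wnorm_sum_le[OF _ _ w])
    fix s assume s: "s \<in> {..<K}"
    interpret nested_partitions M "cube s" using s grid by simp
    show "sparse (Suc (Suc N)) (1 / (2 * C0)) (case_nat {} G) f \<in> borel_measurable M" by measurable
    show "wnorm M p w (sparse (Suc (Suc N)) (1 / (2 * C0)) (case_nat {} G) f) \<le> sparse_const p (1 / (2 * C0)) * epowr W (max 1 (1 / (p - 1))) * wnorm M p w f"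
    proof (rule sparse_bound[OF Ap p])
      show "disjoint_family (case_nat {} G)"
        using assms(3) by (auto simp: disjoint_family_on_def split: nat.splits)
    qed (use s C0 assms in \<open>auto split: nat.splits\<close>)
  qed (use p in auto)
  then show ?thesis by (simp add: const_sparse_def mult.assoc)
qed

end

text \<open>
  All points whose envelope of level \<open>l\<close> contains \<open>y\<close> lie in one of the \<open>K\<close> cubes of level \<open>Suc l\<close> that
  contain \<open>y\<close>. This replaces counting overlaps.
\<close>
lemma nn_integral_env_kernel:
  assumes t: "t < K" and y: "y \<in> space M"
  shows "(\<integral>\<^sup>+z. indicator (env t l z) y / emeasure M (env t l z) \<partial>M) \<le> ennreal (of_nat K * C0)"
proof -
  have "(\<integral>\<^sup>+z. indicator (env t l z) y / emeasure M (env t l z) \<partial>M)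
      \<le> (\<integral>\<^sup>+z. (\<Sum>s<K. ennreal C0 / emeasure M (cube s (Suc l) y) * indicator (cube s (Suc l) y) z) \<partial>M)"
  proof (rule nn_integral_mono)
    fix z assume z: "z \<in> space M"
    show "indicator (env t l z) y / emeasure M (env t l z) \<le> (\<Sum>s<K. ennreal C0 / emeasure M (cube s (Suc l) y) * indicator (cube s (Suc l) y) z)"
    proof (cases "y \<in> env t l z")
      case True
      obtain s where s: "s < K" "cube s (Suc l) y = cube s (Suc l) z" "emeasure M (cube s (Suc l) z) \<le> ennreal C0 * emeasure M (cube t l z)"
        using env_adjacent_cube[OF t z, of l] True by metis
      interpret s: nested_partitions M "cube s" by (rule grid[OF s(1)])
      let ?m = "emeasure M (cube s (Suc l) y)" and ?h = "emeasure M (env t l z)"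
      have m: "?m \<noteq> 0" "?m \<noteq> top" using s.cube_pos[OF y] s.cube_fin[OF y] by auto
      have h: "?h \<noteq> 0" "?h \<noteq> top" using emeasure_env[OF t z, of l] by auto
      have "?m \<le> ennreal C0 * ?h"
        unfolding s(2) using s(3) by (rule order_trans) (intro mult_left_mono emeasure_cube_le_env t z, simp)
      then have "?m / ?h \<le> ennreal C0 * ?h / ?h" by (rule divide_right_mono_ennreal)
      then have "1 / ?h * ?m \<le> ennreal C0" using h by (simp add: ennreal_mult_divide_cancel ennreal_divide_times)
      then have "1 / ?h * ?m / ?m \<le> ennreal C0 / ?m" by (rule divide_right_mono_ennreal)
      then have "1 / ?h \<le> ennreal C0 / ?m" unfolding ennreal_mult_divide_cancel(3)[OF m] .
      also have "\<dots> = ennreal C0 / ?m * indicator (cube s (Suc l) y) z"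
        using s.cube_self[OF z, of "Suc l"] by (simp add: s(2))
      also have "\<dots> \<le> (\<Sum>s<K. ennreal C0 / emeasure M (cube s (Suc l) y) * indicator (cube s (Suc l) y) z)"
        using s(1) by (intro member_le_sum[of s "{..<K}" "\<lambda>s. ennreal C0 / emeasure M (cube s (Suc l) y) * indicator (cube s (Suc l) y) z"]) auto
      finally show ?thesis using True by simp
    qed simp
  qed
  also have "\<dots> = (\<Sum>s<K. \<integral>\<^sup>+z. ennreal C0 / emeasure M (cube s (Suc l) y) * indicator (cube s (Suc l) y) z \<partial>M)"
    using nested_partitions.cube_sets[OF grid y] by (intro nn_integral_sum) auto
  also have "\<dots> = (\<Sum>s<K. ennreal C0)"
  proof (intro sum.cong refl)
    fix s assume "s \<in> {..<K}"
    then interpret s: nested_partitions M "cube s" using grid by simp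
    show "(\<integral>\<^sup>+z. ennreal C0 / emeasure M (cube s (Suc l) y) * indicator (cube s (Suc l) y) z \<partial>M) = ennreal C0"
      using s.cube_sets[OF y] s.cube_pos[OF y] s.cube_fin[OF y]
      by (simp add: nn_integral_cmult_indicator ennreal_mult_divide_cancel)
  qed
  also have "\<dots> = ennreal (of_nat K * C0)"
    using C0 by (simp add: ennreal_mult ennreal_of_nat_eq_real_of_nat)
  finally show ?thesis .
qed

text \<open>
  A countable union of rectangles, since the envelope is constant on each cube. Needed for Fubini.
\<close>
lemma env_pair_measurable:
  assumes t: "t < K"
  shows "(\<lambda>(z, y). indicator (env t l z) y :: ennreal) \<in> borel_measurable (M \<Otimes>\<^sub>M M)"
proof -
  interpret t: nested_partitions M "cube t" by (rule grid[OF t])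
  let ?E = "\<Union>Q\<in>cube t l ` space M. Q \<times> env t l (SOME z. z \<in> Q)"
  have rep: "(SOME z. z \<in> cube t l x) \<in> cube t l x" if "x \<in> space M" for x
    using t.cube_self[OF that] by (rule someI)
  have "?E \<in> sets (M \<Otimes>\<^sub>M M)"
  proof (rule sets.countable_UN''[OF t.cube_countable])
    fix Q assume "Q \<in> cube t l ` space M"
    then obtain x where x: "x \<in> space M" "Q = cube t l x" by auto
    show "Q \<times> env t l (SOME z. z \<in> Q) \<in> sets (M \<Otimes>\<^sub>M M)"
      unfolding x(2) by (intro pair_measureI t.cube_sets x env_sets t t.cube_space[OF x(1) rep[OF x(1)]])
  qed
  then have "indicator ?E \<in> borel_measurable (M \<Otimes>\<^sub>M M)" by simp
  moreover have "(\<lambda>(z, y). indicator (env t l z) y :: ennreal) zy = indicator ?E zy" if zy: "zy \<in> space (M \<Otimes>\<^sub>M M)" for zy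
  proof -
    obtain z y where eq: "zy = (z, y)" and z: "z \<in> space M" using zy by (auto simp: space_pair_measure)
    have "zy \<in> ?E \<longleftrightarrow> y \<in> env t l z"
    proof
      assume "zy \<in> ?E"
      then obtain x where x: "x \<in> space M" "z \<in> cube t l x" "y \<in> env t l (SOME z. z \<in> cube t l x)" using eq by auto
      then show "y \<in> env t l z"
        using env_eq[OF t x(1) rep[OF x(1)]] env_eq[OF t x(1,2)] by simp
    next
      assume "y \<in> env t l z"
      then have "y \<in> env t l (SOME u. u \<in> cube t l z)" using env_eq[OF t z rep[OF z]] by simp
      then show "zy \<in> ?E" using z t.cube_self[OF z, of l] eq by blast
    qed
    then show ?thesis by (simp add: eq indicator_def)
  qed
  ultimately show ?thesis by (subst measurable_cong) auto
qed

text \<open>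
  The oscillations of the previous estimate are replaced by averages of \<open>\<nu>\<close> over envelopes. In the
  first sum the maximal function can be moved under such an average, because its size at \<open>x\<close> is
  comparable with its size on the whole envelope; this gives \<open>A(\<nu> M f)\<close> with a sparse operator \<open>A\<close>.
  In the second sum, Fubini's theorem moves the averaging from \<open>\<nu>\<close> to \<open>f\<close>; this gives \<open>M(\<nu> A f)\<close>. In both
  terms one operator acts on each side of \<open>\<nu>\<close>.
\<close>
lemma dyadic_commutator_pointwise:
  fixes B :: "nat \<Rightarrow> 'a \<Rightarrow> complex" and b :: "'a \<Rightarrow> complex" and f \<nu> :: "'a \<Rightarrow> ennreal" and \<beta> :: ennreal
  defines "F \<equiv> \<lambda>i y. ennreal (cmod (b y - B i y))"
  assumes t: "t < K" and b [measurable]: "b \<in> borel_measurable M"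
    and f [measurable]: "f \<in> borel_measurable M" and \<nu> [measurable]: "\<nu> \<in> borel_measurable M"
    and B: "\<And>i. nested_partitions.adapted M (cube t) i (B i)"
    and B_diff: "\<And>i j x. x \<in> space M \<Longrightarrow> j \<le> i \<Longrightarrow> ennreal (cmod (B j x - B i x)) \<le> mean M (cube t j x) (F i)"
    and bmo: "\<And>l x. x \<in> space M \<Longrightarrow> mean M (cube t l x) (F l) \<le> \<beta> * mean M (env t l x) \<nu>"
    and j: "j \<le> N" and x: "x \<in> space M"
  defines "G \<equiv> nested_partitions.last_stop_set M (cube t) F f N"
  shows "mean M (cube t j x) (\<lambda>y. ennreal (cmod (B 0 x - B 0 y)) * f y)
    \<le> ennreal (32 * C0) * (\<beta> * (ennreal (C0 ^ 3) * sparse_all N G (\<lambda>y. \<nu> y * max_all N f y) x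
        + ennreal (real K * C0 ^ 5) * max_all N (\<lambda>y. \<nu> y * sparse_all N G f y) x))"
proof -
  interpret nested_partitions M "cube t" by (rule grid[OF t])
  interpret sigma_finite_measure M by (rule sigma_finite)
  interpret P: pair_sigma_finite M M ..
  have Bm [measurable]: "B i \<in> borel_measurable M" for i
    by (rule adapted_measurable[OF B]) auto
  have Fm [measurable]: "F i \<in> borel_measurable M" for i unfolding F_def by measurable
  let ?lev = "stop_level (stops F f) N"
  let ?c = "ennreal C0"
  define osc where "osc l y = (if ?lev l y = l then avg l (F l) y else 0)" for l y
  have osc_le: "osc l y \<le> \<beta> * mean M (env t l y) \<nu>" if "y \<in> space M" for l y
    using bmo[OF that] by (simp add: osc_def)
  have half: "ennreal (1 / 2) \<le> avg l (indicator (G l)) y" if "y \<in> space M" "l \<le> N" "?lev l y = l" for l y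
    unfolding G_def by (rule avg_last_stop_set[OF Fm f that])
  have avg_doubling: "avg j g y \<le> ennreal C0 * avg (Suc j) g y" if "y \<in> space M" for j y g
    using C0 by (intro avg_le_Suc that cube_doubling t) auto
  let ?First = "\<Sum>l\<le>N. osc l x * (SUP i\<in>{l..N}. avg i f x)"
  let ?Second = "avg j (\<lambda>y. \<Sum>l\<le>j. osc l y * avg l f y) x"
  have main: "avg j (\<lambda>y. ennreal (cmod (B 0 x - B 0 y)) * f y) x \<le> ennreal (32 * C0) * (?First + ?Second)"
    unfolding osc_def F_def
    using oscillation_domination[of b f B C0 x j N, OF b f B _ C0 avg_doubling x j] B_diff
    unfolding F_def by blast
  have first: "?First \<le> \<beta> * (ennreal (C0 ^ 3) * sparse_all N G (\<lambda>y. \<nu> y * max_all N f y) x)"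
  proof -
    have "osc l x * (SUP i\<in>{l..N}. avg i f x) \<le> \<beta> * (?c * ?c) * (?c * sparse_term G (\<lambda>y. \<nu> y * max_all N f y) l x)"
      if l: "l \<le> N" for l
    proof (cases "?lev l x = l")
      case True
      let ?m = "SUP i\<in>{l..N}. avg i f x"
      \<comment> \<open>The envelope of level \<open>l\<close> is contained in those of all coarser levels.\<close>
      have mle: "?m \<le> ?c * ?c * max_all N f y" if y: "y \<in> env t l x" for y
      proof (rule SUP_least)
        fix i assume i: "i \<in> {l..N}"
        have "avg i f x \<le> ?c * mean M (env t i x) f" by (rule mean_cube_le_env[OF t x])
        also have "\<dots> \<le> ?c * (?c * max_all N f y)"
          using i y env_mono[OF t x, of l i] by (intro mult_left_mono mean_env_le_max_all[OF t x]) auto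
        finally show "avg i f x \<le> ?c * ?c * max_all N f y" by (simp only: mult.assoc)
      qed
      have "osc l x * ?m \<le> \<beta> * mean M (env t l x) \<nu> * ?m" by (intro mult_right_mono osc_le x) simp
      also have "\<dots> = \<beta> * mean M (env t l x) (\<lambda>y. ?m * \<nu> y)"
        using t x by (subst mean_cmult) (auto simp: env_sets mult_ac)
      also have "\<dots> \<le> \<beta> * mean M (env t l x) (\<lambda>y. (?c * ?c) * (\<nu> y * max_all N f y))"
      proof (intro mult_left_mono mean_mono)
        fix y assume "y \<in> env t l x"
        then have "?m * \<nu> y \<le> ?c * ?c * max_all N f y * \<nu> y" by (intro mult_right_mono mle) auto
        then show "?m * \<nu> y \<le> (?c * ?c) * (\<nu> y * max_all N f y)" by (simp only: mult_ac)
      qed simp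
      also have "\<dots> = \<beta> * (?c * ?c) * mean M (env t l x) (\<lambda>y. \<nu> y * max_all N f y)"
        using t x by (subst mean_cmult) (auto simp: env_sets mult.assoc)
      also have "\<dots> \<le> \<beta> * (?c * ?c) * (?c * sparse_term G (\<lambda>y. \<nu> y * max_all N f y) l x)"
        by (intro mult_left_mono mean_env_le_sparse_term[where G = G and l = l, OF t x half[OF x l True] env_self[OF t x]]) simp
      finally show ?thesis .
    qed (simp add: osc_def)
    then have "?First \<le> (\<Sum>l\<le>N. \<beta> * (?c * ?c) * (?c * sparse_term G (\<lambda>y. \<nu> y * max_all N f y) l x))"
      by (intro sum_mono) auto
    also have "\<dots> = \<beta> * ((?c * ?c * ?c) * (\<Sum>l\<le>N. sparse_term G (\<lambda>y. \<nu> y * max_all N f y) l x))"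
      by (simp only: sum_distrib_left[symmetric] mult.assoc)
    also have "\<dots> \<le> \<beta> * ((?c * ?c * ?c) * sparse_all N G (\<lambda>y. \<nu> y * max_all N f y) x)"
      by (intro mult_left_mono sum_sparse_term_le) auto
    also have "?c * ?c * ?c = ennreal (C0 ^ 3)"
      using C0 by (simp add: ennreal_mult[symmetric] power3_eq_cube)
    finally show ?thesis .
  qed
  have second: "?Second \<le> \<beta> * (ennreal (real K * C0 ^ 5) * max_all N (\<lambda>y. \<nu> y * sparse_all N G f y) x)"
  proof -
    let ?Q = "cube t j x" and ?H = "env t j x"
    have [measurable]: "?Q \<in> sets M" "?H \<in> sets M" using x t by (auto simp: cube_sets env_sets)
    define u where "u l z = (if ?lev l z = l then avg l f z else 0) * indicator ?Q z" for l z
    have um: "u l \<in> borel_measurable M" if "l \<le> N" for l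
    proof -
      have "?lev l \<in> measurable M (count_space UNIV)"
        by (rule adapted_measurable[OF lev_adapted[OF Fm f that]]) auto
      then show ?thesis unfolding u_def[abs_def] by measurable
    qed
    have oscu: "osc l z * avg l f z * indicator ?Q z \<le> \<beta> * (u l z * mean M (env t l z) \<nu>)" if z: "z \<in> space M" for l z
      using mult_right_mono[OF osc_le[OF z, of l], of "avg l f z * indicator ?Q z"]
      by (cases "?lev l z = l") (simp_all add: u_def osc_def mult_ac)
    have meanm: "(\<lambda>z. mean M (env t l z) \<nu>) \<in> borel_measurable M" for l
    proof (rule adapted_measurable[of l])
      show "adapted l (\<lambda>z. mean M (env t l z) \<nu>)"
      proof (rule adaptedI)
        fix z y assume "z \<in> space M" "y \<in> cube t l z"
        then have "env t l y = env t l z" by (rule env_eq[OF t])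
        then show "mean M (env t l y) \<nu> = mean M (env t l z) \<nu>" by simp
      qed
    qed auto
    have envm: "(\<lambda>z. emeasure M (env t l z)) \<in> borel_measurable M" for l
    proof (rule adapted_measurable[of l])
      show "adapted l (\<lambda>z. emeasure M (env t l z))"
      proof (rule adaptedI)
        fix z y assume "z \<in> space M" "y \<in> cube t l z"
        then have "env t l y = env t l z" by (rule env_eq[OF t])
        then show "emeasure M (env t l y) = emeasure M (env t l z)" by simp
      qed
    qed auto
    \<comment> \<open>Fubini: integrate first over the points \<open>z\<close> whose envelope contains \<open>y\<close>.\<close>
    have level: "(\<integral>\<^sup>+z. u l z * mean M (env t l z) \<nu> \<partial>M) \<le> ennreal (real K * C0 ^ 3) * (\<integral>\<^sup>+y\<in>?H. \<nu> y * sparse_term G f l y \<partial>M)"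
      if l: "l \<le> j" for l
    proof -
      have lN: "l \<le> N" using l j by simp
      let ?k = "\<lambda>z y. indicator (env t l z) y / emeasure M (env t l z) :: ennreal"
      note [measurable] = um[OF lN] envm[of l]
      have km [measurable]: "(\<lambda>(z, y). indicator (env t l z) y :: ennreal) \<in> borel_measurable (M \<Otimes>\<^sub>M M)"
        by (rule env_pair_measurable[OF t])
      have km1: "(\<lambda>y. indicator (env t l z) y :: ennreal) \<in> borel_measurable M" if "z \<in> space M" for z
        using env_sets[OF t that] by simp
      have "(\<integral>\<^sup>+z. u l z * mean M (env t l z) \<nu> \<partial>M) = (\<integral>\<^sup>+z. (\<integral>\<^sup>+y. u l z * (?k z y * \<nu> y) \<partial>M) \<partial>M)"
      proof (rule nn_integral_cong)
        fix z assume z: "z \<in> space M"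
        have [measurable]: "env t l z \<in> sets M" by (rule env_sets[OF t z])
        have "(\<integral>\<^sup>+y. u l z * (?k z y * \<nu> y) \<partial>M) = (\<integral>\<^sup>+y. (u l z * (\<nu> y * indicator (env t l z) y)) / emeasure M (env t l z) \<partial>M)"
          by (intro nn_integral_cong) (simp add: ennreal_times_divide ennreal_divide_times mult_ac)
        also have "\<dots> = u l z * mean M (env t l z) \<nu>"
          by (simp add: nn_integral_divide nn_integral_cmult mean_def ennreal_times_divide)
        finally show "u l z * mean M (env t l z) \<nu> = (\<integral>\<^sup>+y. u l z * (?k z y * \<nu> y) \<partial>M)" by simp
      qed
      also have "\<dots> = (\<integral>\<^sup>+y. (\<integral>\<^sup>+z. u l z * (?k z y * \<nu> y) \<partial>M) \<partial>M)"
      proof (rule P.Fubini'[symmetric])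
        have [measurable]: "(\<lambda>w. indicator (env t l (fst w)) (snd w) :: ennreal) \<in> borel_measurable (M \<Otimes>\<^sub>M M)"
          using km by (simp add: case_prod_beta')
        show "(\<lambda>(z, y). u l z * (?k z y * \<nu> y)) \<in> borel_measurable (M \<Otimes>\<^sub>M M)"
          unfolding case_prod_beta' by measurable
      qed
      also have "\<dots> \<le> (\<integral>\<^sup>+y. ennreal (real K * C0 ^ 3) * (\<nu> y * sparse_term G f l y * indicator ?H y) \<partial>M)"
      proof (rule nn_integral_mono)
        fix y assume y: "y \<in> space M"
        have kz [measurable]: "(\<lambda>z. ?k z y) \<in> borel_measurable M"
        proof -
          have "(\<lambda>z. indicator (env t l z) y :: ennreal) \<in> borel_measurable M"
            using measurable_Pair_compose_split[OF km measurable_ident_sets[OF refl] measurable_const[OF y]] by simp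
          then show ?thesis by measurable
        qed
        have "(\<integral>\<^sup>+z. u l z * (?k z y * \<nu> y) \<partial>M) \<le> (\<integral>\<^sup>+z. (?c * ?c * sparse_term G f l y * \<nu> y * indicator ?H y) * ?k z y \<partial>M)"
        proof (rule nn_integral_mono)
          fix z assume z: "z \<in> space M"
          show "u l z * (?k z y * \<nu> y) \<le> (?c * ?c * sparse_term G f l y * \<nu> y * indicator ?H y) * ?k z y"
          proof (cases "?lev l z = l \<and> z \<in> ?Q \<and> y \<in> env t l z")
            case True
            have "u l z = avg l f z" using True by (simp add: u_def)
            also have "\<dots> \<le> ?c * mean M (env t l z) f" by (rule mean_cube_le_env[OF t z])
            also have "\<dots> \<le> ?c * (?c * sparse_term G f l y)"
              using True by (intro mult_left_mono mean_env_le_sparse_term[where G = G and l = l, OF t z half[OF z lN]]) auto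
            finally have ul: "u l z \<le> ?c * ?c * sparse_term G f l y" by (simp only: mult.assoc)
            have "y \<in> ?H" using True env_mono[OF t z l] env_eq[OF t x, of z j] by auto
            then have "u l z * (?k z y * \<nu> y) \<le> (?c * ?c * sparse_term G f l y) * (?k z y * \<nu> y) * indicator ?H y"
              using ul by (simp add: mult_right_mono)
            then show ?thesis by (simp only: mult_ac)
          qed (auto simp: u_def)
        qed
        also have "\<dots> = (?c * ?c * sparse_term G f l y * \<nu> y * indicator ?H y) * (\<integral>\<^sup>+z. ?k z y \<partial>M)"
          by (rule nn_integral_cmult) measurable
        also have "\<dots> \<le> (?c * ?c * sparse_term G f l y * \<nu> y * indicator ?H y) * ennreal (of_nat K * C0)"
          by (intro mult_left_mono nn_integral_env_kernel t y) simp
        also have "\<dots> = (?c * ?c * ennreal (of_nat K * C0)) * (\<nu> y * sparse_term G f l y * indicator ?H y)"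
          by (simp only: mult_ac)
        also have "?c * ?c * ennreal (of_nat K * C0) = ennreal (real K * C0 ^ 3)"
          using C0 by (simp add: ennreal_mult[symmetric] power3_eq_cube mult_ac)
        finally show "(\<integral>\<^sup>+z. u l z * (?k z y * \<nu> y) \<partial>M) \<le> ennreal (real K * C0 ^ 3) * (\<nu> y * sparse_term G f l y * indicator ?H y)" .
      qed
      also have "\<dots> = ennreal (real K * C0 ^ 3) * (\<integral>\<^sup>+y\<in>?H. \<nu> y * sparse_term G f l y \<partial>M)"
        by (rule nn_integral_cmult) measurable
      finally show ?thesis .
    qed
    have "(\<integral>\<^sup>+z\<in>?Q. (\<Sum>l\<le>j. osc l z * avg l f z) \<partial>M) \<le> (\<integral>\<^sup>+z. (\<Sum>l\<le>j. \<beta> * (u l z * mean M (env t l z) \<nu>)) \<partial>M)"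
      unfolding sum_distrib_right by (intro nn_integral_mono sum_mono oscu)
    also have "\<dots> = (\<Sum>l\<le>j. \<beta> * (\<integral>\<^sup>+z. u l z * mean M (env t l z) \<nu> \<partial>M))"
    proof -
      have m: "(\<lambda>z. u l z * mean M (env t l z) \<nu>) \<in> borel_measurable M" if "l \<in> {..j}" for l
        using that j by (intro borel_measurable_times_ennreal um meanm) simp
      have "(\<integral>\<^sup>+z. (\<Sum>l\<le>j. \<beta> * (u l z * mean M (env t l z) \<nu>)) \<partial>M) = (\<Sum>l\<le>j. (\<integral>\<^sup>+z. \<beta> * (u l z * mean M (env t l z) \<nu>) \<partial>M))"
        by (rule nn_integral_sum) (rule borel_measurable_times_ennreal[OF borel_measurable_const m])
      also have "\<dots> = (\<Sum>l\<le>j. \<beta> * (\<integral>\<^sup>+z. u l z * mean M (env t l z) \<nu> \<partial>M))"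
        by (rule sum.cong[OF refl], rule nn_integral_cmult, rule m)
      finally show ?thesis .
    qed
    also have "\<dots> \<le> (\<Sum>l\<le>j. \<beta> * (ennreal (real K * C0 ^ 3) * (\<integral>\<^sup>+y\<in>?H. \<nu> y * sparse_term G f l y \<partial>M)))"
      by (intro sum_mono mult_left_mono level) auto
    also have "\<dots> = \<beta> * (ennreal (real K * C0 ^ 3) * (\<integral>\<^sup>+y. (\<Sum>l\<le>j. \<nu> y * sparse_term G f l y * indicator ?H y) \<partial>M))"
      by (subst nn_integral_sum) (auto simp: sum_distrib_left)
    also have "\<dots> \<le> \<beta> * (ennreal (real K * C0 ^ 3) * (\<integral>\<^sup>+y\<in>?H. \<nu> y * sparse_all N G f y \<partial>M))"
    proof (intro mult_left_mono nn_integral_mono)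
      fix y
      have "(\<Sum>l\<le>j. \<nu> y * sparse_term G f l y * indicator ?H y) = \<nu> y * (\<Sum>l\<le>j. sparse_term G f l y) * indicator ?H y"
        by (simp only: sum_distrib_left sum_distrib_right)
      also have "\<dots> \<le> \<nu> y * sparse_all N G f y * indicator ?H y"
        by (intro mult_right_mono mult_left_mono sum_sparse_term_le j) auto
      finally show "(\<Sum>l\<le>j. \<nu> y * sparse_term G f l y * indicator ?H y) \<le> \<nu> y * sparse_all N G f y * indicator ?H y" .
    qed auto
    finally have le: "(\<integral>\<^sup>+z\<in>?Q. (\<Sum>l\<le>j. osc l z * avg l f z) \<partial>M) \<le> \<beta> * (ennreal (real K * C0 ^ 3) * (\<integral>\<^sup>+y\<in>?H. \<nu> y * sparse_all N G f y \<partial>M))" .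
    let ?mQ = "emeasure M ?Q" and ?mH = "emeasure M ?H" and ?I = "\<integral>\<^sup>+y\<in>?H. \<nu> y * sparse_all N G f y \<partial>M"
    have mQ: "?mQ \<noteq> 0" "?mQ \<noteq> top" and mH: "?mH \<noteq> 0" "?mH \<noteq> top"
      using cube_pos[OF x] cube_fin[OF x] emeasure_env[OF t x, of j] by auto
    have "?I / ?mQ \<le> ?c * mean M ?H (\<lambda>y. \<nu> y * sparse_all N G f y)"
    proof -
      have "?I / ?mQ = (?I / ?mH) * ?mH / ?mQ" using mH by (simp add: ennreal_mult_divide_cancel)
      also have "\<dots> \<le> (?I / ?mH) * (?c * ?mQ) / ?mQ"
        by (intro divide_right_mono_ennreal mult_left_mono emeasure_env_le t x) simp
      also have "\<dots> = ?c * mean M ?H (\<lambda>y. \<nu> y * sparse_all N G f y)"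
        unfolding mult.assoc[symmetric] ennreal_mult_divide_cancel(3)[OF mQ] mean_def by (rule mult.commute)
      finally show ?thesis .
    qed
    also have "\<dots> \<le> ?c * (?c * max_all N (\<lambda>y. \<nu> y * sparse_all N G f y) x)"
      by (intro mult_left_mono mean_env_le_max_all[OF t x env_self[OF t x] j]) simp
    finally have I: "?I / ?mQ \<le> ?c * ?c * max_all N (\<lambda>y. \<nu> y * sparse_all N G f y) x" by (simp only: mult.assoc)
    have "?Second \<le> \<beta> * (ennreal (real K * C0 ^ 3) * ?I) / ?mQ"
      unfolding mean_def[of M ?Q] by (rule divide_right_mono_ennreal[OF le])
    also have "\<dots> = \<beta> * (ennreal (real K * C0 ^ 3) * (?I / ?mQ))" by (simp only: ennreal_times_divide)
    also have "\<dots> \<le> \<beta> * (ennreal (real K * C0 ^ 3) * (?c * ?c * max_all N (\<lambda>y. \<nu> y * sparse_all N G f y) x))"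
      by (intro mult_left_mono I) auto
    also have "\<dots> = \<beta> * ((ennreal (real K * C0 ^ 3) * (?c * ?c)) * max_all N (\<lambda>y. \<nu> y * sparse_all N G f y) x)"
      by (simp only: mult.assoc)
    also have "ennreal (real K * C0 ^ 3) * (?c * ?c) = ennreal (real K * C0 ^ 5)"
    proof -
      have "real K * C0 ^ 3 * (C0 * C0) = real K * C0 ^ 5" by (simp add: eval_nat_numeral)
      then show ?thesis using C0 by (simp add: ennreal_mult[symmetric])
    qed
    finally show ?thesis .
  qed
  have "?First + ?Second \<le> \<beta> * (ennreal (C0 ^ 3) * sparse_all N G (\<lambda>y. \<nu> y * max_all N f y) x
        + ennreal (real K * C0 ^ 5) * max_all N (\<lambda>y. \<nu> y * sparse_all N G f y) x)"
    unfolding distrib_left by (rule add_mono[OF first second])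
  then show ?thesis by (rule order_trans[OF main mult_left_mono]) simp
qed

definition const_commutator :: "real \<Rightarrow> ennreal" where
  "const_commutator p = ennreal (32 * C0) * ennreal (real (Suc K) * C0 ^ 5) * (epowr 2 (1 / p) * 2) * (const_sparse p * const_max p)"

text \<open>
  Each of the two terms is a composition of two operators with \<open>\<nu>\<close> in between, so each weight is
  used once and the characteristics are multiplied.
\<close>
lemma dyadic_commutator_bound:
  fixes B :: "nat \<Rightarrow> 'a \<Rightarrow> complex" and b :: "'a \<Rightarrow> complex" and f \<nu> w1 w2 \<sigma>1 \<sigma>2 :: "'a \<Rightarrow> ennreal" and \<beta> :: ennreal
  defines "F \<equiv> \<lambda>i y. ennreal (cmod (b y - B i y))"
  assumes t: "t < K" and b [measurable]: "b \<in> borel_measurable M"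
    and f [measurable]: "f \<in> borel_measurable M" and \<nu> [measurable]: "\<nu> \<in> borel_measurable M"
    and B: "\<And>i. nested_partitions.adapted M (cube t) i (B i)"
    and B_diff: "\<And>i j x. x \<in> space M \<Longrightarrow> j \<le> i \<Longrightarrow> ennreal (cmod (B j x - B i x)) \<le> mean M (cube t j x) (F i)"
    and bmo: "\<And>l x. x \<in> space M \<Longrightarrow> mean M (cube t l x) (F l) \<le> \<beta> * mean M (env t l x) \<nu>"
    and p: "1 < p"
    and w1 [measurable]: "w1 \<in> borel_measurable M" and w2 [measurable]: "w2 \<in> borel_measurable M"
    and Ap1: "\<And>t. t < K \<Longrightarrow> nested_partitions.dyadic_Ap M (cube t) p w1 \<sigma>1 W1"
    and Ap2: "\<And>t. t < K \<Longrightarrow> nested_partitions.dyadic_Ap M (cube t) p w2 \<sigma>2 W2"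
    and Bloom: "AE x in M. epowr (\<nu> x) p * w2 x = w1 x"
  shows "wnorm M p w2 (\<lambda>x. SUP j\<in>{..N}. mean M (cube t j x) (\<lambda>y. ennreal (cmod (B 0 x - B 0 y)) * f y))
    \<le> const_commutator p * epowr (W1 * W2) (max 1 (1 / (p - 1))) * \<beta> * wnorm M p w1 f"
proof -
  interpret nested_partitions M "cube t" by (rule grid[OF t])
  have [measurable]: "F i \<in> borel_measurable M" for i
  proof -
    have [measurable]: "B i \<in> borel_measurable M" by (rule adapted_measurable[OF B]) auto
    show ?thesis unfolding F_def by measurable
  qed
  let ?G = "last_stop_set F f N" and ?e = "max 1 (1 / (p - 1))"
  have G: "?G l \<in> sets M" "disjoint_family ?G" for l
    by (rule last_stop_set_sets; simp) (rule last_stop_set_disjoint; simp)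
  let ?u = "sparse_all N ?G (\<lambda>y. \<nu> y * max_all N f y)" and ?v = "max_all N (\<lambda>y. \<nu> y * sparse_all N ?G f y)"
  let ?c = "ennreal (32 * C0) * ennreal (real (Suc K) * C0 ^ 5) * \<beta>"
  let ?A = "const_sparse p * const_max p * epowr (W1 * W2) ?e * wnorm M p w1 f"
  have pt: "(SUP j\<in>{..N}. mean M (cube t j x) (\<lambda>y. ennreal (cmod (B 0 x - B 0 y)) * f y)) \<le> ?c * (?u x + ?v x)"
    if x: "x \<in> space M" for x
  proof (rule SUP_least)
    fix j assume j: "j \<in> {..N}"
    have "C0 ^ 3 \<le> C0 ^ 5" using C0 by (intro power_increasing) auto
    also have "\<dots> \<le> real (Suc K) * C0 ^ 5" using C0 by simp
    finally have c: "C0 ^ 3 \<le> real (Suc K) * C0 ^ 5" "real K * C0 ^ 5 \<le> real (Suc K) * C0 ^ 5"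
      using C0 by (auto intro!: mult_right_mono)
    have "mean M (cube t j x) (\<lambda>y. ennreal (cmod (B 0 x - B 0 y)) * f y)
        \<le> ennreal (32 * C0) * (\<beta> * (ennreal (C0 ^ 3) * ?u x + ennreal (real K * C0 ^ 5) * ?v x))"
      unfolding F_def using dyadic_commutator_pointwise[OF t b f \<nu> B _ _ _ x] B_diff bmo j unfolding F_def by blast
    also have "\<dots> \<le> ennreal (32 * C0) * (\<beta> * (ennreal (real (Suc K) * C0 ^ 5) * ?u x + ennreal (real (Suc K) * C0 ^ 5) * ?v x))"
      by (intro mult_left_mono add_mono mult_right_mono ennreal_leI c) auto
    also have "\<dots> = ?c * (?u x + ?v x)" by (simp only: distrib_left mult_ac)
    finally show "mean M (cube t j x) (\<lambda>y. ennreal (cmod (B 0 x - B 0 y)) * f y) \<le> ?c * (?u x + ?v x)" .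
  qed
  have u: "wnorm M p w2 ?u \<le> ?A"
  proof -
    have "wnorm M p w2 ?u \<le> const_sparse p * epowr W2 ?e * wnorm M p w2 (\<lambda>y. \<nu> y * max_all N f y)"
      by (rule sparse_all_bound[OF p Ap2 w2 _ G]) measurable
    also have "wnorm M p w2 (\<lambda>y. \<nu> y * max_all N f y) = wnorm M p w1 (max_all N f)"
      by (rule wnorm_Bloom[OF _ Bloom]) (use p in simp)
    also have "const_sparse p * epowr W2 ?e * wnorm M p w1 (max_all N f)
        \<le> const_sparse p * epowr W2 ?e * (const_max p * epowr W1 ?e * wnorm M p w1 f)"
      by (intro mult_left_mono max_all_bound[OF p Ap1 w1 f]) auto
    also have "\<dots> = ?A" by (simp only: epowr_mult mult_ac)
    finally show ?thesis .
  qed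
  have v: "wnorm M p w2 ?v \<le> ?A"
  proof -
    have "wnorm M p w2 ?v \<le> const_max p * epowr W2 ?e * wnorm M p w2 (\<lambda>y. \<nu> y * sparse_all N ?G f y)"
      by (rule max_all_bound[OF p Ap2 w2]) measurable
    also have "wnorm M p w2 (\<lambda>y. \<nu> y * sparse_all N ?G f y) = wnorm M p w1 (sparse_all N ?G f)"
      by (rule wnorm_Bloom[OF _ Bloom]) (use p in simp)
    also have "const_max p * epowr W2 ?e * wnorm M p w1 (sparse_all N ?G f)
        \<le> const_max p * epowr W2 ?e * (const_sparse p * epowr W1 ?e * wnorm M p w1 f)"
      by (intro mult_left_mono sparse_all_bound[OF p Ap1 w1 f G]) auto
    also have "\<dots> = ?A" by (simp only: epowr_mult mult_ac)
    finally show ?thesis .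
  qed
  have p0: "0 < p" using p by simp
  have "wnorm M p w2 (\<lambda>x. SUP j\<in>{..N}. mean M (cube t j x) (\<lambda>y. ennreal (cmod (B 0 x - B 0 y)) * f y))
      \<le> wnorm M p w2 (\<lambda>x. ?c * (?u x + ?v x))"
    by (rule wnorm_mono[OF p0 pt])
  also have "\<dots> = ?c * wnorm M p w2 (\<lambda>x. ?u x + ?v x)" by (rule wnorm_cmult[OF p0]) measurable
  also have "\<dots> \<le> ?c * (epowr 2 (1 / p) * 2 * ?A)"
    by (intro mult_left_mono wnorm_add_le p0 u v) auto
  also have "\<dots> = const_commutator p * epowr (W1 * W2) ?e * \<beta> * wnorm M p w1 f"
    by (simp only: const_commutator_def mult_ac)
  finally show ?thesis .
qed

lemma const_commutator_finite: "const_commutator p \<noteq> top"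
  by (simp add: const_commutator_def const_sparse_def const_max_def ennreal_mult_eq_top_iff sparse_const_finite)

end


section \<open>Balls and nets in spaces of homogeneous type\<close>

locale homogeneous_space = space_of_homogeneous_type d M for d :: "'a \<Rightarrow> 'a \<Rightarrow> real" and M :: "'a measure" +
  fixes A Cd :: real
  assumes A: "1 \<le> A" and triangle: "\<lbrakk>x \<in> space M; y \<in> space M; z \<in> space M\<rbrakk> \<Longrightarrow> d x y \<le> A * (d x z + d z y)"
    and Cd: "1 \<le> Cd" and doubling_ball: "\<lbrakk>x \<in> space M; 0 < r\<rbrakk> \<Longrightarrow>
      emeasure M (qball d (space M) x (2 * r)) \<le> ennreal Cd * emeasure M (qball d (space M) x r)"

lemma (in space_of_homogeneous_type) homogeneous_space_exists: "\<exists>A Cd. homogeneous_space d M A Cd"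
proof -
  obtain A where A: "A \<ge> 1" "\<forall>x\<in>space M. \<forall>y\<in>space M. \<forall>z\<in>space M. d x y \<le> A * (d x z + d z y)"
    using quasi_triangle by blast
  obtain C where C: "\<forall>x\<in>space M. \<forall>r>0. emeasure M (qball d (space M) x (2 * r)) \<le> ennreal C * emeasure M (qball d (space M) x r)"
    using doubling by blast
  have "homogeneous_space d M A (max 1 C)"
  proof unfold_locales
    fix x r assume "x \<in> space M" "0 < (r::real)"
    then have "emeasure M (qball d (space M) x (2 * r)) \<le> ennreal C * emeasure M (qball d (space M) x r)" using C by blast
    also have "\<dots> \<le> ennreal (max 1 C) * emeasure M (qball d (space M) x r)" by (intro mult_right_mono ennreal_leI) auto
    finally show "emeasure M (qball d (space M) x (2 * r)) \<le> ennreal (max 1 C) * emeasure M (qball d (space M) x r)" .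
  qed (use A in auto)
  then show ?thesis by blast
qed

context homogeneous_space
begin

abbreviation bl :: "'a \<Rightarrow> real \<Rightarrow> 'a set" where "bl x r \<equiv> qball d (space M) x r"

lemma mem_bl: "y \<in> bl x r \<longleftrightarrow> y \<in> space M \<and> d x y < r"
  by (simp add: qball_def)

lemma bl_mono: "r \<le> s \<Longrightarrow> bl x r \<subseteq> bl x s"
  by (auto simp: mem_bl)

lemma d_self [simp]: "x \<in> space M \<Longrightarrow> d x x = 0"
  by (simp add: dist_zero_iff)

lemma triangle_less:
  assumes "x \<in> space M" "y \<in> space M" "z \<in> space M" "d x z < a" "d z y \<le> b"
  shows "d x y < A * (a + b)"
proof -
  have "d x y \<le> A * (d x z + d z y)" by (rule triangle) fact+
  also have "\<dots> < A * (a + b)" using assms A by (intro mult_strict_left_mono) auto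
  finally show ?thesis .
qed

lemma bl_pow: "x \<in> space M \<Longrightarrow> 0 < r \<Longrightarrow> emeasure M (bl x (2 ^ n * r)) \<le> ennreal (Cd ^ n) * emeasure M (bl x r)"
proof (induction n)
  case (Suc n)
  have "emeasure M (bl x (2 ^ Suc n * r)) = emeasure M (bl x (2 * (2 ^ n * r)))" by (simp add: mult.assoc)
  also have "\<dots> \<le> ennreal Cd * emeasure M (bl x (2 ^ n * r))" using Suc by (intro doubling_ball) auto
  also have "\<dots> \<le> ennreal Cd * (ennreal (Cd ^ n) * emeasure M (bl x r))" by (intro mult_left_mono Suc) auto
  also have "\<dots> = ennreal (Cd ^ Suc n) * emeasure M (bl x r)"
    using Cd by (simp add: ennreal_mult[symmetric] mult.assoc[symmetric])
  finally show ?case .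
qed simp

text \<open>
  A null ball would make all its dilates null by doubling, and with them the whole space.
\<close>
lemma bl_pos: "x \<in> space M \<Longrightarrow> 0 < r \<Longrightarrow> emeasure M (bl x r) \<noteq> 0"
proof
  assume x: "x \<in> space M" and r: "0 < r" and 0: "emeasure M (bl x r) = 0"
  have null: "bl x (2 ^ n * r) \<in> null_sets M" for n
    using bl_pow[OF x r, of n] 0 ball_measurable[OF x, of "2 ^ n * r"] r by (intro null_setsI) auto
  have "space M = (\<Union>n. bl x (2 ^ n * r))"
  proof
    show "space M \<subseteq> (\<Union>n. bl x (2 ^ n * r))"
    proof
      fix y assume y: "y \<in> space M"
      obtain n where "d x y / r < 2 ^ n" using real_arch_pow[of 2 "d x y / r"] by auto
      then have "d x y < 2 ^ n * r" using r by (simp add: field_simps)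
      then show "y \<in> (\<Union>n. bl x (2 ^ n * r))" using y by (auto simp: mem_bl)
    qed
  qed (auto simp: mem_bl)
  moreover have "(\<Union>n. bl x (2 ^ n * r)) \<in> null_sets M" by (rule null_sets_UN) (rule null)
  ultimately show False using measure_nonzero by auto
qed

lemma bl_fin: "x \<in> space M \<Longrightarrow> 0 < r \<Longrightarrow> emeasure M (bl x r) \<noteq> top"
  using ball_finite[of x r] by auto

lemma bl_compare:
  assumes "x \<in> space M" "z \<in> space M" "0 < s" "d x z \<le> k * s" "2 * A * k \<le> 2 ^ n" "0 \<le> k"
  shows "emeasure M (bl x (k * s)) \<le> ennreal (Cd ^ n) * emeasure M (bl z s)"
proof -
  have "bl x (k * s) \<subseteq> bl z (2 ^ n * s)"
  proof
    fix y assume y: "y \<in> bl x (k * s)"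
    have "d y z < A * (k * s + k * s)"
      using y assms dist_sym[of x y] by (intro triangle_less[of y z x]) (auto simp: mem_bl)
    also have "\<dots> = (2 * A * k) * s" by (simp add: algebra_simps)
    also have "\<dots> \<le> 2 ^ n * s" using assms by (intro mult_right_mono) auto
    finally show "y \<in> bl z (2 ^ n * s)" using y assms dist_sym[of y z] by (simp add: mem_bl)
  qed
  then have "emeasure M (bl x (k * s)) \<le> emeasure M (bl z (2 ^ n * s))"
    using assms by (intro emeasure_mono ball_measurable) auto
  also have "\<dots> \<le> ennreal (Cd ^ n) * emeasure M (bl z s)" using assms by (intro bl_pow) auto
  finally show ?thesis .
qed

definition separated :: "real \<Rightarrow> 'a set \<Rightarrow> bool" where
  "separated r S \<longleftrightarrow> S \<subseteq> space M \<and> (\<forall>x\<in>S. \<forall>y\<in>S. x \<noteq> y \<longrightarrow> r \<le> d x y)"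

text \<open>
  Balls of radius \<open>r / (2 A)\<close> around separated points are disjoint and, by doubling, each fills a fixed
  fraction of a common ball.
\<close>
lemma packing: "\<exists>N::nat. \<forall>x r F. x \<in> space M \<longrightarrow> 0 < r \<longrightarrow> finite F \<longrightarrow> F \<subseteq> bl x (k * r) \<longrightarrow> separated r F \<longrightarrow> card F \<le> N"
proof -
  \<comment> \<open>In units of the small radius \<open>s\<close>, the common ball has radius \<open>k' s\<close>.\<close>
  define k' where "k' = 2 * A\<^sup>2 * (\<bar>k\<bar> + 1)"
  obtain n where n: "2 * A * k' < 2 ^ n" using real_arch_pow[of 2 "2 * A * k'"] by auto
  have "card F \<le> nat \<lceil>Cd ^ n\<rceil>"
    if x: "x \<in> space M" and r: "0 < r" and fin: "finite F" and F: "F \<subseteq> bl x (k * r)" and sep: "separated r F" for x r F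
  proof -
    define s where "s = r / (2 * A)"
    have s: "0 < s" using A r by (simp add: s_def)
    have ks: "k' * s = A * (\<bar>k\<bar> + 1) * r" using A by (simp add: k'_def s_def field_simps power2_eq_square)
    have k'0: "0 \<le> k'" by (simp add: k'_def)
    let ?m = "emeasure M (bl x (k' * s))"
    have k's: "0 < k' * s" unfolding ks using A r by (intro mult_pos_pos) auto
    have FX: "F \<subseteq> space M" using sep by (simp add: separated_def)
    have lower: "?m \<le> ennreal (Cd ^ n) * emeasure M (bl \<alpha> s)" if "\<alpha> \<in> F" for \<alpha>
    proof -
      have "d x \<alpha> < k * r" using F that by (auto simp: mem_bl)
      also have "\<dots> \<le> (\<bar>k\<bar> + 1) * r" using r by (intro mult_right_mono) auto
      also have "\<dots> \<le> A * ((\<bar>k\<bar> + 1) * r)" using A r mult_right_mono[of 1 A "(\<bar>k\<bar> + 1) * r"] by simp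
      finally show ?thesis using x FX that s n k'0 by (intro bl_compare) (auto simp: ks mult.assoc)
    qed
    have sub: "bl \<alpha> s \<subseteq> bl x (k' * s)" if "\<alpha> \<in> F" for \<alpha>
    proof
      fix y assume y: "y \<in> bl \<alpha> s"
      have "s \<le> r" using A r by (simp add: s_def field_simps)
      have "d x y < A * (k * r + r)"
        using F that y x \<open>s \<le> r\<close> by (intro triangle_less[of x y \<alpha>]) (auto simp: mem_bl)
      also have "\<dots> \<le> A * ((\<bar>k\<bar> + 1) * r)" using A r by (intro mult_left_mono) (auto simp: distrib_right mult_right_mono)
      finally show "y \<in> bl x (k' * s)" using y by (simp add: mem_bl ks mult.assoc)
    qed
    have disj: "disjoint_family_on (\<lambda>\<alpha>. bl \<alpha> s) F"
    proof (clarsimp simp: disjoint_family_on_def)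
      fix \<alpha> \<beta> assume ab: "\<alpha> \<in> F" "\<beta> \<in> F" "\<alpha> \<noteq> \<beta>"
      show "bl \<alpha> s \<inter> bl \<beta> s = {}"
      proof (rule ccontr)
        assume "bl \<alpha> s \<inter> bl \<beta> s \<noteq> {}"
        then obtain z where z: "z \<in> space M" "d \<alpha> z < s" "d \<beta> z < s" by (auto simp: mem_bl)
        have "d \<alpha> \<beta> < A * (s + s)"
          using z ab FX dist_sym[of \<beta> z] by (intro triangle_less[of \<alpha> \<beta> z]) auto
        also have "\<dots> = r" using A by (simp add: s_def)
        finally show False using sep ab by (force simp: separated_def)
      qed
    qed
    have "of_nat (card F) * ?m = (\<Sum>\<alpha>\<in>F. ?m)" by simp
    also have "\<dots> \<le> (\<Sum>\<alpha>\<in>F. ennreal (Cd ^ n) * emeasure M (bl \<alpha> s))" by (intro sum_mono lower)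
    also have "\<dots> = ennreal (Cd ^ n) * (\<Sum>\<alpha>\<in>F. emeasure M (bl \<alpha> s))" by (rule sum_distrib_left[symmetric])
    also have "(\<Sum>\<alpha>\<in>F. emeasure M (bl \<alpha> s)) = emeasure M (\<Union>\<alpha>\<in>F. bl \<alpha> s)"
      using FX s by (intro sum_emeasure fin disj) (auto intro: ball_measurable)
    also have "\<dots> \<le> ?m" using sub x k's by (intro emeasure_mono ball_measurable) auto
    finally have "of_nat (card F) * ?m / ?m \<le> ennreal (Cd ^ n) * ?m / ?m"
      by (intro divide_right_mono_ennreal) (simp add: mult_left_mono)
    then have "of_nat (card F) \<le> ennreal (Cd ^ n)"
      unfolding ennreal_mult_divide_cancel(3)[OF bl_pos[OF x k's] bl_fin[OF x k's]] .
    then have "real (card F) \<le> Cd ^ n" using Cd by (simp add: ennreal_of_nat_eq_real_of_nat)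
    then show ?thesis by linarith
  qed
  then show ?thesis by blast
qed

lemma separated_subset: "separated r S \<Longrightarrow> T \<subseteq> S \<Longrightarrow> separated r T"
  by (auto simp: separated_def)

lemma separated_countable:
  assumes sep: "separated r S" and r: "0 < r"
  shows "countable S"
proof (cases "S = {}")
  case False
  then obtain x where x: "x \<in> S" "x \<in> space M" using sep by (auto simp: separated_def)
  have "finite (S \<inter> bl x (real n * r))" for n
  proof -
    obtain N :: nat where N: "\<forall>x s F. x \<in> space M \<longrightarrow> 0 < s \<longrightarrow> finite F \<longrightarrow> F \<subseteq> bl x (real n * s) \<longrightarrow> separated s F \<longrightarrow> card F \<le> N"
      using packing[of "real n"] by blast
    show ?thesis
    proof (rule ccontr)
      assume "infinite (S \<inter> bl x (real n * r))"
      then obtain F where F: "finite F" "card F = Suc N" "F \<subseteq> S \<inter> bl x (real n * r)"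
        using infinite_arbitrarily_large by blast
      then have "card F \<le> N" using N x r separated_subset[OF sep, of F] by blast
      then show False using F by simp
    qed
  qed
  moreover have "S = (\<Union>n. S \<inter> bl x (real n * r))"
  proof
    show "S \<subseteq> (\<Union>n. S \<inter> bl x (real n * r))"
    proof
      fix y assume y: "y \<in> S"
      obtain n where "d x y / r < real n" using reals_Archimedean2 by blast
      then have "d x y < real n * r" using r by (simp add: field_simps)
      then show "y \<in> (\<Union>n. S \<inter> bl x (real n * r))" using y sep by (auto simp: mem_bl separated_def)
    qed
  qed auto
  ultimately show ?thesis by (metis countable_UN countable_finite countableI_type)
qed simp

lemma maximal_separated:
  assumes Z: "separated r Z" "Z \<subseteq> Y" and Y: "Y \<subseteq> space M" and r: "0 < r"
  shows "\<exists>S. Z \<subseteq> S \<and> S \<subseteq> Y \<and> separated r S \<and> (\<forall>y\<in>Y. \<exists>s\<in>S. d y s < r)"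
proof -
  let ?\<A> = "{S. Z \<subseteq> S \<and> S \<subseteq> Y \<and> separated r S}"
  have "\<exists>S\<in>?\<A>. \<forall>X\<in>?\<A>. S \<subseteq> X \<longrightarrow> X = S"
  proof (rule subset_Zorn_nonempty)
    show "?\<A> \<noteq> {}" using Z by blast
    fix \<C> assume C: "\<C> \<noteq> {}" "subset.chain ?\<A> \<C>"
    have "separated r (\<Union>\<C>)"
      unfolding separated_def
    proof (intro conjI ballI impI)
      show "\<Union>\<C> \<subseteq> space M" using C Y by (auto simp: subset.chain_def)
      fix x y assume "x \<in> \<Union>\<C>" "y \<in> \<Union>\<C>" "x \<noteq> y"
      then obtain P Q where PQ: "P \<in> \<C>" "Q \<in> \<C>" "x \<in> P" "y \<in> Q" by blast
      then have "P \<subseteq> Q \<or> Q \<subseteq> P" using C(2) unfolding subset.chain_def by blast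
      then obtain R where "R \<in> \<C>" "x \<in> R" "y \<in> R" using PQ by blast
      moreover have "separated r R" using \<open>R \<in> \<C>\<close> C by (auto simp: subset.chain_def)
      ultimately show "r \<le> d x y" using \<open>x \<noteq> y\<close> by (auto simp: separated_def)
    qed
    then show "\<Union>\<C> \<in> ?\<A>" using C by (auto simp: subset.chain_def)
  qed
  then obtain S where S: "Z \<subseteq> S" "S \<subseteq> Y" "separated r S"
    and max: "\<And>X. Z \<subseteq> X \<Longrightarrow> X \<subseteq> Y \<Longrightarrow> separated r X \<Longrightarrow> S \<subseteq> X \<Longrightarrow> X = S" by auto
  have "\<exists>s\<in>S. d y s < r" if y: "y \<in> Y" for y
  proof (rule ccontr)
    assume neg: "\<not> (\<exists>s\<in>S. d y s < r)"
    have yX: "y \<in> space M" using y Y by blast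
    then have "d y y < r" using r by simp
    then have "y \<notin> S" using neg by blast
    have SX: "S \<subseteq> space M" using S(3) by (simp add: separated_def)
    have ys: "r \<le> d y s \<and> r \<le> d s y" if "s \<in> S" for s
    proof -
      have "r \<le> d y s" using neg that by (meson not_less)
      moreover have "d s y = d y s" by (rule dist_sym[OF _ yX]) (use SX that in blast)
      ultimately show ?thesis by simp
    qed
    have "separated r (insert y S)"
      unfolding separated_def
    proof (intro conjI ballI impI)
      fix u v assume "u \<in> insert y S" "v \<in> insert y S" "u \<noteq> v"
      then show "r \<le> d u v" using ys S(3) unfolding separated_def by blast
    qed (use yX SX in blast)
    then have "insert y S = S" using S y by (intro max) auto
    then show False using \<open>y \<notin> S\<close> by blast
  qed
  then show ?thesis using S by blast
qed

definition net :: "real \<Rightarrow> 'a set \<Rightarrow> bool" where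
  "net r S \<longleftrightarrow> separated r S \<and> (\<forall>x\<in>space M. \<exists>s\<in>S. d x s < r)"

text \<open>
  Choose a maximal separated set, then a maximal separated set among the points far from it, and
  so on. A point that is far from the first \<open>K\<close> choices has, by maximality, a member of each of them
  within distance \<open>r\<close>, and these \<open>K\<close> points are separated by \<open>\<epsilon> r\<close>; packing bounds \<open>K\<close>. Finally each
  choice is enlarged to a maximal separated set of the whole space.
\<close>
lemma adjacent_nets:
  assumes e: "0 < \<epsilon>"
  shows "\<exists>K>0. \<forall>r>0. \<exists>S. (\<forall>t<(K::nat). net r (S t)) \<and> (\<forall>x\<in>space M. \<exists>t<K. \<exists>s\<in>S t. d x s < \<epsilon> * r)"
proof -
  obtain N :: nat where N: "\<And>x r F. x \<in> space M \<Longrightarrow> 0 < r \<Longrightarrow> finite F \<Longrightarrow> F \<subseteq> bl x (1 / \<epsilon> * r) \<Longrightarrow> separated r F \<Longrightarrow> card F \<le> N"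
    using packing[of "1 / \<epsilon>"] by metis
  have "\<exists>S. (\<forall>t<Suc N. net r (S t)) \<and> (\<forall>x\<in>space M. \<exists>t<Suc N. \<exists>s\<in>S t. d x s < \<epsilon> * r)" if r: "0 < r" for r
  proof -
    define far where "far U = {x \<in> space M. \<forall>\<alpha>\<in>U. \<epsilon> * r \<le> d \<alpha> x}" for U
    have "\<exists>S. S \<subseteq> far U \<and> separated r S \<and> (\<forall>y\<in>far U. \<exists>s\<in>S. d y s < r)" for U
      using maximal_separated[of r "{}" "far U"] r by (auto simp: separated_def far_def)
    then obtain pick where pick: "\<And>U. pick U \<subseteq> far U" "\<And>U. separated r (pick U)" "\<And>U y. y \<in> far U \<Longrightarrow> \<exists>s\<in>pick U. d y s < r"
      by metis
    define U where "U = rec_nat {} (\<lambda>_ U. U \<union> pick U)"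
    have U: "U 0 = {}" "\<And>t. U (Suc t) = U t \<union> pick (U t)" by (auto simp: U_def)
    have Umono: "s \<le> t \<Longrightarrow> U s \<subseteq> U t" for s t by (rule lift_Suc_mono_le[of U]) (auto simp: U)
    have pickX: "pick (U t) \<subseteq> space M" for t using pick(2) by (simp add: separated_def)
    have "\<exists>S. pick (U t) \<subseteq> S \<and> S \<subseteq> space M \<and> separated r S \<and> (\<forall>y\<in>space M. \<exists>s\<in>S. d y s < r)" for t
      by (rule maximal_separated[OF pick(2) pickX order_refl r])
    then obtain S where S: "\<And>t. pick (U t) \<subseteq> S t" "\<And>t. net r (S t)"
      unfolding net_def by metis
    have "\<exists>t<Suc N. \<exists>s\<in>S t. d x s < \<epsilon> * r" if x: "x \<in> space M" for x
    proof (rule ccontr)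
      assume neg: "\<not> (\<exists>t<Suc N. \<exists>s\<in>S t. d x s < \<epsilon> * r)"
      have "\<epsilon> * r \<le> d \<alpha> x" if "\<alpha> \<in> U t" "t \<le> Suc N" for \<alpha> t
        using that
      proof (induction t)
        case (Suc t)
        show ?case
        proof (cases "\<alpha> \<in> U t")
          case False
          then have "\<alpha> \<in> pick (U t)" using Suc.prems U by auto
          then have "\<alpha> \<in> S t" "\<alpha> \<in> space M" using S pickX by blast+
          then have "\<epsilon> * r \<le> d x \<alpha>" using neg Suc.prems by (meson not_less Suc_le_lessD)
          then show ?thesis using dist_sym[OF x \<open>\<alpha> \<in> space M\<close>] by simp
        qed (use Suc in auto)
      qed (simp add: U)
      then have "x \<in> far (U t)" if "t < Suc N" for t using x that by (auto simp: far_def)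
      then have "\<forall>t\<in>{..<Suc N}. \<exists>s\<in>pick (U t). d x s < r" using pick(3) by blast
      then obtain \<alpha> where al: "\<And>t. t < Suc N \<Longrightarrow> \<alpha> t \<in> pick (U t)" "\<And>t. t < Suc N \<Longrightarrow> d x (\<alpha> t) < r"
        by (metis lessThan_iff)
      have alX: "\<alpha> t \<in> space M" if "t < Suc N" for t using al(1)[OF that] pickX by blast
      have sep1: "\<epsilon> * r \<le> d (\<alpha> s) (\<alpha> t)" if "s < t" "t < Suc N" for s t
      proof -
        have "\<alpha> s \<in> U (Suc s)" using al(1)[of s] that U by auto
        then have "\<alpha> s \<in> U t" using Umono[of "Suc s" t] that by auto
        moreover have "\<alpha> t \<in> far (U t)" using al(1)[of t] pick(1) that by blast
        ultimately show ?thesis by (auto simp: far_def)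
      qed
      have er: "0 < \<epsilon> * r" using e r by simp
      have sep2: "\<epsilon> * r \<le> d (\<alpha> s) (\<alpha> t)" if "s \<noteq> t" "t < Suc N" "s < Suc N" for s t
      proof (cases "s < t")
        case False
        then have "t < s" using that by simp
        then show ?thesis using sep1[of t s] that dist_sym[OF alX alX, of s t] by simp
      qed (use sep1 that in auto)
      have inj: "inj_on \<alpha> {..<Suc N}"
      proof (rule inj_onI, rule ccontr)
        fix s t assume st: "s \<in> {..<Suc N}" "t \<in> {..<Suc N}" "\<alpha> s = \<alpha> t" "s \<noteq> t"
        then have "\<epsilon> * r \<le> 0" using sep2[of s t] alX[of t] by simp
        then show False using er by simp
      qed
      have "card (\<alpha> ` {..<Suc N}) \<le> N"
      proof (rule N[OF x er])
        show "\<alpha> ` {..<Suc N} \<subseteq> bl x (1 / \<epsilon> * (\<epsilon> * r))" using al alX e by (auto simp: mem_bl)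
        show "separated (\<epsilon> * r) (\<alpha> ` {..<Suc N})"
          unfolding separated_def
        proof (intro conjI ballI impI)
          fix u v assume "u \<in> \<alpha> ` {..<Suc N}" "v \<in> \<alpha> ` {..<Suc N}" "u \<noteq> v"
          then obtain i j where "u = \<alpha> i" "v = \<alpha> j" "i < Suc N" "j < Suc N" "i \<noteq> j" by blast
          then show "\<epsilon> * r \<le> d u v" using sep2[of i j] by simp
        qed (use alX in auto)
      qed simp
      then show False using inj by (simp add: card_image)
    qed
    then show ?thesis using S by blast
  qed
  then show ?thesis by blast
qed

text \<open>
  A net point within distance \<open>r\<close>, and the unique one within distance \<open>r / (2 A)\<close> if it exists. The second
  clause makes the cells contain a ball around their centre; taking least indices makes the map
  measurable.
\<close>
definition parent :: "real \<Rightarrow> 'a set \<Rightarrow> 'a \<Rightarrow> 'a" where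
  "parent r S y = from_nat_into S
     (if \<exists>n. d (from_nat_into S n) y < r / (2 * A) then LEAST n. d (from_nat_into S n) y < r / (2 * A)
      else LEAST n. d (from_nat_into S n) y < r)"

lemma parent:
  assumes S: "net r S" and r: "0 < r"
  shows "y \<in> space M \<Longrightarrow> parent r S y \<in> S" "y \<in> space M \<Longrightarrow> d (parent r S y) y < r"
    "y \<in> space M \<Longrightarrow> \<alpha> \<in> S \<Longrightarrow> d \<alpha> y < r / (2 * A) \<Longrightarrow> parent r S y = \<alpha>"
    "parent r S \<in> measurable M (count_space UNIV)"
proof -
  let ?e = "from_nat_into S"
  have sep: "separated r S" and SX: "S \<subseteq> space M" using S by (auto simp: net_def separated_def)
  have count: "countable S" using separated_countable[OF sep r] .
  have ne: "S \<noteq> {}" if "y \<in> space M" for y using S that by (auto simp: net_def)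
  have eS: "?e n \<in> S" if "y \<in> space M" for n y using from_nat_into[OF ne[OF that]] .
  have ex: "\<exists>n. d (?e n) y < r" if y: "y \<in> space M" for y
  proof -
    obtain s where s: "s \<in> S" "d y s < r" using S y by (auto simp: net_def)
    then have "d s y < r" using dist_sym[OF y, of s] SX by auto
    moreover have "?e (to_nat_on S s) = s" using count s by simp
    ultimately show ?thesis by metis
  qed
  show 1: "parent r S y \<in> S" if "y \<in> space M"
    unfolding parent_def using eS[OF that] by simp
  have le: "r / (2 * A) \<le> r" using A r by (simp add: field_simps)
  show "d (parent r S y) y < r" if "y \<in> space M"
  proof (cases "\<exists>n. d (?e n) y < r / (2 * A)")
    case True
    have "d (parent r S y) y < r / (2 * A)" unfolding parent_def if_P[OF True] by (rule LeastI_ex[of "\<lambda>n. d (?e n) y < r / (2 * A)", OF True])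
    then show ?thesis using le by linarith
  next
    case False
    show ?thesis unfolding parent_def if_not_P[OF False] by (rule LeastI_ex[of "\<lambda>n. d (?e n) y < r", OF ex[OF that]])
  qed
  show "parent r S y = \<alpha>" if y: "y \<in> space M" and al: "\<alpha> \<in> S" "d \<alpha> y < r / (2 * A)"
  proof (rule ccontr)
    assume neq: "parent r S y \<noteq> \<alpha>"
    have "?e (to_nat_on S \<alpha>) = \<alpha>" using count al by simp
    then have ex2: "\<exists>n. d (?e n) y < r / (2 * A)" using al by metis
    have "d (parent r S y) y < r / (2 * A)"
      unfolding parent_def if_P[OF ex2] by (rule LeastI_ex[of "\<lambda>n. d (?e n) y < r / (2 * A)", OF ex2])
    then have "d (parent r S y) \<alpha> < A * (r / (2 * A) + r / (2 * A))"
      using 1[OF y] al y SX dist_sym[OF y, of \<alpha>] by (intro triangle_less[of _ _ y]) auto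
    also have "\<dots> = r" using A by simp
    finally show False using sep 1[OF y] al neq by (force simp: separated_def)
  qed
  show "parent r S \<in> measurable M (count_space UNIV)"
  proof -
    have pred: "Measurable.pred M (\<lambda>y. d (?e n) y < s)" if s: "0 < s" for n s
    proof (cases "space M = {}")
      case False
      then obtain x where "x \<in> space M" by blast
      then have "?e n \<in> space M" using eS SX by blast
      then have "{y \<in> space M. d (?e n) y < s} \<in> sets M" using ball_measurable[of "?e n" s] s by (simp add: qball_def)
      then show ?thesis by (simp add: pred_def)
    qed (simp add: pred_def)
    have [measurable]: "Measurable.pred M (\<lambda>y. d (?e n) y < r)" "Measurable.pred M (\<lambda>y. d (?e n) y < r / (2 * A))" for n
      using pred r A by auto
    have "(\<lambda>y. if \<exists>n. d (?e n) y < r / (2 * A) then LEAST n. d (?e n) y < r / (2 * A)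
      else LEAST n. d (?e n) y < r) \<in> measurable M (count_space UNIV)" by measurable
    then show ?thesis unfolding parent_def[abs_def]
      by (rule measurable_compose) simp
  qed
qed

end


section \<open>Construction of adjacent dyadic systems\<close>

context homogeneous_space
begin

text \<open>
  The centre of the cube of level \<open>j\<close> containing \<open>x\<close>. The nets of different levels are unrelated, and
  the cubes are nested because the centre of the next level depends only on the previous centre.
  The freedom to choose the nets level by level makes adjacent systems easy to build; the price is
  that there is a finest level.
\<close>
primrec ancestor :: "(nat \<Rightarrow> 'a set) \<Rightarrow> (nat \<Rightarrow> real) \<Rightarrow> nat \<Rightarrow> 'a \<Rightarrow> 'a" where
  "ancestor S r 0 x = parent (r 0) (S 0) x"
| "ancestor S r (Suc j) x = parent (r (Suc j)) (S (Suc j)) (ancestor S r j x)"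

lemma A_le_powers: "A \<le> A ^ 2" "A ^ 2 \<le> A ^ 3" "A ^ 3 \<le> A ^ 5" "1 \<le> A ^ 5"
  using A by (auto intro!: power_increasing one_le_power simp: self_le_power)

context
  fixes S :: "nat \<Rightarrow> 'a set" and D :: real and r :: "nat \<Rightarrow> real"
  assumes S: "\<And>j. net (r j) (S j)" and r_0: "0 < r 0" and r_Suc: "\<And>j. r (Suc j) = D * r j" and D: "32 * A ^ 5 \<le> D"
begin

lemma D_pos: "0 < D" "1 \<le> D" using D A_le_powers by linarith+

lemma r_pos: "0 < r j" by (induction j) (use r_0 D_pos r_Suc in auto)

lemma r_le: "c \<le> 32 * A ^ 5 \<Longrightarrow> c * r j \<le> r (Suc j)"
  unfolding r_Suc using D r_pos[of j] by (intro mult_right_mono) auto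

abbreviation "anc \<equiv> ancestor S r"

lemma anc_net: "x \<in> space M \<Longrightarrow> anc j x \<in> S j \<and> anc j x \<in> space M"
proof (induction j)
  case 0
  then show ?case using parent(1)[OF S r_pos, of x 0] S[of 0] by (auto simp: net_def separated_def)
next
  case (Suc j)
  then show ?case using parent(1)[OF S r_pos, of "anc j x" "Suc j"] S[of "Suc j"] by (auto simp: net_def separated_def)
qed

lemma anc_space: "x \<in> space M \<Longrightarrow> anc j x \<in> space M"
  using anc_net by simp

lemma anc_step: "x \<in> space M \<Longrightarrow> d (anc (Suc j) x) (anc j x) < r (Suc j)"
  using parent(2)[OF S r_pos anc_space, of x "Suc j"] by simp

lemma anc_dist: "x \<in> space M \<Longrightarrow> d (anc j x) x < 2 * A * r j"
proof (induction j)
  case 0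
  have "d (anc 0 x) x < r 0" using parent(2)[OF S r_pos 0] by simp
  also have "\<dots> \<le> 2 * A * r 0" using A r_pos[of 0] mult_right_mono[of 1 "2 * A" "r 0"] by simp
  finally show ?case .
next
  case (Suc j)
  have "d (anc (Suc j) x) x < A * (r (Suc j) + 2 * A * r j)"
    using Suc anc_step by (intro triangle_less[of _ _ "anc j x"] anc_space) (auto simp: less_imp_le)
  also have "\<dots> \<le> A * (r (Suc j) + r (Suc j))"
    using A A_le_powers by (intro mult_left_mono add_left_mono r_le) auto
  finally show ?case by simp
qed

lemma anc_measurable: "anc j \<in> measurable M (count_space UNIV)"
proof (induction j)
  case 0
  show ?case using parent(4)[OF S r_pos, of 0] by (simp cong: measurable_cong_simp)
next
  case (Suc j)
  have "(\<lambda>x. parent (r (Suc j)) (S (Suc j)) (anc j x)) \<in> measurable M (count_space UNIV)"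
    by (rule measurable_compose[OF Suc]) simp
  then show ?case by simp
qed

text \<open>
  If \<open>y\<close> is very close to \<open>\<alpha>\<close>, its centre one level below is still within \<open>r j / (2 A)\<close> of \<open>\<alpha>\<close>, because the
  scales grow by a factor of at least \<open>8 A\<^sup>3\<close>.
\<close>
lemma anc_inner:
  assumes y: "y \<in> space M" and al: "\<alpha> \<in> S j" "d \<alpha> y < r j / (4 * A\<^sup>2)"
  shows "anc j y = \<alpha>"
proof (cases j)
  case 0
  have "r 0 / (4 * A\<^sup>2) \<le> r 0 / (2 * A)"
    using A A_le_powers r_pos[of 0] by (intro divide_left_mono) auto
  then show ?thesis using parent(3)[OF S r_pos y, of \<alpha> 0] al 0 by simp
next
  case (Suc i)
  have alX: "\<alpha> \<in> space M" using al S[of j] by (auto simp: net_def separated_def)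
  have "d \<alpha> (anc i y) < A * (r j / (4 * A\<^sup>2) + 2 * A * r i)"
    using al y alX anc_dist[OF y, of i] dist_sym[OF y anc_space[OF y], of i]
    by (intro triangle_less[of _ _ y] anc_space) auto
  also have "\<dots> \<le> A * (r j / (4 * A\<^sup>2) + r j / (4 * A\<^sup>2))"
  proof -
    have "2 * A * r i * (4 * A\<^sup>2) = 8 * A ^ 3 * r i" by (simp add: power2_eq_square power3_eq_cube)
    also have "\<dots> \<le> r j" unfolding Suc using A_le_powers A by (intro r_le) linarith
    finally have "2 * A * r i \<le> r j / (4 * A\<^sup>2)" using A by (simp add: field_simps)
    then show ?thesis using A by (intro mult_left_mono) auto
  qed
  also have "\<dots> = r j / (2 * A)" using A by (simp add: field_simps power2_eq_square)
  finally show ?thesis using parent(3)[OF S r_pos anc_space[OF y], of \<alpha> j] al Suc by simp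
qed

definition "grid_cube j x = {y \<in> space M. anc j y = anc j x}"
definition "grid_env j x = bl (anc j x) (4 * A\<^sup>2 * r j)"

lemma grid_cube_inner: "x \<in> space M \<Longrightarrow> bl (anc j x) (r j / (4 * A\<^sup>2)) \<subseteq> grid_cube j x"
  using anc_inner anc_net[of x j] by (auto simp: grid_cube_def mem_bl)

lemma grid_cube_sets: "grid_cube j x \<in> sets M"
proof -
  have "anc j -` {anc j x} \<inter> space M \<in> sets M" by (rule measurable_sets[OF anc_measurable]) simp
  moreover have "anc j -` {anc j x} \<inter> space M = grid_cube j x" by (auto simp: grid_cube_def)
  ultimately show ?thesis by simp
qed

lemma grid_cube_subset_env: "x \<in> space M \<Longrightarrow> grid_cube j x \<subseteq> grid_env j x"
proof
  fix y assume x: "x \<in> space M" and y: "y \<in> grid_cube j x"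
  then have "d (anc j x) y < 2 * A * r j" using anc_dist[of y j] by (auto simp: grid_cube_def)
  also have "\<dots> \<le> 4 * A\<^sup>2 * r j" using A A_le_powers r_pos[of j] by (intro mult_right_mono) auto
  finally show "y \<in> grid_env j x" using y by (auto simp: grid_env_def grid_cube_def mem_bl)
qed

lemma grid_cube_diameter: "x \<in> space M \<Longrightarrow> y \<in> grid_cube j x \<Longrightarrow> d x y < 4 * A\<^sup>2 * r j"
proof -
  assume x: "x \<in> space M" and y: "y \<in> grid_cube j x"
  then have y': "y \<in> space M" "anc j y = anc j x" by (auto simp: grid_cube_def)
  have "d x y < A * (2 * A * r j + 2 * A * r j)"
    using anc_dist[OF x, of j] anc_dist[OF y'(1), of j] y' x dist_sym[OF x anc_space[OF x, of j]]
    by (intro triangle_less[of _ _ "anc j x"] anc_space) (auto simp: less_imp_le)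
  then show ?thesis by (simp add: power2_eq_square algebra_simps)
qed

lemma grid_nested: "nested_partitions M grid_cube"
proof
  fix x y j assume x: "x \<in> space M"
  show "x \<in> grid_cube j x" using x by (simp add: grid_cube_def)
  show "grid_cube j x \<in> sets M" by (rule grid_cube_sets)
  show "grid_cube j x \<subseteq> grid_cube (Suc j) x" by (auto simp: grid_cube_def)
  show "grid_cube j y = grid_cube j x" if "y \<in> grid_cube j x" using that by (auto simp: grid_cube_def)
  have pos: "0 < r j / (4 * A\<^sup>2)" using r_pos[of j] A by simp
  show "emeasure M (grid_cube j x) \<noteq> 0"
    using emeasure_mono[OF grid_cube_inner[OF x, of j] grid_cube_sets] bl_pos[OF anc_space[OF x] pos, of j]
    by (auto simp: le_zero_eq)
  have pos2: "0 < 4 * A\<^sup>2 * r j" using r_pos[of j] A by simp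
  show "emeasure M (grid_cube j x) \<noteq> top"
    using emeasure_mono[OF grid_cube_subset_env[OF x, of j], unfolded grid_env_def, OF ball_measurable[OF anc_space[OF x] pos2]]
      bl_fin[OF anc_space[OF x] pos2, of j] by (auto simp: top_unique)
next
  fix j
  have "grid_cube j ` space M \<subseteq> (\<lambda>\<alpha>. {y \<in> space M. anc j y = \<alpha>}) ` S j"
    using anc_net by (auto simp: grid_cube_def)
  moreover have "countable (S j)" using S[of j] r_pos[of j] separated_countable by (auto simp: net_def)
  ultimately show "countable (grid_cube j ` space M)" by (meson countable_image countable_subset)
qed

lemma grid_env_Suc: "x \<in> space M \<Longrightarrow> grid_env j x \<subseteq> grid_env (Suc j) x"
proof
  fix z assume x: "x \<in> space M" and z: "z \<in> grid_env j x"
  then have zX: "z \<in> space M" and dz: "d (anc j x) z < 4 * A\<^sup>2 * r j" by (auto simp: grid_env_def mem_bl)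
  have "d (anc (Suc j) x) z < A * (r (Suc j) + 4 * A\<^sup>2 * r j)"
    using anc_step[OF x, of j] dz zX x by (intro triangle_less[of _ _ "anc j x"] anc_space) auto
  also have "\<dots> \<le> A * (r (Suc j) + r (Suc j))"
    using A A_le_powers by (intro mult_left_mono add_left_mono r_le) auto
  also have "\<dots> \<le> 4 * A\<^sup>2 * r (Suc j)"
    using A A_le_powers r_pos[of "Suc j"] mult_right_mono[of "2 * A" "4 * A\<^sup>2" "r (Suc j)"] by simp
  finally show "z \<in> grid_env (Suc j) x" using zX by (simp add: grid_env_def mem_bl)
qed

text \<open>
  A ball whose centre is close to a net point of the next level lies in the ball around that net
  point which the cube is known to contain.
\<close>
lemma ball_in_grid_cube:
  assumes z: "z \<in> space M" and al: "\<alpha> \<in> S (Suc j)" "d z \<alpha> < 1 / (8 * A ^ 3) * r (Suc j)"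
    and x: "x \<in> bl z (4 * A\<^sup>2 * r j)"
  shows "bl z (4 * A\<^sup>2 * r j) \<subseteq> grid_cube (Suc j) x"
proof -
  have alX: "\<alpha> \<in> space M" using al S[of "Suc j"] by (auto simp: net_def separated_def)
  have "anc (Suc j) y = \<alpha>" if y: "y \<in> bl z (4 * A\<^sup>2 * r j)" for y
  proof (rule anc_inner[OF _ al(1)])
    have "d \<alpha> y < A * (1 / (8 * A ^ 3) * r (Suc j) + 4 * A\<^sup>2 * r j)"
      using al y z alX dist_sym[OF z alX] by (intro triangle_less[of _ _ z]) (auto simp: mem_bl less_imp_le)
    also have "\<dots> \<le> A * (1 / (8 * A ^ 3) * r (Suc j) + 1 / (8 * A ^ 3) * r (Suc j))"
    proof -
      have "4 * A\<^sup>2 * r j = 1 / (8 * A ^ 3) * (32 * A ^ 5 * r j)"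
        using A by (simp add: field_simps eval_nat_numeral)
      also have "\<dots> \<le> 1 / (8 * A ^ 3) * r (Suc j)" using A by (intro mult_left_mono r_le) auto
      finally have "4 * A\<^sup>2 * r j \<le> 1 / (8 * A ^ 3) * r (Suc j)" .
      then show ?thesis using A by (intro mult_left_mono) auto
    qed
    also have "\<dots> = r (Suc j) / (4 * A\<^sup>2)" using A by (simp add: field_simps eval_nat_numeral)
    finally show "d \<alpha> y < r (Suc j) / (4 * A\<^sup>2)" .
    show "y \<in> space M" using y by (simp add: mem_bl)
  qed
  then show ?thesis using x by (auto simp: grid_cube_def mem_bl)
qed

lemma grid_cube_measure:
  assumes x: "x \<in> space M" and z: "z \<in> space M" "d x z \<le> 4 * A\<^sup>2 * r j"
    and n: "2 * A * (16 * A ^ 4 * D\<^sup>2) \<le> 2 ^ n" and s: "r j / (4 * A\<^sup>2 * D) \<le> s"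
  shows "emeasure M (grid_cube (Suc j) x) \<le> ennreal (Cd ^ n) * emeasure M (bl z s)"
proof -
  define s0 where "s0 = r j / (4 * A\<^sup>2 * D)"
  have s0: "0 < s0" "s0 \<le> s" using s r_pos[of j] A D_pos by (auto simp: s0_def)
  have eq: "16 * A ^ 4 * D\<^sup>2 * s0 = 4 * A\<^sup>2 * r (Suc j)"
    using A D_pos by (simp add: s0_def r_Suc field_simps power2_eq_square eval_nat_numeral)
  have "grid_cube (Suc j) x \<subseteq> bl x (16 * A ^ 4 * D\<^sup>2 * s0)"
    unfolding eq using grid_cube_diameter[OF x] by (auto simp: mem_bl grid_cube_def)
  moreover have k0: "0 < 16 * A ^ 4 * D\<^sup>2" using A D_pos by simp
  ultimately have "emeasure M (grid_cube (Suc j) x) \<le> emeasure M (bl x (16 * A ^ 4 * D\<^sup>2 * s0))"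
    using s0 by (intro emeasure_mono ball_measurable x) auto
  also have "\<dots> \<le> ennreal (Cd ^ n) * emeasure M (bl z s0)"
  proof (rule bl_compare[OF x z(1) s0(1) _ n])
    have "r j \<le> r (Suc j)" unfolding r_Suc using D_pos r_pos[of j] mult_right_mono[of 1 D "r j"] by simp
    then show "d x z \<le> 16 * A ^ 4 * D\<^sup>2 * s0"
      unfolding eq using A by (intro order_trans[OF z(2)] mult_left_mono) auto
  qed (use k0 in simp)
  also have "\<dots> \<le> ennreal (Cd ^ n) * emeasure M (bl z s)"
    using s0 z by (intro mult_left_mono emeasure_mono bl_mono ball_measurable) auto
  finally show ?thesis .
qed

end

text \<open>
  Large enough for an envelope of one level, of radius \<open>4 A\<^sup>2 r\<close>, to have radius at most
  \<open>1 / (8 A\<^sup>3)\<close> times the scale of the next level.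
\<close>
definition "scale_ratio = 32 * A ^ 5"

text \<open>
  The number \<open>K\<close> of systems and the constant \<open>C0\<close> do not depend on the finest scale \<open>\<rho>\<close>, so the estimates
  for the dyadic model are uniform as \<open>\<rho>\<close> tends to \<open>0\<close>.
\<close>
theorem adjacent_systems_exist:
  "\<exists>K C0. 1 \<le> C0 \<and> (\<forall>\<rho>>0. \<exists>cube env. adjacent_systems M K cube env C0 \<and>
     (\<forall>t<K. \<forall>x\<in>space M. \<forall>y\<in>cube t 0 x. d x y < 4 * A\<^sup>2 * \<rho>) \<and>
     (\<forall>t<K. \<forall>x\<in>space M. \<forall>j. env t j x \<in> balls d M) \<and>
     (\<forall>z\<in>space M. \<forall>j s. \<rho> * scale_ratio ^ j / scale_ratio < s \<longrightarrow> s \<le> \<rho> * scale_ratio ^ j \<longrightarrow>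
        (\<exists>t<K. \<forall>x\<in>bl z s. bl z s \<subseteq> cube t (Suc j) x \<and>
           emeasure M (cube t (Suc j) x) \<le> ennreal C0 * emeasure M (bl z s))))"
proof -
  let ?D = scale_ratio
  have e: "0 < 1 / (8 * A ^ 3)" using A by simp
  obtain K :: nat where K: "\<And>r. 0 < r \<Longrightarrow> \<exists>S. (\<forall>t<K. net r (S t)) \<and> (\<forall>x\<in>space M. \<exists>t<K. \<exists>s\<in>S t. d x s < 1 / (8 * A ^ 3) * r)"
    using adjacent_nets[OF e] by blast
  obtain n where n: "2 * A * (16 * A ^ 4 * ?D\<^sup>2) < 2 ^ n" using real_arch_pow[of 2 "2 * A * (16 * A ^ 4 * ?D\<^sup>2)"] by auto
  have n': "2 * A * (16 * A ^ 4 * ?D\<^sup>2) \<le> 2 ^ n" using n by simp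
  have D: "32 * A ^ 5 \<le> ?D" by (simp add: scale_ratio_def)
  have D0: "0 < ?D" "1 \<le> ?D" using A_le_powers(4) unfolding scale_ratio_def by linarith+
  let ?C0 = "Cd ^ n"
  have "\<exists>cube env. adjacent_systems M K cube env ?C0 \<and>
     (\<forall>t<K. \<forall>x\<in>space M. \<forall>y\<in>cube t 0 x. d x y < 4 * A\<^sup>2 * \<rho>) \<and>
     (\<forall>t<K. \<forall>x\<in>space M. \<forall>j. env t j x \<in> balls d M) \<and>
     (\<forall>z\<in>space M. \<forall>j s. \<rho> * ?D ^ j / ?D < s \<longrightarrow> s \<le> \<rho> * ?D ^ j \<longrightarrow>
        (\<exists>t<K. \<forall>x\<in>bl z s. bl z s \<subseteq> cube t (Suc j) x \<and>
           emeasure M (cube t (Suc j) x) \<le> ennreal ?C0 * emeasure M (bl z s)))"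
    if rho: "0 < \<rho>" for \<rho>
  proof -
    let ?r = "\<lambda>j. \<rho> * ?D ^ j"
    have r: "0 < ?r j" for j using rho D0 by simp
    have r0: "0 < ?r 0" using rho by simp
    have rS: "?r (Suc j) = ?D * ?r j" for j by simp
    obtain T where T: "\<And>j t. t < K \<Longrightarrow> net (?r j) (T j t)"
      "\<And>j x. x \<in> space M \<Longrightarrow> \<exists>t<K. \<exists>s\<in>T j t. d x s < 1 / (8 * A ^ 3) * ?r j"
      using K[OF r] by metis
    define cube where "cube t = grid_cube (\<lambda>j. T j t) ?r" for t
    define env where "env t = grid_env (\<lambda>j. T j t) ?r" for t
    have small: "?r j / (4 * A\<^sup>2 * ?D) \<le> ?r j / (4 * A\<^sup>2)" for j
      using r[of j] A D0 by (intro divide_left_mono) (auto intro!: mult_left_mono)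
    have cover: "\<exists>t<K. \<forall>x\<in>bl z (4 * A\<^sup>2 * ?r j). bl z (4 * A\<^sup>2 * ?r j) \<subseteq> cube t (Suc j) x" if z: "z \<in> space M" for z j
    proof -
      obtain t s where ts: "t < K" "s \<in> T (Suc j) t" "d z s < 1 / (8 * A ^ 3) * ?r (Suc j)" using T(2)[OF z, of "Suc j"] by blast
      have "bl z (4 * A\<^sup>2 * ?r j) \<subseteq> cube t (Suc j) x" if "x \<in> bl z (4 * A\<^sup>2 * ?r j)" for x
        unfolding cube_def
        by (rule ball_in_grid_cube[OF T(1)[OF ts(1)] r0 rS D z ts(2,3) that])
      then show ?thesis using ts(1) by blast
    qed
    have measure: "emeasure M (cube s (Suc j) x) \<le> ennreal ?C0 * emeasure M (bl z u)"
      if "s < K" "x \<in> space M" "z \<in> space M" "d x z \<le> 4 * A\<^sup>2 * ?r j" "?r j / (4 * A\<^sup>2 * ?D) \<le> u" for s x z u j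
      unfolding cube_def by (rule grid_cube_measure[OF T(1)[OF that(1)] r0 rS D that(2-4) n' that(5)])
    have center: "grid_cube (\<lambda>j. T j t) ?r j x \<supseteq> bl (ancestor (\<lambda>j. T j t) ?r j x) (?r j / (4 * A\<^sup>2))"
       "ancestor (\<lambda>j. T j t) ?r j x \<in> space M"
       "d (ancestor (\<lambda>j. T j t) ?r j x) x < 4 * A\<^sup>2 * ?r j"
      if "t < K" "x \<in> space M" for t x j
    proof -
      note a = T(1)[OF that(1)] r0 rS D
      show "grid_cube (\<lambda>j. T j t) ?r j x \<supseteq> bl (ancestor (\<lambda>j. T j t) ?r j x) (?r j / (4 * A\<^sup>2))"
        by (rule grid_cube_inner[OF a that(2)])
      show "ancestor (\<lambda>j. T j t) ?r j x \<in> space M" by (rule anc_space[OF a that(2)])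
      have "x \<in> grid_env (\<lambda>j. T j t) ?r j x"
        using grid_cube_subset_env[OF a that(2), of j] nested_partitions.cube_self[OF grid_nested[OF a] that(2), of j] by blast
      then show "d (ancestor (\<lambda>j. T j t) ?r j x) x < 4 * A\<^sup>2 * ?r j"
        by (simp add: grid_env_def[OF a] mem_bl)
    qed
    have cube_double: "emeasure M (cube s (Suc j) x) \<le> ennreal ?C0 * emeasure M (cube t j x)"
      if "s < K" "t < K" "x \<in> space M" for s t x j
    proof -
      let ?a = "ancestor (\<lambda>j. T j t) ?r j x"
      have "emeasure M (cube s (Suc j) x) \<le> ennreal ?C0 * emeasure M (bl ?a (?r j / (4 * A\<^sup>2)))"
        using center[OF that(2,3), of j] dist_sym[OF that(3), of ?a] that small[of j]
        by (intro measure) auto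
      also have "\<dots> \<le> ennreal ?C0 * emeasure M (cube t j x)"
        unfolding cube_def using center(1)[OF that(2,3), of j] grid_cube_sets[OF T(1)[OF that(2)] r0 rS D]
        by (intro mult_left_mono emeasure_mono) auto
      finally show ?thesis .
    qed
    have "adjacent_systems M K cube env ?C0"
    proof (rule adjacent_systems.intro)
      fix t x y j assume t: "t < K"
      note a = T(1)[OF t] r0 rS D
      show "nested_partitions M (cube t)" unfolding cube_def by (rule grid_nested[OF a])
      assume x: "x \<in> space M"
      show "cube t j x \<subseteq> env t j x" unfolding cube_def env_def by (rule grid_cube_subset_env[OF a x])
      have "0 < 4 * A\<^sup>2 * ?r j" using A r[of j] by simp
      then show "env t j x \<in> sets M"
        unfolding env_def grid_env_def[OF a] by (intro ball_measurable center[OF t x])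
      show "env t j y = env t j x" if "y \<in> cube t j x"
        using that unfolding env_def cube_def grid_env_def[OF a] grid_cube_def[OF a] by simp
      show "env t j x \<subseteq> env t (Suc j) x" unfolding env_def by (rule grid_env_Suc[OF a x])
      show "emeasure M (cube t (Suc j) x) \<le> ennreal ?C0 * emeasure M (cube t j x)" by (rule cube_double[OF t t x])
      obtain s where s: "s < K" "\<And>u. u \<in> env t j x \<Longrightarrow> env t j x \<subseteq> cube s (Suc j) u"
        using cover[OF center(2)[OF t x, of j], of j] unfolding env_def grid_env_def[OF a] by blast
      have "x \<in> env t j x" using center(3)[OF t x, of j] x by (simp add: env_def grid_env_def[OF a] mem_bl)
      then show "\<exists>s<K. env t j x \<subseteq> cube s (Suc j) x \<and> emeasure M (cube s (Suc j) x) \<le> ennreal ?C0 * emeasure M (cube t j x)"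
        using s cube_double[OF s(1) t x] by blast
    qed (use Cd in simp)
    moreover have "d x y < 4 * A\<^sup>2 * \<rho>" if "t < K" "x \<in> space M" "y \<in> cube t 0 x" for t x y
      using grid_cube_diameter[OF T(1)[OF that(1)] r0 rS D that(2), of y 0] that(3) by (simp add: cube_def)
    moreover have "env t j x \<in> balls d M" if "t < K" "x \<in> space M" for t j x
    proof -
      have "0 < 4 * A\<^sup>2 * ?r j" using A r[of j] by simp
      then show ?thesis unfolding env_def grid_env_def[OF T(1)[OF that(1)] r0 rS D] balls_def
        using center(2)[OF that, of j] by blast
    qed
    moreover have "\<exists>t<K. \<forall>x\<in>bl z s. bl z s \<subseteq> cube t (Suc j) x \<and> emeasure M (cube t (Suc j) x) \<le> ennreal ?C0 * emeasure M (bl z s)"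
      if z: "z \<in> space M" and s: "?r j / ?D < s" "s \<le> ?r j" for z j s
    proof -
      obtain t where t: "t < K" "\<And>x. x \<in> bl z (4 * A\<^sup>2 * ?r j) \<Longrightarrow> bl z (4 * A\<^sup>2 * ?r j) \<subseteq> cube t (Suc j) x"
        using cover[OF z, of j] by blast
      have "1 \<le> 4 * A\<^sup>2" using A one_le_power[of A 2] by linarith
      then have "1 * ?r j \<le> 4 * A\<^sup>2 * ?r j" using r[of j] by (intro mult_right_mono) auto
      then have sub: "bl z s \<subseteq> bl z (4 * A\<^sup>2 * ?r j)" using s by (intro bl_mono) simp
      have le: "?r j / (4 * A\<^sup>2 * ?D) \<le> s"
      proof -
        have "?r j / (4 * A\<^sup>2 * ?D) \<le> ?r j / (1 * ?D)"
          using r[of j] A D0 \<open>1 \<le> 4 * A\<^sup>2\<close> by (intro divide_left_mono mult_right_mono) auto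
        then show ?thesis using s(1) by simp
      qed
      have "emeasure M (cube t (Suc j) x) \<le> ennreal ?C0 * emeasure M (bl z s)" if x: "x \<in> bl z s" for x
      proof (rule measure[OF t(1) _ z _ le])
        show "x \<in> space M" using x by (simp add: mem_bl)
        have "d z x < 4 * A\<^sup>2 * ?r j" using x sub by (auto simp: mem_bl)
        then show "d x z \<le> 4 * A\<^sup>2 * ?r j" using dist_sym[OF z \<open>x \<in> space M\<close>] by simp
      qed
      then show ?thesis using t sub by blast
    qed
    ultimately show ?thesis by blast
  qed
  moreover have "1 \<le> ?C0" using Cd by simp
  ultimately show ?thesis by blast
qed

end


section \<open>Lebesgue differentiation along fine partitions\<close>

text \<open>
  Convergence to zero up to arbitrarily small errors: the form in which countable unions and limits
  of functions are handled below.
\<close>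
lemma tendsto_0_approx:
  fixes f :: "nat \<Rightarrow> ennreal"
  assumes "\<And>k. \<exists>g. g \<longlonglongrightarrow> 0 \<and> (\<forall>n. f n \<le> g n + \<delta> k)" "\<delta> \<longlonglongrightarrow> 0"
  shows "f \<longlonglongrightarrow> 0"
proof (rule order_tendstoI)
  fix a :: ennreal assume "0 < a"
  then obtain e where e: "0 < e" "e < a" using dense by blast
  then obtain r where r: "e = ennreal r" "0 < r" by (cases e) auto
  have half: "ennreal (r / 2) + ennreal (r / 2) = e" using r by (simp flip: ennreal_plus)
  have pos: "0 < ennreal (r / 2)" using r by simp
  obtain k where k: "\<delta> k < ennreal (r / 2)"
    using order_tendstoD(2)[OF assms(2) pos] by (auto simp: eventually_sequentially)
  obtain g where g: "g \<longlonglongrightarrow> 0" "\<And>n. f n \<le> g n + \<delta> k" using assms(1) by blast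
  show "eventually (\<lambda>n. f n < a) sequentially"
    using order_tendstoD(2)[OF g(1) pos]
  proof eventually_elim
    case (elim n)
    have "f n \<le> g n + \<delta> k" by (rule g)
    also have "\<dots> \<le> ennreal (r / 2) + ennreal (r / 2)" using elim k by (intro add_mono) auto
    finally show ?case using half e by simp
  qed
qed auto

lemma mean_zero [simp]: "mean M B (\<lambda>y. 0) = 0"
  by (simp add: mean_def)

lemma ball_avg_add:
  assumes "set_integrable M Q g" "set_integrable M Q h"
  shows "ball_avg M (\<lambda>x. g x + h x) Q = ball_avg M g Q + ball_avg M h Q"
  using assms by (simp add: ball_avg_def set_integral_add scaleR_add_right)

lemma ball_avg_diff:
  assumes "set_integrable M Q g" "set_integrable M Q h"
  shows "ball_avg M (\<lambda>x. g x - h x) Q = ball_avg M g Q - ball_avg M h Q"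
  using assms by (simp add: ball_avg_def set_integral_diff scaleR_diff_right)

lemma ball_avg_const:
  assumes "Q \<in> sets M" "emeasure M Q \<noteq> 0" "emeasure M Q \<noteq> top"
  shows "ball_avg M (\<lambda>x. c) Q = c"
proof -
  have "measure M Q \<noteq> 0" using assms by (simp add: emeasure_eq_ennreal_measure)
  then show ?thesis using assms
    by (simp add: ball_avg_def set_lebesgue_integral_def less_top)
qed

lemma set_integrable_const:
  assumes "Q \<in> sets M" "emeasure M Q \<noteq> top"
  shows "set_integrable M Q (\<lambda>x. c :: complex)"
  using assms by (simp add: set_integrable_def less_top)

lemma norm_ball_avg_le:
  assumes [measurable]: "Q \<in> sets M" and Q: "emeasure M Q \<noteq> 0" "emeasure M Q \<noteq> top" and g: "set_integrable M Q g"
  shows "ennreal (cmod (ball_avg M g Q)) \<le> mean M Q (\<lambda>y. ennreal (cmod (g y)))"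
proof -
  have m: "0 < measure M Q" using Q by (simp add: emeasure_eq_ennreal_measure zero_less_measure_iff)
  have "ennreal (cmod (LINT x:Q|M. g x)) \<le> (\<integral>\<^sup>+x. norm (indicator Q x *\<^sub>R g x) \<partial>M)"
    using g unfolding set_lebesgue_integral_def set_integrable_def by (rule integral_norm_bound_ennreal)
  also have "\<dots> = (\<integral>\<^sup>+x\<in>Q. ennreal (cmod (g x)) \<partial>M)"
    by (intro nn_integral_cong) (auto simp: indicator_def)
  finally have "ennreal (cmod (LINT x:Q|M. g x)) / emeasure M Q \<le> mean M Q (\<lambda>y. ennreal (cmod (g y)))"
    unfolding mean_def by (rule divide_right_mono_ennreal)
  moreover have "ennreal (cmod (LINT x:Q|M. g x)) / emeasure M Q = ennreal (cmod (ball_avg M g Q))"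
    using Q m by (simp add: ball_avg_def emeasure_eq_ennreal_measure divide_ennreal divide_inverse mult.commute)
  ultimately show ?thesis by simp
qed

context homogeneous_space
begin

lemma sets_bl: "x \<in> space M \<Longrightarrow> 0 < R \<Longrightarrow> bl x R \<in> sets M"
  by (rule ball_measurable)

context
  fixes C :: "nat \<Rightarrow> nat \<Rightarrow> 'a \<Rightarrow> 'a set" and \<kappa> :: "nat \<Rightarrow> real"
  assumes C: "\<And>n. nested_partitions M (C n)"
    and small: "\<And>n x y. x \<in> space M \<Longrightarrow> y \<in> C n 0 x \<Longrightarrow> d x y < \<kappa> n"
    and kappa: "\<kappa> \<longlonglongrightarrow> 0" "\<And>n. \<kappa> n \<le> 1"
begin

abbreviation E :: "nat \<Rightarrow> ('a \<Rightarrow> ennreal) \<Rightarrow> 'a \<Rightarrow> ennreal" where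
  "E n f x \<equiv> mean M (C n 0 x) f"

lemma E_measurable [measurable]: "E n f \<in> borel_measurable M"
  by (rule nested_partitions.avg_measurable[OF C])

lemma E_selfadjoint:
  assumes [measurable]: "f \<in> borel_measurable M" "g \<in> borel_measurable M"
  shows "(\<integral>\<^sup>+x. f x * E n g x \<partial>M) = (\<integral>\<^sup>+x. E n f x * g x \<partial>M)"
proof -
  interpret nested_partitions M "C n" by (rule C)
  have ad: "adapted 0 (avg 0 h)" for h by (rule adapted_avg) simp
  have "(\<integral>\<^sup>+x. f x * avg 0 g x \<partial>M) = (\<integral>\<^sup>+x. avg 0 g x * avg 0 f x \<partial>M)"
    using nn_integral_adapted_mult_avg[OF ad, of f g] by (simp add: mult.commute)
  also have "\<dots> = (\<integral>\<^sup>+x. avg 0 f x * avg 0 g x \<partial>M)" by (simp add: mult.commute)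
  also have "\<dots> = (\<integral>\<^sup>+x. avg 0 f x * g x \<partial>M)" by (rule nn_integral_adapted_mult_avg[OF ad]) measurable
  finally show ?thesis .
qed

lemma cube_near_ball:
  assumes "x0 \<in> space M" "x \<in> bl x0 R" "y \<in> C n 0 x"
  shows "y \<in> bl x0 (A * (R + 1))"
proof -
  have x: "x \<in> space M" using assms by (simp add: mem_bl)
  have y: "y \<in> space M" using nested_partitions.cube_space[OF C x assms(3)] .
  have "d x0 y < A * (R + 1)"
    using small[OF x assms(3)] kappa(2)[of n] assms x y by (intro triangle_less[of x0 y x]) (auto simp: mem_bl)
  then show ?thesis using y by (simp add: mem_bl)
qed

lemma E_local:
  assumes x0: "x0 \<in> space M" and R: "0 < R" and [measurable]: "g \<in> borel_measurable M"
  shows "(\<integral>\<^sup>+x. indicator (bl x0 R) x * E n g x \<partial>M) \<le> (\<integral>\<^sup>+x. indicator (bl x0 (A * (R + 1))) x * g x \<partial>M)"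
proof -
  interpret nested_partitions M "C n" by (rule C)
  have [measurable]: "bl x0 R \<in> sets M" using x0 R by (rule sets_bl)
  have "(\<integral>\<^sup>+x. indicator (bl x0 R) x * E n g x \<partial>M) = (\<integral>\<^sup>+x. E n (indicator (bl x0 R)) x * g x \<partial>M)"
    by (rule E_selfadjoint) measurable
  also have "\<dots> \<le> (\<integral>\<^sup>+x. indicator (bl x0 (A * (R + 1))) x * g x \<partial>M)"
  proof (intro nn_integral_mono mult_right_mono)
    fix x assume x: "x \<in> space M"
    show "E n (indicator (bl x0 R)) x \<le> indicator (bl x0 (A * (R + 1))) x"
    proof (cases "x \<in> bl x0 (A * (R + 1))")
      case True
      have "E n (indicator (bl x0 R)) x \<le> E n (\<lambda>y. 1) x" by (rule mean_mono) (auto simp: indicator_def)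
      then show ?thesis using True avg_const[OF x] by simp
    next
      case False
      have "E n (indicator (bl x0 R)) x = E n (\<lambda>y. 0) x"
      proof (rule mean_cong)
        fix y assume y: "y \<in> space M" "y \<in> C n 0 x"
        have "x \<in> C n 0 y" using cube_sym[OF x y(2)] .
        then have "y \<notin> bl x0 R" using False cube_near_ball[OF x0, of y R x] by blast
        then show "indicator (bl x0 R) y = (0 :: ennreal)" by simp
      qed
      also have "\<dots> = 0" by (rule mean_zero)
      finally show ?thesis by simp
    qed
  qed simp
  finally show ?thesis .
qed

text \<open>
  In the limit, averaging moves no mass across the boundary of \<open>S\<close>, measured inside any ball. This
  symmetric condition passes to complements at once, which suits an induction over the Borel sets,
  and it makes sense for sets of infinite measure.
\<close>
definition mixes :: "'a set \<Rightarrow> bool" where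
  "mixes S \<longleftrightarrow> (\<forall>x0\<in>space M. \<forall>R>0.
     (\<lambda>n. \<integral>\<^sup>+x. indicator (bl x0 R - S) x * E n (indicator S) x \<partial>M) \<longlonglongrightarrow> 0 \<and>
     (\<lambda>n. \<integral>\<^sup>+x. indicator (bl x0 R \<inter> S) x * E n (indicator (space M - S)) x \<partial>M) \<longlonglongrightarrow> 0)"

lemma E_complement_open:
  assumes U: "qopen d (space M) U" and x: "x \<in> U"
  shows "eventually (\<lambda>n. \<forall>T. T \<inter> U = {} \<longrightarrow> E n (indicator T) x = 0) sequentially"
proof -
  obtain r where r: "0 < r" "bl x r \<subseteq> U" using U x by (auto simp: qopen_def)
  have xX: "x \<in> space M" using U x by (auto simp: qopen_def)
  show ?thesis
    using order_tendstoD(2)[OF kappa(1) r(1)]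
  proof eventually_elim
    case (elim n)
    show ?case
    proof (intro allI impI)
      fix T assume T: "T \<inter> U = {}"
      have "E n (indicator T) x = E n (\<lambda>y. 0) x"
      proof (rule mean_cong)
        fix y assume y: "y \<in> space M" "y \<in> C n 0 x"
        have "y \<in> bl x r" using small[OF xX y(2)] elim y by (simp add: mem_bl)
        then have "y \<notin> T" using r T by blast
        then show "indicator T y = (0 :: ennreal)" by simp
      qed
      then show "E n (indicator T) x = 0" by (simp add: mean_def)
    qed
  qed
qed

lemma E_indicator_le_1: "x \<in> space M \<Longrightarrow> E n (indicator T) x \<le> 1"
  using mean_mono[of M "C n 0 x" "indicator T" "\<lambda>y. 1"] nested_partitions.avg_const[OF C, of x n 0 1]
  by (simp add: indicator_def)

text \<open>
  Cubes shrink to points, so at a point of an open set \<open>U\<close> they are eventually contained in \<open>U\<close>. Mass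
  entering \<open>U\<close> therefore vanishes by dominated convergence, and self-adjointness of the averages
  turns mass leaving \<open>U\<close> into mass entering it.
\<close>
lemma mixes_open:
  assumes U: "qopen d (space M) U"
  shows "mixes U"
  unfolding mixes_def
proof (intro ballI allI impI conjI)
  fix x0 R assume x0: "x0 \<in> space M" and R: "0 < (R::real)"
  have [measurable]: "U \<in> sets M" using U by (rule open_measurable)
  have [measurable]: "bl x0 R \<in> sets M" "bl x0 (A * (R + 1)) \<in> sets M"
    using x0 R A by (auto intro!: sets_bl mult_pos_pos)
  have dom: "(\<lambda>n. \<integral>\<^sup>+x. u n x \<partial>M) \<longlonglongrightarrow> (\<integral>\<^sup>+x. 0 \<partial>M)"
    if um: "\<And>n. u n \<in> borel_measurable M" and lim: "\<And>x. x \<in> space M \<Longrightarrow> (\<lambda>n. u n x) \<longlonglongrightarrow> 0"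
      and le: "\<And>n x. x \<in> space M \<Longrightarrow> u n x \<le> indicator (bl x0 S) x" and S: "0 < S" for u S
  proof (rule nn_integral_dominated_convergence[where w = "indicator (bl x0 S)"])
    show "(\<integral>\<^sup>+x. indicator (bl x0 S) x \<partial>M) < \<infinity>" using bl_fin[OF x0 S] sets_bl[OF x0 S] by (simp add: less_top)
    show "indicator (bl x0 S) \<in> borel_measurable M" using sets_bl[OF x0 S] by simp
  qed (use um lim le in auto)
  have zero: "(\<lambda>n. indicator U x * E n (indicator T) x) \<longlonglongrightarrow> 0" if "T \<inter> U = {}" for x T
  proof (cases "x \<in> U")
    case True
    have "eventually (\<lambda>n. indicator U x * E n (indicator T) x = 0) sequentially"
      using E_complement_open[OF U True] by eventually_elim (use that in simp)
    then show ?thesis by (rule tendsto_eventually)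
  qed simp
  have "(\<lambda>n. \<integral>\<^sup>+x. indicator U x * E n (indicator (bl x0 R - U)) x \<partial>M) \<longlonglongrightarrow> (\<integral>\<^sup>+x. 0 \<partial>M)"
  proof (rule dom)
    show "(\<lambda>n. indicator U x * E n (indicator (bl x0 R - U)) x) \<longlonglongrightarrow> 0" for x by (rule zero) auto
    show "0 < A * (R + 1)" using A R by simp
    show "indicator U x * E n (indicator (bl x0 R - U)) x \<le> indicator (bl x0 (A * (R + 1))) x" if x: "x \<in> space M" for n x
    proof (cases "x \<in> bl x0 (A * (R + 1))")
      case True
      then show ?thesis using E_indicator_le_1[OF x, of n "bl x0 R - U"] by (auto simp: indicator_def)
    next
      case False
      have "E n (indicator (bl x0 R - U)) x = E n (\<lambda>y. 0) x"
      proof (rule mean_cong)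
        fix y assume y: "y \<in> space M" "y \<in> C n 0 x"
        have "x \<in> C n 0 y" using nested_partitions.cube_sym[OF C x y(2)] .
        then have "y \<notin> bl x0 R" using False cube_near_ball[OF x0, of y R x] by blast
        then show "indicator (bl x0 R - U) y = (0 :: ennreal)" by simp
      qed
      also have "\<dots> = 0" by (rule mean_zero)
      finally show ?thesis by simp
    qed
  qed measurable
  moreover have "(\<integral>\<^sup>+x. indicator (bl x0 R - U) x * E n (indicator U) x \<partial>M) = (\<integral>\<^sup>+x. indicator U x * E n (indicator (bl x0 R - U)) x \<partial>M)" for n
    by (subst E_selfadjoint) (auto simp: mult.commute)
  ultimately show "(\<lambda>n. \<integral>\<^sup>+x. indicator (bl x0 R - U) x * E n (indicator U) x \<partial>M) \<longlonglongrightarrow> 0" by simp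
  have "(\<lambda>n. \<integral>\<^sup>+x. indicator (bl x0 R) x * (indicator U x * E n (indicator (space M - U)) x) \<partial>M) \<longlonglongrightarrow> (\<integral>\<^sup>+x. 0 \<partial>M)"
  proof (rule dom[OF _ _ _ R])
    show "(\<lambda>n. indicator (bl x0 R) x * (indicator U x * E n (indicator (space M - U)) x)) \<longlonglongrightarrow> 0" for x
      using zero[of "space M - U" x] by (cases "x \<in> bl x0 R") auto
    show "indicator (bl x0 R) x * (indicator U x * E n (indicator (space M - U)) x) \<le> indicator (bl x0 R) x" if "x \<in> space M" for n x
      using E_indicator_le_1[OF that, of n "space M - U"] by (auto simp: indicator_def)
  qed measurable
  then show "(\<lambda>n. \<integral>\<^sup>+x. indicator (bl x0 R \<inter> U) x * E n (indicator (space M - U)) x \<partial>M) \<longlonglongrightarrow> 0"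
    by (simp add: indicator_inter_arith mult.assoc)
qed

lemma mixes_compl: "S \<in> sets M \<Longrightarrow> mixes S \<Longrightarrow> mixes (space M - S)"
proof -
  assume S: "S \<in> sets M" "mixes S"
  have SX: "S \<subseteq> space M" using S(1) by (rule sets.sets_into_space)
  have eq: "bl x0 R - (space M - S) = bl x0 R \<inter> S" "bl x0 R \<inter> (space M - S) = bl x0 R - S" "space M - (space M - S) = S" for x0 R
    using SX by (auto simp: mem_bl)
  show ?thesis using S(2) unfolding mixes_def eq by blast
qed

lemma mixes_Union:
  fixes S :: "nat \<Rightarrow> 'a set"
  assumes S [measurable]: "\<And>i. S i \<in> sets M" and disj: "disjoint_family S" and mix: "\<And>i. mixes (S i)"
  shows "mixes (\<Union>i. S i)"
  unfolding mixes_def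
proof (intro ballI allI impI conjI)
  fix x0 R assume x0: "x0 \<in> space M" and R: "0 < (R::real)"
  let ?F = "bl x0 R" and ?F' = "bl x0 (A * (R + 1))" and ?S = "\<Union>i. S i"
  define T where "T k = (\<Union>i. S (i + k))" for k
  have F' : "0 < A * (R + 1)" using A R by simp
  have [measurable]: "?F \<in> sets M" "?F' \<in> sets M" "T k \<in> sets M" for k
    using sets_bl[OF x0 R] sets_bl[OF x0 F'] by (auto simp: T_def)
  have FF': "?F \<subseteq> ?F'"
  proof (rule bl_mono)
    have "1 * (R + 1) \<le> A * (R + 1)" using A R by (intro mult_right_mono) auto
    then show "R \<le> A * (R + 1)" by (rule order_trans[rotated]) simp
  qed
  have tail: "(\<lambda>k. emeasure M (?F' \<inter> T k)) \<longlonglongrightarrow> 0"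
  proof -
    have dec: "decseq (\<lambda>k. ?F' \<inter> T k)"
      unfolding decseq_def
    proof safe
      fix k l x assume "k \<le> l" "x \<in> T l"
      then obtain i where "x \<in> S (i + l)" by (auto simp: T_def)
      then have "x \<in> S ((i + (l - k)) + k)" using \<open>k \<le> l\<close> by simp
      then show "x \<in> T k" unfolding T_def by blast
    qed
    have "(\<Inter>k. ?F' \<inter> T k) = {}"
    proof (rule ccontr)
      assume "(\<Inter>k. ?F' \<inter> T k) \<noteq> {}"
      then obtain x where x: "\<And>k. x \<in> T k" by blast
      obtain i where i: "x \<in> S i" using x[of 0] by (auto simp: T_def)
      obtain j where j: "x \<in> S (j + Suc i)" using x[of "Suc i"] by (auto simp: T_def)
      have "S i \<inter> S (j + Suc i) = {}" using disj by (auto simp: disjoint_family_on_def)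
      then show False using i j by blast
    qed
    moreover have "(\<lambda>k. emeasure M (?F' \<inter> T k)) \<longlonglongrightarrow> emeasure M (\<Inter>k. ?F' \<inter> T k)"
    proof (rule Lim_emeasure_decseq[OF _ dec])
      show "emeasure M (?F' \<inter> T k) \<noteq> \<infinity>" for k
        using bl_fin[OF x0 F'] emeasure_mono[of "?F' \<inter> T k" ?F' M] by (auto simp: top_unique)
    qed auto
    ultimately show ?thesis by simp
  qed
  have split: "(indicator ?S y :: ennreal) = (\<Sum>i<k. indicator (S i) y) + indicator (T k) y" for y k
  proof -
    have "?S = (\<Union>i<k. S i) \<union> T k"
    proof
      show "?S \<subseteq> (\<Union>i<k. S i) \<union> T k"
      proof safe
        fix x i assume "x \<in> S i" "x \<notin> T k"
        then have "i < k" unfolding T_def using le_add_diff_inverse2[of k i] by (metis UN_I UNIV_I not_less)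
        then show "x \<in> (\<Union>i<k. S i)" using \<open>x \<in> S i\<close> by blast
      qed
    qed (auto simp: T_def)
    moreover have "(\<Union>i<k. S i) \<inter> T k = {}"
    proof (rule ccontr)
      assume "(\<Union>i<k. S i) \<inter> T k \<noteq> {}"
      then obtain x i j where "i < k" "x \<in> S i" "x \<in> S (j + k)" by (auto simp: T_def)
      moreover have "S i \<inter> S (j + k) = {}" using disj \<open>i < k\<close> by (auto simp: disjoint_family_on_def)
      ultimately show False by blast
    qed
    ultimately have "(indicator ?S y :: ennreal) = indicator (\<Union>i<k. S i) y + indicator (T k) y"
      by (auto simp: indicator_def)
    moreover have "(indicator (\<Union>i<k. S i) y :: ennreal) = (\<Sum>i<k. indicator (S i) y)"
      using disjoint_family_on_mono[OF _ disj, of "{..<k}"] by (simp add: indicator_UN_disjoint)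
    ultimately show ?thesis by simp
  qed
  have mixF: "(\<lambda>n. \<integral>\<^sup>+x. indicator (?F - S i) x * E n (indicator (S i)) x \<partial>M) \<longlonglongrightarrow> 0"
     "(\<lambda>n. \<integral>\<^sup>+x. indicator (?F \<inter> S i) x * E n (indicator (space M - S i)) x \<partial>M) \<longlonglongrightarrow> 0" for i
    using mix[of i] x0 R unfolding mixes_def by blast+
  show "(\<lambda>n. \<integral>\<^sup>+x. indicator (?F - ?S) x * E n (indicator ?S) x \<partial>M) \<longlonglongrightarrow> 0"
  proof (rule tendsto_0_approx[OF _ tail])
    fix k
    \<comment> \<open>Finitely many sets are handled one by one; the remaining ones have small measure in the larger ball.\<close>
    let ?g = "\<lambda>n. \<Sum>i<k. \<integral>\<^sup>+x. indicator (?F - S i) x * E n (indicator (S i)) x \<partial>M"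
    have "?g \<longlonglongrightarrow> (\<Sum>i<k. 0)" by (intro tendsto_sum mixF)
    moreover have "(\<integral>\<^sup>+x. indicator (?F - ?S) x * E n (indicator ?S) x \<partial>M) \<le> ?g n + emeasure M (?F' \<inter> T k)" for n
    proof -
      have "(\<integral>\<^sup>+x. indicator (?F - ?S) x * E n (indicator ?S) x \<partial>M)
          \<le> (\<integral>\<^sup>+x. (\<Sum>i<k. indicator (?F - S i) x * E n (indicator (S i)) x) + indicator ?F x * E n (indicator (T k)) x \<partial>M)"
      proof (rule nn_integral_mono)
        fix x assume x: "x \<in> space M"
        have Q [measurable]: "C n 0 x \<in> sets M" by (rule nested_partitions.cube_sets[OF C x])
        have "E n (indicator ?S) x = E n (\<lambda>y. (\<Sum>i<k. indicator (S i) y) + indicator (T k) y) x"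
          by (rule mean_cong) (rule split)
        also have "\<dots> = E n (\<lambda>y. \<Sum>i<k. indicator (S i) y) x + E n (indicator (T k)) x"
          by (rule mean_add) measurable
        also have "E n (\<lambda>y. \<Sum>i<k. indicator (S i) y) x = (\<Sum>i<k. E n (indicator (S i)) x)"
          by (rule mean_sum) measurable
        finally have "indicator (?F - ?S) x * E n (indicator ?S) x
            = (\<Sum>i<k. indicator (?F - ?S) x * E n (indicator (S i)) x) + indicator (?F - ?S) x * E n (indicator (T k)) x"
          by (simp only: distrib_left sum_distrib_left)
        also have "\<dots> \<le> (\<Sum>i<k. indicator (?F - S i) x * E n (indicator (S i)) x) + indicator ?F x * E n (indicator (T k)) x"
          by (intro add_mono sum_mono mult_right_mono) (auto simp: indicator_def)
        finally show "indicator (?F - ?S) x * E n (indicator ?S) x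
          \<le> (\<Sum>i<k. indicator (?F - S i) x * E n (indicator (S i)) x) + indicator ?F x * E n (indicator (T k)) x" .
      qed
      also have "\<dots> = (\<integral>\<^sup>+x. (\<Sum>i<k. indicator (?F - S i) x * E n (indicator (S i)) x) \<partial>M) + (\<integral>\<^sup>+x. indicator ?F x * E n (indicator (T k)) x \<partial>M)"
        by (rule nn_integral_add) measurable
      also have "(\<integral>\<^sup>+x. (\<Sum>i<k. indicator (?F - S i) x * E n (indicator (S i)) x) \<partial>M) = ?g n"
        by (rule nn_integral_sum) measurable
      also have "(\<integral>\<^sup>+x. indicator ?F x * E n (indicator (T k)) x \<partial>M) \<le> (\<integral>\<^sup>+x. indicator ?F' x * indicator (T k) x \<partial>M)"
        by (rule E_local[OF x0 R]) measurable
      also have "\<dots> = emeasure M (?F' \<inter> T k)"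
        by (simp add: indicator_inter_arith[symmetric])
      finally show ?thesis by (simp add: add_left_mono)
    qed
    ultimately show "\<exists>g. g \<longlonglongrightarrow> 0 \<and> (\<forall>n. (\<integral>\<^sup>+x. indicator (?F - ?S) x * E n (indicator ?S) x \<partial>M) \<le> g n + emeasure M (?F' \<inter> T k))"
      by (intro exI[of _ ?g]) simp
  qed
  show "(\<lambda>n. \<integral>\<^sup>+x. indicator (?F \<inter> ?S) x * E n (indicator (space M - ?S)) x \<partial>M) \<longlonglongrightarrow> 0"
  proof (rule tendsto_0_approx[OF _ tail])
    fix k
    let ?g = "\<lambda>n. \<Sum>i<k. \<integral>\<^sup>+x. indicator (?F \<inter> S i) x * E n (indicator (space M - S i)) x \<partial>M"
    have "?g \<longlonglongrightarrow> (\<Sum>i<k. 0)" by (intro tendsto_sum mixF)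
    moreover have "(\<integral>\<^sup>+x. indicator (?F \<inter> ?S) x * E n (indicator (space M - ?S)) x \<partial>M) \<le> ?g n + emeasure M (?F' \<inter> T k)" for n
    proof -
      have "(\<integral>\<^sup>+x. indicator (?F \<inter> ?S) x * E n (indicator (space M - ?S)) x \<partial>M)
          \<le> (\<integral>\<^sup>+x. (\<Sum>i<k. indicator (?F \<inter> S i) x * E n (indicator (space M - S i)) x) + indicator (?F' \<inter> T k) x \<partial>M)"
      proof (rule nn_integral_mono)
        fix x assume x: "x \<in> space M"
        have "indicator (?F \<inter> ?S) x * E n (indicator (space M - ?S)) x
            = (\<Sum>i<k. indicator (?F \<inter> S i) x * E n (indicator (space M - ?S)) x) + indicator (?F \<inter> T k) x * E n (indicator (space M - ?S)) x"
          unfolding indicator_inter_arith split[of x k] by (simp only: distrib_left distrib_right sum_distrib_left sum_distrib_right)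
        also have "\<dots> \<le> (\<Sum>i<k. indicator (?F \<inter> S i) x * E n (indicator (space M - S i)) x) + indicator (?F' \<inter> T k) x * 1"
        proof (intro add_mono sum_mono mult_mono)
          show "E n (indicator (space M - ?S)) x \<le> E n (indicator (space M - S i)) x" for i
            by (rule mean_mono) (auto simp: indicator_def)
          show "E n (indicator (space M - ?S)) x \<le> 1" by (rule E_indicator_le_1[OF x])
          show "indicator (?F \<inter> T k) x \<le> (indicator (?F' \<inter> T k) x :: ennreal)" using FF' by (auto simp: indicator_def)
        qed auto
        finally show "indicator (?F \<inter> ?S) x * E n (indicator (space M - ?S)) x
          \<le> (\<Sum>i<k. indicator (?F \<inter> S i) x * E n (indicator (space M - S i)) x) + indicator (?F' \<inter> T k) x" by simp
      qed
      also have "\<dots> = (\<integral>\<^sup>+x. (\<Sum>i<k. indicator (?F \<inter> S i) x * E n (indicator (space M - S i)) x) \<partial>M) + (\<integral>\<^sup>+x. indicator (?F' \<inter> T k) x \<partial>M)"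
        by (rule nn_integral_add) measurable
      also have "(\<integral>\<^sup>+x. (\<Sum>i<k. indicator (?F \<inter> S i) x * E n (indicator (space M - S i)) x) \<partial>M) = ?g n"
        by (rule nn_integral_sum) measurable
      also have "(\<integral>\<^sup>+x. indicator (?F' \<inter> T k) x \<partial>M) = emeasure M (?F' \<inter> T k)" by simp
      finally show ?thesis .
    qed
    ultimately show "\<exists>g. g \<longlonglongrightarrow> 0 \<and> (\<forall>n. (\<integral>\<^sup>+x. indicator (?F \<inter> ?S) x * E n (indicator (space M - ?S)) x \<partial>M) \<le> g n + emeasure M (?F' \<inter> T k))"
      by (intro exI[of _ ?g]) simp
  qed
qed

lemma mixes_Borel:
  assumes "S \<in> sigma_sets (space M) {U. qopen d (space M) U}"
  shows "S \<in> sets M \<and> mixes S"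
proof -
  have stable: "Int_stable {U. qopen d (space M) U}"
    unfolding Int_stable_def
  proof safe
    fix U V assume U: "qopen d (space M) U" and V: "qopen d (space M) V"
    show "qopen d (space M) (U \<inter> V)"
      unfolding qopen_def
    proof safe
      fix x assume x: "x \<in> U" "x \<in> V"
      obtain r where r: "0 < r" "bl x r \<subseteq> U" using U x by (auto simp: qopen_def)
      obtain s where s: "0 < s" "bl x s \<subseteq> V" using V x by (auto simp: qopen_def)
      have "bl x (min r s) \<subseteq> U \<inter> V" using r s bl_mono[of "min r s" r x] bl_mono[of "min r s" s x] by auto
      then show "\<exists>r>0. bl x r \<subseteq> U \<inter> V" using r s by (intro exI[of _ "min r s"]) auto
    qed (use U in \<open>auto simp: qopen_def\<close>)
  qed
  have pow: "{U. qopen d (space M) U} \<subseteq> Pow (space M)" by (auto simp: qopen_def)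
  show ?thesis
  proof (rule sigma_sets_induct_disjoint[OF stable pow assms])
    show "U \<in> sets M \<and> mixes U" if "U \<in> {U. qopen d (space M) U}" for U
      using that open_measurable mixes_open by simp
    have "qopen d (space M) {}" by (simp add: qopen_def)
    then show "{} \<in> sets M \<and> mixes {}" using mixes_open by simp
  qed (auto intro: mixes_compl mixes_Union)
qed

text \<open>
  Borel regularity: inside a ball, a measurable set agrees with a Borel set up to a null set.
\<close>
lemma mixes_sets:
  assumes S [measurable]: "S \<in> sets M"
  shows "mixes S"
  unfolding mixes_def
proof (intro ballI allI impI)
  fix x0 R assume x0: "x0 \<in> space M" and R: "0 < (R::real)"
  let ?F = "bl x0 R" and ?F' = "bl x0 (A * (R + 1))"
  have R': "0 < A * (R + 1)" using A R by simp
  have [measurable]: "?F \<in> sets M" "?F' \<in> sets M" using sets_bl[OF x0 R] sets_bl[OF x0 R'] by auto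
  have FF': "?F \<subseteq> ?F'"
  proof (rule bl_mono)
    have "1 * (R + 1) \<le> A * (R + 1)" using A R by (intro mult_right_mono) auto
    then show "R \<le> A * (R + 1)" by (rule order_trans[rotated]) simp
  qed
  obtain H where H: "H \<in> sigma_sets (space M) {U. qopen d (space M) U}" "S \<inter> ?F' \<subseteq> H" "emeasure M H = emeasure M (S \<inter> ?F')"
    using borel_regular[of "S \<inter> ?F'"] by auto
  have HM [measurable]: "H \<in> sets M" and mix: "mixes H" using mixes_Borel[OF H(1)] by auto
  have fin: "emeasure M (S \<inter> ?F') \<noteq> \<infinity>"
    using bl_fin[OF x0 R'] emeasure_mono[of "S \<inter> ?F'" ?F' M] by (auto simp: top_unique)
  have "emeasure M (H - S \<inter> ?F') = 0"
    using emeasure_Diff[OF fin _ _ H(2)] H(3) fin by simp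
  then have null: "AE x in M. x \<notin> H - S \<inter> ?F'" by (intro AE_not_in) auto
  have eq: "AE x in M. x \<in> ?F' \<longrightarrow> (x \<in> S \<longleftrightarrow> x \<in> H)"
    using null by eventually_elim (use H(2) in auto)
  have EE: "E n (indicator S) x = E n (indicator H) x" "E n (indicator (space M - S)) x = E n (indicator (space M - H)) x"
    if x: "x \<in> ?F" for x n
  proof -
    have sub: "C n 0 x \<subseteq> ?F'" using cube_near_ball[OF x0 x] by blast
    show "E n (indicator S) x = E n (indicator H) x"
      by (rule mean_cong_AE) (use eq sub in \<open>auto elim!: eventually_mono simp: indicator_def\<close>)
    show "E n (indicator (space M - S)) x = E n (indicator (space M - H)) x"
      by (rule mean_cong_AE) (use eq sub in \<open>auto elim!: eventually_mono simp: indicator_def\<close>)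
  qed
  have "(\<integral>\<^sup>+x. indicator (?F - S) x * E n (indicator S) x \<partial>M) = (\<integral>\<^sup>+x. indicator (?F - H) x * E n (indicator H) x \<partial>M)" for n
    by (rule nn_integral_cong_AE) (use eq FF' in \<open>auto elim!: eventually_mono simp: indicator_def EE\<close>)
  moreover have "(\<integral>\<^sup>+x. indicator (?F \<inter> S) x * E n (indicator (space M - S)) x \<partial>M) = (\<integral>\<^sup>+x. indicator (?F \<inter> H) x * E n (indicator (space M - H)) x \<partial>M)" for n
    by (rule nn_integral_cong_AE) (use eq FF' in \<open>auto elim!: eventually_mono simp: indicator_def EE\<close>)
  moreover have "(\<lambda>n. \<integral>\<^sup>+x. indicator (?F - H) x * E n (indicator H) x \<partial>M) \<longlonglongrightarrow> 0 \<and>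
     (\<lambda>n. \<integral>\<^sup>+x. indicator (?F \<inter> H) x * E n (indicator (space M - H)) x \<partial>M) \<longlonglongrightarrow> 0"
    using mix x0 R unfolding mixes_def by blast
  ultimately show "(\<lambda>n. \<integral>\<^sup>+x. indicator (?F - S) x * E n (indicator S) x \<partial>M) \<longlonglongrightarrow> 0 \<and>
     (\<lambda>n. \<integral>\<^sup>+x. indicator (?F \<inter> S) x * E n (indicator (space M - S)) x \<partial>M) \<longlonglongrightarrow> 0" by simp
qed

abbreviation "cavg n g x \<equiv> ball_avg M g (C n 0 x)"

lemma cavg_measurable [measurable]: "cavg n g \<in> borel_measurable M"
proof -
  interpret nested_partitions M "C n" by (rule C)
  show ?thesis by (rule adapted_measurable[OF adapted_cube]) auto
qed

lemma integrable_cube: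
  fixes g :: "'a \<Rightarrow> complex"
  shows "integrable M g \<Longrightarrow> x \<in> space M \<Longrightarrow> set_integrable M (C n 0 x) g"
  unfolding set_integrable_def
  by (rule integrable_mult_indicator[OF nested_partitions.cube_sets[OF C]])

lemma norm_cavg_le: "x \<in> space M \<Longrightarrow> set_integrable M (C n 0 x) g \<Longrightarrow> ennreal (cmod (cavg n g x)) \<le> E n (\<lambda>y. ennreal (cmod (g y))) x"
  by (intro norm_ball_avg_le nested_partitions.cube_sets[OF C] nested_partitions.cube_pos[OF C] nested_partitions.cube_fin[OF C])

definition "L1_conv g \<longleftrightarrow> (\<forall>x0\<in>space M. \<forall>R>0.
  (\<lambda>n. \<integral>\<^sup>+x. indicator (bl x0 R) x * ennreal (cmod (cavg n g x - g x)) \<partial>M) \<longlonglongrightarrow> 0)"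

lemma cavg_error_le:
  assumes g: "integrable M g" and [measurable]: "F \<in> sets M"
  shows "(\<integral>\<^sup>+x. indicator F x * ennreal (cmod (cavg n g x - g x)) \<partial>M) \<le> 2 * (\<integral>\<^sup>+x. ennreal (cmod (g x)) \<partial>M)"
proof -
  have [measurable]: "g \<in> borel_measurable M" using g by simp
  have "(\<integral>\<^sup>+x. indicator F x * ennreal (cmod (cavg n g x - g x)) \<partial>M) \<le> (\<integral>\<^sup>+x. E n (\<lambda>y. ennreal (cmod (g y))) x + ennreal (cmod (g x)) \<partial>M)"
  proof (rule nn_integral_mono)
    fix x assume x: "x \<in> space M"
    have "ennreal (cmod (cavg n g x - g x)) \<le> ennreal (cmod (cavg n g x) + cmod (g x))"
      by (intro ennreal_leI norm_triangle_ineq4)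
    also have "\<dots> = ennreal (cmod (cavg n g x)) + ennreal (cmod (g x))" by simp
    also have "\<dots> \<le> E n (\<lambda>y. ennreal (cmod (g y))) x + ennreal (cmod (g x))"
      by (intro add_right_mono norm_cavg_le integrable_cube g x)
    finally show "indicator F x * ennreal (cmod (cavg n g x - g x)) \<le> E n (\<lambda>y. ennreal (cmod (g y))) x + ennreal (cmod (g x))"
      by (auto simp: indicator_def)
  qed
  also have "\<dots> = (\<integral>\<^sup>+x. E n (\<lambda>y. ennreal (cmod (g y))) x \<partial>M) + (\<integral>\<^sup>+x. ennreal (cmod (g x)) \<partial>M)"
    by (rule nn_integral_add) measurable
  also have "(\<integral>\<^sup>+x. E n (\<lambda>y. ennreal (cmod (g y))) x \<partial>M) = (\<integral>\<^sup>+x. ennreal (cmod (g x)) \<partial>M)"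
    by (rule nested_partitions.nn_integral_avg[OF C]) measurable
  finally show ?thesis by (simp add: mult_2)
qed

lemma cavg_error_add:
  assumes g: "integrable M g" and h: "integrable M h" and [measurable]: "F \<in> sets M"
  shows "(\<integral>\<^sup>+x. indicator F x * ennreal (cmod (cavg n (\<lambda>x. g x + h x) x - (g x + h x))) \<partial>M)
    \<le> (\<integral>\<^sup>+x. indicator F x * ennreal (cmod (cavg n g x - g x)) \<partial>M) + (\<integral>\<^sup>+x. indicator F x * ennreal (cmod (cavg n h x - h x)) \<partial>M)"
proof -
  have [measurable]: "g \<in> borel_measurable M" "h \<in> borel_measurable M" using g h by auto
  have "(\<integral>\<^sup>+x. indicator F x * ennreal (cmod (cavg n (\<lambda>x. g x + h x) x - (g x + h x))) \<partial>M)
      \<le> (\<integral>\<^sup>+x. indicator F x * ennreal (cmod (cavg n g x - g x)) + indicator F x * ennreal (cmod (cavg n h x - h x)) \<partial>M)"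
  proof (rule nn_integral_mono)
    fix x assume x: "x \<in> space M"
    have "cavg n (\<lambda>x. g x + h x) x - (g x + h x) = (cavg n g x - g x) + (cavg n h x - h x)"
      by (simp add: ball_avg_add integrable_cube g h x)
    then have "ennreal (cmod (cavg n (\<lambda>x. g x + h x) x - (g x + h x))) \<le> ennreal (cmod (cavg n g x - g x) + cmod (cavg n h x - h x))"
      by (simp only: ennreal_leI norm_triangle_ineq)
    then show "indicator F x * ennreal (cmod (cavg n (\<lambda>x. g x + h x) x - (g x + h x)))
      \<le> indicator F x * ennreal (cmod (cavg n g x - g x)) + indicator F x * ennreal (cmod (cavg n h x - h x))"
      by (auto simp: indicator_def)
  qed
  also have "\<dots> = (\<integral>\<^sup>+x. indicator F x * ennreal (cmod (cavg n g x - g x)) \<partial>M) + (\<integral>\<^sup>+x. indicator F x * ennreal (cmod (cavg n h x - h x)) \<partial>M)"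
    by (rule nn_integral_add) measurable
  finally show ?thesis .
qed

lemma L1_conv_indicator:
  assumes S [measurable]: "S \<in> sets M" and fin: "emeasure M S < \<infinity>"
  shows "L1_conv (\<lambda>x. indicator S x *\<^sub>R c)"
  unfolding L1_conv_def
proof (intro ballI allI impI)
  fix x0 R assume x0: "x0 \<in> space M" and R: "0 < (R::real)"
  let ?F = "bl x0 R" and ?g = "\<lambda>x. indicator S x *\<^sub>R c"
  have [measurable]: "?F \<in> sets M" using sets_bl[OF x0 R] .
  let ?u = "\<lambda>n. \<integral>\<^sup>+x. indicator (?F - S) x * E n (indicator S) x \<partial>M"
  let ?v = "\<lambda>n. \<integral>\<^sup>+x. indicator (?F \<inter> S) x * E n (indicator (space M - S)) x \<partial>M"
  have uv: "?u \<longlonglongrightarrow> 0" "?v \<longlonglongrightarrow> 0" using mixes_sets[OF S] x0 R unfolding mixes_def by blast+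
  have int: "integrable M ?g" using fin by (intro integrable_scaleR_left integrable_real_indicator) auto
  have le: "(\<integral>\<^sup>+x. indicator ?F x * ennreal (cmod (cavg n ?g x - ?g x)) \<partial>M) \<le> ennreal (cmod c) * (?u n + ?v n)" for n
  proof -
    have "(\<integral>\<^sup>+x. indicator ?F x * ennreal (cmod (cavg n ?g x - ?g x)) \<partial>M)
        \<le> (\<integral>\<^sup>+x. ennreal (cmod c) * (indicator (?F - S) x * E n (indicator S) x + indicator (?F \<inter> S) x * E n (indicator (space M - S)) x) \<partial>M)"
    proof (rule nn_integral_mono)
      fix x assume x: "x \<in> space M"
      have Q: "C n 0 x \<in> sets M" "emeasure M (C n 0 x) \<noteq> 0" "emeasure M (C n 0 x) \<noteq> top"
        using nested_partitions.cube_sets[OF C x] nested_partitions.cube_pos[OF C x] nested_partitions.cube_fin[OF C x] by auto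
      have const: "set_integrable M (C n 0 x) (\<lambda>y. ?g x)" using Q by (intro set_integrable_const)
      have diff: "set_integrable M (C n 0 x) (\<lambda>y. ?g y - ?g x)"
        by (rule set_integral_diff(1)[OF integrable_cube[OF int x] const])
      have "cavg n ?g x - ?g x = ball_avg M (\<lambda>y. ?g y - ?g x) (C n 0 x)"
        using ball_avg_diff[OF integrable_cube[OF int x] const] ball_avg_const[OF Q, of "?g x"] by simp
      then have "ennreal (cmod (cavg n ?g x - ?g x)) \<le> E n (\<lambda>y. ennreal (cmod (?g y - ?g x))) x"
        using norm_cavg_le[OF x diff] by simp
      also have "\<dots> \<le> E n (\<lambda>y. ennreal (cmod c) * (indicator (if x \<in> S then space M - S else S) y)) x"
        by (rule mean_mono) (auto simp: indicator_def)
      also have "\<dots> = ennreal (cmod c) * E n (indicator (if x \<in> S then space M - S else S)) x"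
        by (rule mean_cmult[OF Q(1)]) auto
      finally show "indicator ?F x * ennreal (cmod (cavg n ?g x - ?g x))
          \<le> ennreal (cmod c) * (indicator (?F - S) x * E n (indicator S) x + indicator (?F \<inter> S) x * E n (indicator (space M - S)) x)"
        by (cases "x \<in> ?F"; cases "x \<in> S") auto
    qed
    also have "\<dots> = ennreal (cmod c) * (\<integral>\<^sup>+x. indicator (?F - S) x * E n (indicator S) x + indicator (?F \<inter> S) x * E n (indicator (space M - S)) x \<partial>M)"
      by (rule nn_integral_cmult) measurable
    also have "(\<integral>\<^sup>+x. indicator (?F - S) x * E n (indicator S) x + indicator (?F \<inter> S) x * E n (indicator (space M - S)) x \<partial>M) = ?u n + ?v n"
      by (rule nn_integral_add) measurable
    finally show ?thesis .
  qed
  have "(\<lambda>n. ennreal (cmod c) * (?u n + ?v n)) \<longlonglongrightarrow> ennreal (cmod c) * (0 + 0)"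
    by (intro ennreal_tendsto_cmult tendsto_add uv) simp
  then have lim: "(\<lambda>n. ennreal (cmod c) * (?u n + ?v n)) \<longlonglongrightarrow> 0" by simp
  show "(\<lambda>n. \<integral>\<^sup>+x. indicator ?F x * ennreal (cmod (cavg n ?g x - ?g x)) \<partial>M) \<longlonglongrightarrow> 0"
    by (rule tendsto_sandwich[OF _ _ tendsto_const lim]) (use le in auto)
qed

text \<open>
  Lebesgue's differentiation theorem in the mean. The partitions of different \<open>n\<close> are not nested in each
  other, so there is no martingale; convergence in the mean suffices for almost everywhere
  convergence of a subsequence.
\<close>
lemma L1_conv_integrable:
  fixes g :: "'a \<Rightarrow> complex"
  assumes "integrable M g"
  shows "L1_conv g"
  using assms
proof (induction rule: integrable_induct)
  case (base S c)
  then show ?case by (rule L1_conv_indicator)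
next
  case (add f g)
  show ?case
    unfolding L1_conv_def
  proof (intro ballI allI impI)
    fix x0 R assume x0: "x0 \<in> space M" and R: "0 < (R::real)"
    let ?e = "\<lambda>g n. \<integral>\<^sup>+x. indicator (bl x0 R) x * ennreal (cmod (cavg n g x - g x)) \<partial>M"
    have "(\<lambda>n. ?e f n + ?e g n) \<longlonglongrightarrow> 0 + 0"
      using add x0 R unfolding L1_conv_def by (intro tendsto_add) blast+
    then have lim: "(\<lambda>n. ?e f n + ?e g n) \<longlonglongrightarrow> 0" by simp
    show "?e (\<lambda>x. f x + g x) \<longlonglongrightarrow> 0"
      by (rule tendsto_sandwich[OF _ _ tendsto_const lim])
        (use cavg_error_add[OF add(1,2) sets_bl[OF x0 R]] in auto)
  qed
next
  case (lim f s)
  show ?case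
    unfolding L1_conv_def
  proof (intro ballI allI impI)
    fix x0 R assume x0: "x0 \<in> space M" and R: "0 < (R::real)"
    let ?e = "\<lambda>g n. \<integral>\<^sup>+x. indicator (bl x0 R) x * ennreal (cmod (cavg n g x - g x)) \<partial>M"
    let ?\<delta> = "\<lambda>k. 2 * (\<integral>\<^sup>+x. ennreal (cmod (f x - s k x)) \<partial>M)"
    have [measurable]: "f \<in> borel_measurable M" "s k \<in> borel_measurable M" for k using lim by auto
    have "(\<lambda>k. \<integral>\<^sup>+x. ennreal (cmod (f x - s k x)) \<partial>M) \<longlonglongrightarrow> (\<integral>\<^sup>+x. 0 \<partial>M)"
    proof (rule nn_integral_dominated_convergence[where w = "\<lambda>x. ennreal (3 * cmod (f x))"])
      have "(\<integral>\<^sup>+x. ennreal (cmod (f x)) \<partial>M) < \<infinity>"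
        using lim by (simp add: integrable_iff_bounded)
      moreover have "(\<integral>\<^sup>+x. ennreal (3 * cmod (f x)) \<partial>M) = 3 * (\<integral>\<^sup>+x. ennreal (cmod (f x)) \<partial>M)"
        by (subst nn_integral_cmult[symmetric]) (auto simp: ennreal_mult)
      ultimately show "(\<integral>\<^sup>+x. ennreal (3 * cmod (f x)) \<partial>M) < \<infinity>"
        by (simp add: ennreal_mult_less_top)
      show "AE x in M. ennreal (cmod (f x - s k x)) \<le> ennreal (3 * cmod (f x))" for k
      proof (rule AE_I2)
        fix x assume x: "x \<in> space M"
        have "cmod (f x - s k x) \<le> cmod (f x) + cmod (s k x)" by (rule norm_triangle_ineq4)
        then show "ennreal (cmod (f x - s k x)) \<le> ennreal (3 * cmod (f x))"
          using lim(3)[OF x, of k] by (intro ennreal_leI) simp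
      qed
      show "AE x in M. (\<lambda>k. ennreal (cmod (f x - s k x))) \<longlonglongrightarrow> 0"
      proof (rule AE_I2)
        fix x assume x: "x \<in> space M"
        have "(\<lambda>k. cmod (f x - s k x)) \<longlonglongrightarrow> cmod (f x - f x)"
          by (intro tendsto_intros lim(2) x)
        then show "(\<lambda>k. ennreal (cmod (f x - s k x))) \<longlonglongrightarrow> 0"
          using tendsto_ennrealI by fastforce
      qed
    qed measurable
    then have "?\<delta> \<longlonglongrightarrow> 2 * 0" by (intro ennreal_tendsto_cmult) simp_all
    then have del: "?\<delta> \<longlonglongrightarrow> 0" by simp
    show "?e f \<longlonglongrightarrow> 0"
    proof (rule tendsto_0_approx[OF _ del])
      fix k
      have fs: "integrable M (\<lambda>x. f x - s k x)" using lim by simp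
      have "?e f n \<le> ?e (s k) n + ?\<delta> k" for n
      proof -
        have "?e f n = ?e (\<lambda>x. s k x + (f x - s k x)) n" by simp
        also have "\<dots> \<le> ?e (s k) n + ?e (\<lambda>x. f x - s k x) n"
          by (rule cavg_error_add[OF lim(1) fs sets_bl[OF x0 R]])
        also have "\<dots> \<le> ?e (s k) n + ?\<delta> k"
          by (intro add_left_mono cavg_error_le[OF fs sets_bl[OF x0 R]])
        finally show ?thesis .
      qed
      moreover have "?e (s k) \<longlonglongrightarrow> 0" using lim(5)[of k] x0 R unfolding L1_conv_def by blast
      ultimately show "\<exists>g. g \<longlonglongrightarrow> 0 \<and> (\<forall>n. ?e f n \<le> g n + ?\<delta> k)" by (intro exI[of _ "?e (s k)"]) simp
    qed
  qed
qed

lemma L1_conv_locally_integrable: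
  fixes b :: "'a \<Rightarrow> complex"
  assumes b: "locally_integrable d M b" and x0: "x0 \<in> space M" and R: "0 < R"
  shows "(\<lambda>n. \<integral>\<^sup>+x. indicator (bl x0 R) x * ennreal (cmod (cavg n b x - b x)) \<partial>M) \<longlonglongrightarrow> 0"
proof -
  let ?F' = "bl x0 (A * (R + 1))" 
  define g where "g = (\<lambda>x. indicator ?F' x *\<^sub>R b x)"
  have R': "0 < A * (R + 1)" using A R by simp
  have "set_integrable M ?F' b" using b x0 R' unfolding locally_integrable_def balls_def by blast
  then have "L1_conv g" by (intro L1_conv_integrable) (simp add: g_def set_integrable_def)
  then have lim: "(\<lambda>n. \<integral>\<^sup>+x. indicator (bl x0 R) x * ennreal (cmod (cavg n g x - g x)) \<partial>M) \<longlonglongrightarrow> 0"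
    using x0 R unfolding L1_conv_def by blast
  have "indicator (bl x0 R) x * ennreal (cmod (cavg n b x - b x)) = indicator (bl x0 R) x * ennreal (cmod (cavg n g x - g x))"
    if x: "x \<in> space M" for n x
  proof (cases "x \<in> bl x0 R")
    case True
    have sub: "C n 0 x \<subseteq> ?F'" using cube_near_ball[OF x0 True] by blast
    have "x \<in> ?F'" using sub nested_partitions.cube_self[OF C x, of n 0] by blast
    then have "g x = b x" by (simp add: g_def)
    moreover have "cavg n g x = cavg n b x"
      unfolding ball_avg_def set_lebesgue_integral_def g_def
      using sub by (intro arg_cong[where f = "\<lambda>y. y /\<^sub>R _"] Bochner_Integration.integral_cong) (auto simp: indicator_def)
    ultimately show ?thesis by simp
  qed simp
  then have "(\<integral>\<^sup>+x. indicator (bl x0 R) x * ennreal (cmod (cavg n b x - b x)) \<partial>M)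
      = (\<integral>\<^sup>+x. indicator (bl x0 R) x * ennreal (cmod (cavg n g x - g x)) \<partial>M)" for n
    by (intro nn_integral_cong)
  with lim show ?thesis by simp
qed

end
end


section \<open>Weights and BMO on cubes\<close>

context homogeneous_space
begin

lemma space_eq_UN_balls: "x0 \<in> space M \<Longrightarrow> x \<in> space M \<Longrightarrow> eventually (\<lambda>n. x \<in> bl x0 (real n + 1)) sequentially"
proof -
  assume x: "x \<in> space M"
  obtain N where "d x0 x < real N" using reals_Archimedean2 by blast
  then show ?thesis using x by (auto simp: eventually_sequentially mem_bl intro!: exI[of _ N])
qed

lemma locally_integrable_measurable:
  fixes g :: "'a \<Rightarrow> 'b :: {banach, second_countable_topology}"
  assumes g: "locally_integrable d M g"
  shows "g \<in> borel_measurable M"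
proof (cases "space M = {}")
  case True
  then show ?thesis by (simp add: measurable_def)
next
  case False
  then obtain x0 where x0: "x0 \<in> space M" by blast
  show ?thesis
  proof (rule borel_measurable_LIMSEQ_metric)
    fix n
    have "bl x0 (real n + 1) \<in> balls d M" using x0 unfolding balls_def by force
    then have "set_integrable M (bl x0 (real n + 1)) g" using g by (simp add: locally_integrable_def)
    then show "(\<lambda>x. indicator (bl x0 (real n + 1)) x *\<^sub>R g x) \<in> borel_measurable M"
      unfolding set_integrable_def by (rule borel_measurable_integrable)
  next
    fix x assume x: "x \<in> space M"
    have "eventually (\<lambda>n. indicator (bl x0 (real n + 1)) x *\<^sub>R g x = g x) sequentially"
      using space_eq_UN_balls[OF x0 x] by eventually_elim simp
    then show "(\<lambda>n. indicator (bl x0 (real n + 1)) x *\<^sub>R g x) \<longlonglongrightarrow> g x" by (rule tendsto_eventually)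
  qed
qed

lemma ball_measure:
  assumes "B \<in> balls d M"
  shows "B \<in> sets M" "emeasure M B \<noteq> 0" "emeasure M B \<noteq> top"
  using assms bl_pos bl_fin sets_bl by (auto simp: balls_def)

lemma mean_pos:
  assumes [measurable]: "Q \<in> sets M" "f \<in> borel_measurable M" and Q: "emeasure M Q \<noteq> 0" "emeasure M Q \<noteq> top"
    and f: "AE x in M. f x \<noteq> 0"
  shows "mean M Q f \<noteq> 0"
proof
  assume "mean M Q f = 0"
  then have "(\<integral>\<^sup>+x\<in>Q. f x \<partial>M) = 0" using Q by (simp add: mean_def ennreal_divide_eq_0_iff)
  then have "AE x in M. f x * indicator Q x = 0" by (subst (asm) nn_integral_0_iff_AE) auto
  with f have "AE x in M. x \<notin> Q" by eventually_elim (auto simp: indicator_def split: if_splits)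
  then have "emeasure M Q = 0" by (subst (asm) AE_iff_measurable[of Q]) (use sets.sets_into_space[of Q M] in auto)
  then show False using Q by simp
qed

definition weight :: "('a \<Rightarrow> real) \<Rightarrow> 'a \<Rightarrow> ennreal" where
  "weight lam x = ennreal (lam x)"

definition dual_weight :: "real \<Rightarrow> ('a \<Rightarrow> real) \<Rightarrow> 'a \<Rightarrow> ennreal" where
  "dual_weight p lam x = ennreal (lam x powr (- (1 / (p - 1))))"

lemma Ap_measurable:
  assumes "lam \<in> Ap d M p"
  shows "lam \<in> borel_measurable M" "weight lam \<in> borel_measurable M" "dual_weight p lam \<in> borel_measurable M"
proof -
  show [measurable]: "lam \<in> borel_measurable M"
    using assms locally_integrable_measurable by (auto simp: Ap_def)
  show "weight lam \<in> borel_measurable M" "dual_weight p lam \<in> borel_measurable M"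
    unfolding weight_def[abs_def] dual_weight_def[abs_def] by measurable
qed

lemma Ap_positive:
  assumes "lam \<in> Ap d M p"
  shows "AE x in M. weight lam x \<noteq> 0" "AE x in M. dual_weight p lam x \<noteq> 0"
proof -
  have pos: "AE x in M. 0 < lam x" using assms by (simp add: Ap_def)
  show "AE x in M. weight lam x \<noteq> 0" "AE x in M. dual_weight p lam x \<noteq> 0"
    using pos by (auto elim!: eventually_mono simp: weight_def dual_weight_def)
qed

lemma Ap_ball:
  assumes lam: "lam \<in> Ap d M p" and p: "1 < p" and B: "B \<in> balls d M"
  shows "mean M B (weight lam) * epowr (mean M B (dual_weight p lam)) (p - 1) \<le> Ap_const d M p lam"
    "mean M B (weight lam) \<noteq> top" "mean M B (dual_weight p lam) \<noteq> top"
proof -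
  note meas = Ap_measurable[OF lam] and ball = ball_measure[OF B]
  show le: "mean M B (weight lam) * epowr (mean M B (dual_weight p lam)) (p - 1) \<le> Ap_const d M p lam"
    unfolding Ap_const_def mean_def weight_def dual_weight_def by (rule SUP_upper[OF B])
  have fin: "Ap_const d M p lam < top" using lam by (simp add: Ap_def)
  have "set_integrable M B lam" using lam B by (auto simp: Ap_def locally_integrable_def)
  then have "(\<integral>\<^sup>+x. ennreal (norm (indicator B x *\<^sub>R lam x)) \<partial>M) < top"
    unfolding set_integrable_def integrable_iff_bounded by simp
  moreover have "(\<integral>\<^sup>+x\<in>B. weight lam x \<partial>M) \<le> (\<integral>\<^sup>+x. ennreal (norm (indicator B x *\<^sub>R lam x)) \<partial>M)"
    by (intro nn_integral_mono) (auto simp: weight_def indicator_def intro!: ennreal_leI)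
  ultimately have "(\<integral>\<^sup>+x\<in>B. weight lam x \<partial>M) < top" by (rule le_less_trans[rotated])
  then show "mean M B (weight lam) \<noteq> top" using ball by (auto simp: mean_def ennreal_divide_eq_top_iff)
  have pos: "mean M B (weight lam) \<noteq> 0" by (rule mean_pos[OF ball(1) meas(2) ball(2,3) Ap_positive(1)[OF lam]])
  have "mean M B (weight lam) * epowr (mean M B (dual_weight p lam)) (p - 1) \<noteq> top"
    using le_less_trans[OF le fin] by simp
  then show "mean M B (dual_weight p lam) \<noteq> top" using pos by (auto simp: ennreal_mult_top)
qed

text \<open>
  Averages over a cube are at most \<open>C0\<close> times averages over its envelope, which is a ball.
\<close>
lemma dyadic_Ap_weight:
  assumes "adjacent_systems M K cube env C0" and ball: "\<And>t j x. t < K \<Longrightarrow> x \<in> space M \<Longrightarrow> env t j x \<in> balls d M"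
    and lam: "lam \<in> Ap d M p" and p: "1 < p" and t: "t < K" and ne: "space M \<noteq> {}"
  shows "nested_partitions.dyadic_Ap M (cube t) p (weight lam) (dual_weight p lam) (epowr (ennreal C0) p * Ap_const d M p lam)"
proof -
  interpret adjacent_systems M K cube env C0 by fact
  interpret nested_partitions M "cube t" by (rule grid[OF t])
  let ?w = "weight lam" and ?s = "dual_weight p lam" and ?c = "ennreal C0"
  note meas = Ap_measurable[OF lam]
  have dual: "AE x in M. ?w x * epowr (?s x) (p - 1) = 1"
  proof -
    have "AE x in M. 0 < lam x" using lam by (simp add: Ap_def)
    then show ?thesis
    proof eventually_elim
      case (elim x)
      have "lam x * ((lam x powr (- (1 / (p - 1)))) powr (p - 1)) = lam x * lam x powr (- 1)"
        using p by (simp add: powr_powr)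
      also have "\<dots> = 1" using elim by (simp add: powr_minus)
      finally show ?case using elim by (simp add: weight_def dual_weight_def epowr_ennreal ennreal_mult[symmetric])
    qed
  qed
  have pos: "avg j ?w x \<noteq> 0" "avg j ?s x \<noteq> 0" if x: "x \<in> space M" for j x
    by (rule mean_pos[OF cube_sets[OF x] _ cube_pos[OF x] cube_fin[OF x]]; fact meas Ap_positive[OF lam])+
  have fin: "avg j ?w x \<noteq> top" "avg j ?s x \<noteq> top" if x: "x \<in> space M" for j x
  proof -
    have "avg j g x \<noteq> top" if "mean M (env t j x) g \<noteq> top" for g
      using mean_cube_le_env[OF t x, of j g] that by (auto simp: top_unique ennreal_mult_eq_top_iff)
    then show "avg j ?w x \<noteq> top" "avg j ?s x \<noteq> top"
      using Ap_ball(2,3)[OF lam p ball[OF t x]] by blast+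
  qed
  have W: "avg j ?w x * epowr (avg j ?s x) (p - 1) \<le> epowr ?c p * Ap_const d M p lam" if x: "x \<in> space M" for j x
  proof -
    let ?H = "env t j x"
    have "avg j ?w x * epowr (avg j ?s x) (p - 1) \<le> (?c * mean M ?H ?w) * epowr (?c * mean M ?H ?s) (p - 1)"
      using p by (intro mult_mono epowr_mono mean_cube_le_env t x) auto
    also have "\<dots> = (?c * epowr ?c (p - 1)) * (mean M ?H ?w * epowr (mean M ?H ?s) (p - 1))"
      by (simp only: epowr_mult mult_ac)
    also have "\<dots> \<le> (?c * epowr ?c (p - 1)) * Ap_const d M p lam"
      by (intro mult_left_mono Ap_ball(1)[OF lam p ball[OF t x]]) simp
    also have "?c * epowr ?c (p - 1) = epowr ?c p" using epowr_add[of ?c 1 "p - 1"] by simp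
    finally show ?thesis .
  qed
  obtain x where x: "x \<in> space M" using ne by blast
  have "epowr ?c p * Ap_const d M p lam \<noteq> 0"
    using W[OF x, of 0] pos[OF x, of 0] by (auto simp del: epowr_eq_0 simp: mult_eq_0_iff) auto
  moreover have "epowr ?c p * Ap_const d M p lam \<noteq> top"
    using lam by (auto simp: Ap_def ennreal_mult_eq_top_iff)
  ultimately show ?thesis
    unfolding dyadic_Ap_def using meas dual pos fin W by blast
qed

definition Bloom_weight :: "real \<Rightarrow> ('a \<Rightarrow> real) \<Rightarrow> ('a \<Rightarrow> real) \<Rightarrow> 'a \<Rightarrow> real" where
  "Bloom_weight p lam1 lam2 = (\<lambda>x. lam1 x powr (1 / p) * lam2 x powr (- (1 / p)))"

text \<open>
  Finiteness of the averages of \<open>\<nu>\<close> follows from Young's inequality, which bounds \<open>\<nu>\<close> by the sum of \<open>\<lambda>\<^sub>1\<close>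
  and the dual weight of \<open>\<lambda>\<^sub>2\<close>.
\<close>
lemma Bloom_weight:
  assumes p: "1 < p" and lam1: "lam1 \<in> Ap d M p" and lam2: "lam2 \<in> Ap d M p"
  defines "\<nu> \<equiv> weight (Bloom_weight p lam1 lam2)"
  shows "\<nu> \<in> borel_measurable M" "AE x in M. \<nu> x \<noteq> 0" "AE x in M. epowr (\<nu> x) p * weight lam2 x = weight lam1 x"
    "B \<in> balls d M \<Longrightarrow> mean M B \<nu> \<noteq> top"
proof -
  note [measurable] = Ap_measurable[OF lam1] Ap_measurable[OF lam2]
  show "\<nu> \<in> borel_measurable M" unfolding \<nu>_def weight_def[abs_def] Bloom_weight_def by measurable
  have pos: "AE x in M. 0 < lam1 x \<and> 0 < lam2 x" using lam1 lam2 by (simp add: Ap_def)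
  show "AE x in M. \<nu> x \<noteq> 0" using pos by eventually_elim (simp add: \<nu>_def weight_def Bloom_weight_def)
  show "AE x in M. epowr (\<nu> x) p * weight lam2 x = weight lam1 x"
    using pos
  proof eventually_elim
    case (elim x)
    have "(lam1 x powr (1 / p) * lam2 x powr (- (1 / p))) powr p * lam2 x = lam1 x * (lam2 x powr (- 1) * lam2 x)"
      using elim p by (simp add: powr_mult powr_powr)
    also have "\<dots> = lam1 x" using elim by (simp add: powr_minus)
    finally show ?case using elim by (simp add: \<nu>_def weight_def Bloom_weight_def epowr_ennreal ennreal_mult[symmetric])
  qed
  show "mean M B \<nu> \<noteq> top" if B: "B \<in> balls d M"
  proof -
    define q where "q = p / (p - 1)"
    have pq: "1 / p + 1 / q = 1" using p by (simp add: q_def field_simps)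
    have q: "1 < q" "- (1 / p) * q = - (1 / (p - 1))" using p by (simp_all add: q_def field_simps)
    have "mean M B \<nu> \<le> mean M B (\<lambda>x. weight lam1 x + dual_weight p lam2 x)"
    proof (rule mean_mono)
      fix x assume x: "x \<in> space M"
      have nn: "0 \<le> lam1 x" using lam1 x by (simp add: Ap_def)
      let ?a = "ennreal (lam1 x powr (1 / p))" and ?b = "ennreal (lam2 x powr (- (1 / p)))"
      have "\<nu> x = ?a * ?b" by (simp add: \<nu>_def weight_def Bloom_weight_def ennreal_mult)
      also have "\<dots> \<le> ennreal (1 / p) * epowr ?a p + ennreal (1 / q) * epowr ?b q" by (rule Young_ennreal[OF p pq])
      also have "\<dots> \<le> 1 * epowr ?a p + 1 * epowr ?b q"
        using p q by (intro add_mono mult_right_mono) auto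
      also have "epowr ?a p = weight lam1 x" using p nn by (simp add: weight_def epowr_ennreal powr_powr)
      also have "epowr ?b q = dual_weight p lam2 x" by (simp only: dual_weight_def epowr_ennreal powr_ge_zero powr_powr q(2))
      finally show "\<nu> x \<le> weight lam1 x + dual_weight p lam2 x" by simp
    qed
    also have "\<dots> = mean M B (weight lam1) + mean M B (dual_weight p lam2)"
      by (rule mean_add[OF ball_measure(1)[OF B] Ap_measurable(2)[OF lam1] Ap_measurable(3)[OF lam2]])
    also have "\<dots> < top" using Ap_ball(2)[OF lam1 p B] Ap_ball(3)[OF lam2 p B] by (simp add: less_top)
    finally show ?thesis by simp
  qed
qed

text \<open>
  The mean oscillation on a cube is at most twice the mean deviation from the average over the
  envelope. The bound involves \<open>\<nu>\<close> on the envelope, not on the cube.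
\<close>
lemma BMO_cube:
  assumes "adjacent_systems M K cube env C0" and ball: "\<And>t j x. t < K \<Longrightarrow> x \<in> space M \<Longrightarrow> env t j x \<in> balls d M"
    and b: "b \<in> BMO d M nu" and nu [measurable]: "weight nu \<in> borel_measurable M" and nu0: "AE x in M. weight nu x \<noteq> 0"
    and nufin: "\<And>B. B \<in> balls d M \<Longrightarrow> mean M B (weight nu) \<noteq> top"
    and t: "t < K" and x: "x \<in> space M"
  shows "mean M (cube t l x) (\<lambda>y. ennreal (cmod (b y - ball_avg M b (cube t l y)))) \<le> ennreal (2 * C0) * BMO_norm d M nu b * mean M (env t l x) (weight nu)"
    and "j \<le> i \<Longrightarrow> ennreal (cmod (ball_avg M b (cube t j x) - ball_avg M b (cube t i x)))
      \<le> mean M (cube t j x) (\<lambda>y. ennreal (cmod (b y - ball_avg M b (cube t i y))))"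
proof -
  interpret adjacent_systems M K cube env C0 by fact
  interpret nested_partitions M "cube t" by (rule grid[OF t])
  have bloc: "locally_integrable d M b" using b by (simp add: BMO_def)
  have [measurable]: "b \<in> borel_measurable M" by (rule locally_integrable_measurable[OF bloc])
  have int: "set_integrable M (cube t l z) b" if z: "z \<in> space M" for l z
    by (rule set_integrable_subset[OF _ cube_sets[OF z] cube_env[OF t z]])
      (use bloc ball[OF t z] in \<open>auto simp: locally_integrable_def\<close>)
  have diff_le: "ennreal (cmod (ball_avg M b (cube t l z) - c)) \<le> mean M (cube t l z) (\<lambda>y. ennreal (cmod (b y - c)))"
    if z: "z \<in> space M" for l z c
  proof -
    have const: "set_integrable M (cube t l z) (\<lambda>y. c)" by (rule set_integrable_const[OF cube_sets[OF z] cube_fin[OF z]])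
    have "ball_avg M b (cube t l z) - c = ball_avg M (\<lambda>y. b y - c) (cube t l z)"
      using ball_avg_diff[OF int[OF z] const] ball_avg_const[OF cube_sets[OF z] cube_pos[OF z] cube_fin[OF z]] by simp
    then show ?thesis
      using norm_ball_avg_le[OF cube_sets[OF z] cube_pos[OF z] cube_fin[OF z] set_integral_diff(1)[OF int[OF z] const]] by simp
  qed
  show "ennreal (cmod (ball_avg M b (cube t j x) - ball_avg M b (cube t i x)))
      \<le> mean M (cube t j x) (\<lambda>y. ennreal (cmod (b y - ball_avg M b (cube t i y))))" if "j \<le> i"
  proof -
    have "mean M (cube t j x) (\<lambda>y. ennreal (cmod (b y - ball_avg M b (cube t i y))))
        = mean M (cube t j x) (\<lambda>y. ennreal (cmod (b y - ball_avg M b (cube t i x))))"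
      by (rule mean_cong) (simp add: cube_eq_above[OF x _ that])
    then show ?thesis using diff_le[OF x, of j "ball_avg M b (cube t i x)"] by simp
  qed
  let ?Q = "cube t l x" and ?H = "env t l x"
  let ?h = "ball_avg M b ?H"
  note H = ball_measure[OF ball[OF t x, of l]]
  have Q: "?Q \<in> sets M" by (rule cube_sets[OF x])
  have "mean M ?Q (\<lambda>y. ennreal (cmod (b y - ball_avg M b (cube t l y)))) = mean M ?Q (\<lambda>y. ennreal (cmod (b y - ball_avg M b ?Q)))"
    by (rule mean_cong) (simp add: cube_eq[OF x])
  also have "\<dots> \<le> mean M ?Q (\<lambda>y. ennreal (cmod (b y - ?h)) + ennreal (cmod (ball_avg M b ?Q - ?h)))"
  proof (rule mean_mono)
    fix y
    have "cmod (b y - ball_avg M b ?Q) \<le> cmod (b y - ?h) + cmod (ball_avg M b ?Q - ?h)"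
      using norm_triangle_ineq4[of "b y - ?h" "ball_avg M b ?Q - ?h"] by simp
    then show "ennreal (cmod (b y - ball_avg M b ?Q)) \<le> ennreal (cmod (b y - ?h)) + ennreal (cmod (ball_avg M b ?Q - ?h))"
      by (simp add: ennreal_leI flip: ennreal_plus)
  qed
  also have "\<dots> = mean M ?Q (\<lambda>y. ennreal (cmod (b y - ?h))) + ennreal (cmod (ball_avg M b ?Q - ?h))"
    using Q x by (simp add: mean_add avg_const)
  also have "\<dots> \<le> mean M ?Q (\<lambda>y. ennreal (cmod (b y - ?h))) + mean M ?Q (\<lambda>y. ennreal (cmod (b y - ?h)))"
    by (intro add_left_mono diff_le x)
  also have "\<dots> = 2 * mean M ?Q (\<lambda>y. ennreal (cmod (b y - ?h)))" by (simp add: mult_2)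
  also have "\<dots> \<le> 2 * (ennreal C0 * mean M ?H (\<lambda>y. ennreal (cmod (b y - ?h))))"
    by (intro mult_left_mono mean_cube_le_env t x) simp
  also have "\<dots> \<le> 2 * (ennreal C0 * (BMO_norm d M nu b * mean M ?H (weight nu)))"
  proof (intro mult_left_mono)
    let ?N = "\<integral>\<^sup>+y\<in>?H. weight nu y \<partial>M" and ?I = "\<integral>\<^sup>+y\<in>?H. ennreal (cmod (b y - ?h)) \<partial>M"
    have "mean M ?H (weight nu) \<noteq> 0" by (rule mean_pos[OF H(1) nu H(2,3) nu0])
    then have N: "?N \<noteq> 0" "?N \<noteq> top"
      using nufin[OF ball[OF t x], of l] H by (auto simp: mean_def ennreal_top_divide)
    have "?I / ?N \<le> BMO_norm d M nu b"
      unfolding BMO_norm_def weight_def by (rule SUP_upper[OF ball[OF t x]])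
    then have "?I / ?N * ?N \<le> BMO_norm d M nu b * ?N" by (rule mult_right_mono) simp
    then have "?I \<le> BMO_norm d M nu b * ?N" unfolding ennreal_mult_divide_cancel(2)[OF N] .
    then show "mean M ?H (\<lambda>y. ennreal (cmod (b y - ?h))) \<le> BMO_norm d M nu b * mean M ?H (weight nu)"
      unfolding mean_def by (simp only: ennreal_times_divide divide_right_mono_ennreal)
  qed auto
  also have "\<dots> = ennreal (2 * C0) * BMO_norm d M nu b * mean M ?H (weight nu)"
    using C0 by (simp add: ennreal_mult mult.assoc)
  finally show "mean M ?Q (\<lambda>y. ennreal (cmod (b y - ball_avg M b (cube t l y)))) \<le> ennreal (2 * C0) * BMO_norm d M nu b * mean M ?H (weight nu)" .
qed

text \<open>
  Choose the subsequence so that the errors on the balls \<open>B(x\<^sub>0, k + 1)\<close> are summable; these balls exhaust the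
  space.
\<close>
lemma AE_subsequence:
  fixes err :: "nat \<Rightarrow> 'a \<Rightarrow> ennreal"
  assumes [measurable]: "\<And>n. err n \<in> borel_measurable M" and x0: "x0 \<in> space M"
    and lim: "\<And>R. 0 < R \<Longrightarrow> (\<lambda>n. \<integral>\<^sup>+x. indicator (bl x0 R) x * err n x \<partial>M) \<longlonglongrightarrow> 0"
  shows "\<exists>r. (\<forall>k. k \<le> r k) \<and> (AE x in M. (\<lambda>k. err (r k) x) \<longlonglongrightarrow> 0)"
proof -
  have "\<exists>n\<ge>k. (\<integral>\<^sup>+x. indicator (bl x0 (real k + 1)) x * err n x \<partial>M) < ennreal ((1 / 2) ^ k)" for k
  proof -
    have "eventually (\<lambda>n. (\<integral>\<^sup>+x. indicator (bl x0 (real k + 1)) x * err n x \<partial>M) < ennreal ((1 / 2) ^ k)) sequentially"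
      by (rule order_tendstoD(2)[OF lim]) auto
    then show ?thesis using eventually_ge_at_top[of k] by (auto dest: eventually_happens' eventually_conj simp: eventually_sequentially) (meson linear order_trans)
  qed
  then obtain r where r: "\<And>k. k \<le> r k" "\<And>k. (\<integral>\<^sup>+x. indicator (bl x0 (real k + 1)) x * err (r k) x \<partial>M) < ennreal ((1 / 2) ^ k)"
    by metis
  have [measurable]: "bl x0 (real k + 1) \<in> sets M" for k by (rule sets_bl[OF x0]) simp
  have "(\<integral>\<^sup>+x. (\<Sum>k. indicator (bl x0 (real k + 1)) x * err (r k) x) \<partial>M) = (\<Sum>k. \<integral>\<^sup>+x. indicator (bl x0 (real k + 1)) x * err (r k) x \<partial>M)"
    by (rule nn_integral_suminf) measurable
  also have "\<dots> \<le> (\<Sum>k. ennreal ((1 / 2) ^ k))"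
    by (intro suminf_le) (use r in \<open>auto simp: less_imp_le\<close>)
  also have "\<dots> = ennreal (\<Sum>k. (1 / 2) ^ k)" by (intro suminf_ennreal2 summable_geometric) auto
  also have "\<dots> < top" by simp
  finally have "(\<integral>\<^sup>+x. (\<Sum>k. indicator (bl x0 (real k + 1)) x * err (r k) x) \<partial>M) \<noteq> \<infinity>" by simp
  then have "AE x in M. (\<Sum>k. indicator (bl x0 (real k + 1)) x * err (r k) x) \<noteq> \<infinity>"
    by (intro nn_integral_noteq_infinite) auto
  then have "AE x in M. (\<lambda>k. err (r k) x) \<longlonglongrightarrow> 0"
  proof (rule AE_mp, intro AE_I2 impI)
    fix x assume x: "x \<in> space M" and fin: "(\<Sum>k. indicator (bl x0 (real k + 1)) x * err (r k) x) \<noteq> \<infinity>"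
    let ?a = "\<lambda>k. indicator (bl x0 (real k + 1)) x * err (r k) x"
    have afin: "?a k \<noteq> top" for k
    proof
      assume "?a k = top"
      then have "(\<Sum>i\<in>{k}. ?a i) = top" by simp
      then have "(\<Sum>k. ?a k) = top" using sum_le_suminf[of ?a "{k}"] by (simp add: top_unique)
      then show False using fin by simp
    qed
    have eq: "?a k = ennreal (enn2real (?a k))" for k using afin[of k] by (simp add: less_top)
    have "summable (\<lambda>k. enn2real (?a k))"
      by (rule summable_suminf_not_top) (use fin eq in \<open>auto simp flip: eq\<close>)
    then have "(\<lambda>k. enn2real (?a k)) \<longlonglongrightarrow> 0" by (rule summable_LIMSEQ_zero)
    then have "(\<lambda>k. ennreal (enn2real (?a k))) \<longlonglongrightarrow> ennreal 0" by (rule tendsto_ennrealI)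
    then have "?a \<longlonglongrightarrow> 0" by (simp flip: eq)
    moreover have "eventually (\<lambda>k. ?a k = err (r k) x) sequentially"
      using space_eq_UN_balls[OF x0 x] by eventually_elim simp
    ultimately show "(\<lambda>k. err (r k) x) \<longlonglongrightarrow> 0" by (simp cong: filterlim_cong)
  qed
  then show ?thesis using r(1) by blast
qed

end


section \<open>The maximal commutator as a limit of dyadic models\<close>

lemma liminf_mult_const_le:
  fixes f :: "nat \<Rightarrow> ennreal" and c :: ennreal
  assumes c: "c \<noteq> top"
  shows "liminf f * c \<le> liminf (\<lambda>k. f k * c)"
proof (cases "c = 0")
  case False
  have less: "y / c < u \<longleftrightarrow> y < u * c" for y u
  proof -
    have "u \<le> y / c \<longleftrightarrow> u * c \<le> y"
    proof
      assume "u \<le> y / c"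
      then have "u * c \<le> y / c * c" by (rule mult_right_mono) simp
      then show "u * c \<le> y" unfolding ennreal_mult_divide_cancel(2)[OF False c] .
    next
      assume "u * c \<le> y"
      then have "u * c / c \<le> y / c" by (rule divide_right_mono_ennreal)
      then show "u \<le> y / c" unfolding ennreal_mult_divide_cancel(3)[OF False c] .
    qed
    then show ?thesis by (simp flip: not_le)
  qed
  show ?thesis
    unfolding le_Liminf_iff less[symmetric]
    using less_LiminfD[of _ sequentially f] by blast
qed simp

context homogeneous_space
begin

lemma scale_ratio_ge: "32 \<le> scale_ratio"
  using A_le_powers(4) by (simp add: scale_ratio_def)

text \<open>
  Normalized so that the cubes of the finest level have diameter at most \<open>scale_ratio\<^sup>-\<^sup>n\<close>.
\<close>
definition "fine_scale n = 1 / (4 * A\<^sup>2) * (1 / scale_ratio) ^ n"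

lemma fine_scale_pos: "0 < fine_scale n"
  using A scale_ratio_ge by (simp add: fine_scale_def)

lemma fine_scale_tendsto: "(\<lambda>n. 4 * A\<^sup>2 * fine_scale n) \<longlonglongrightarrow> 0" "4 * A\<^sup>2 * fine_scale n \<le> 1"
proof -
  have eq: "4 * A\<^sup>2 * fine_scale n = (1 / scale_ratio) ^ n" for n using A by (simp add: fine_scale_def)
  show "(\<lambda>n. 4 * A\<^sup>2 * fine_scale n) \<longlonglongrightarrow> 0"
    unfolding eq using scale_ratio_ge by (intro LIMSEQ_power_zero) simp
  show "4 * A\<^sup>2 * fine_scale n \<le> 1"
    unfolding eq using scale_ratio_ge by (intro power_le_one) auto
qed

text \<open>
  The scales of the levels \<open>0, \<dots>, 2 n\<close> run from about \<open>scale_ratio\<^sup>-\<^sup>n\<close> to about \<open>scale_ratio\<^sup>n\<close>, so every radius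
  is reached from some \<open>n\<close> on.
\<close>
lemma level_of_radius:
  assumes "0 < s"
  shows "eventually (\<lambda>n. \<exists>j\<le>2 * n. fine_scale n * scale_ratio ^ j / scale_ratio < s \<and> s \<le> fine_scale n * scale_ratio ^ j) sequentially"
proof -
  let ?D = scale_ratio
  have D: "1 < ?D" "0 < ?D" using scale_ratio_ge by auto
  have c: "0 < 4 * A\<^sup>2" using A by simp
  obtain N where N: "4 * A\<^sup>2 * s < ?D ^ N" using real_arch_pow[OF D(1)] by blast
  have "(\<lambda>n. 4 * A\<^sup>2 * fine_scale n) \<longlonglongrightarrow> 0" by (rule fine_scale_tendsto)
  then have "eventually (\<lambda>n. 4 * A\<^sup>2 * fine_scale n < 4 * A\<^sup>2 * s) sequentially"
    by (rule order_tendstoD(2)) (use assms c in simp)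
  then show ?thesis
    using eventually_ge_at_top[of N]
  proof eventually_elim
    case (elim n)
    have small: "fine_scale n < s" using elim(1) c by simp
    have "?D ^ N \<le> ?D ^ n" using elim(2) D by (intro power_increasing) auto
    then have "4 * A\<^sup>2 * s \<le> ?D ^ n" using N by simp
    also have "\<dots> = 4 * A\<^sup>2 * (fine_scale n * ?D ^ (2 * n))"
      using c D by (simp add: fine_scale_def power_mult_distrib power_one_over mult_2 power_add)
    finally have top: "s \<le> fine_scale n * ?D ^ (2 * n)" using c by simp
    define j where "j = (LEAST j. s \<le> fine_scale n * ?D ^ j)"
    have j: "s \<le> fine_scale n * ?D ^ j" unfolding j_def by (rule LeastI[of "\<lambda>j. s \<le> fine_scale n * ?D ^ j", OF top])
    have le: "j \<le> 2 * n" unfolding j_def by (rule Least_le[of "\<lambda>j. s \<le> fine_scale n * ?D ^ j", OF top])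
    obtain i where i: "j = Suc i" using j small by (cases j) auto
    have "\<not> s \<le> fine_scale n * ?D ^ i" using not_less_Least[of i "\<lambda>j. s \<le> fine_scale n * ?D ^ j"] i by (simp add: j_def)
    then have "fine_scale n * ?D ^ j / ?D < s" using D by (simp add: i)
    then show ?case using j le by blast
  qed
qed

lemma operator_norm_le:
  assumes "\<And>f. f \<in> borel_measurable M \<Longrightarrow> Lp_norm M p w2 (S f) \<le> C * wnorm M p (weight w1) (\<lambda>x. ennreal (cmod (f x)))"
    and [measurable]: "weight w1 \<in> borel_measurable M"
  shows "operator_norm M p w1 w2 S \<le> C"
  unfolding operator_norm_def
proof (rule Inf_lower, safe)
  fix f assume "f \<in> Lp M p w1"
  then have f [measurable]: "f \<in> borel_measurable M" by (simp add: Lp_def)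
  have "Lp_norm M p w1 (\<lambda>x. ennreal (cmod (f x))) = wnorm M p (weight w1) (\<lambda>x. ennreal (cmod (f x)))"
    unfolding Lp_norm_def wnorm_def weight_def[symmetric] by (subst upper_integral_eq_nn_integral) measurable
  then show "Lp_norm M p w2 (S f) \<le> C * Lp_norm M p w1 (\<lambda>x. ennreal (cmod (f x)))"
    using assms(1)[OF f] by simp
qed

text \<open>
  Fatou's lemma for the upper integral, which needs a measurable majorant at every point. On the
  exceptional null set the majorant is infinite.
\<close>
lemma Lp_norm_le_liminf:
  assumes p: "0 < p" and [measurable]: "weight w \<in> borel_measurable M" "\<And>k. H k \<in> borel_measurable M"
    and le: "AE x in M. g x \<le> liminf (\<lambda>k. H k x)"
    and bound: "\<And>k. wnorm M p (weight w) (H k) \<le> R"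
  shows "Lp_norm M p w g \<le> R"
proof -
  obtain N where N: "{x \<in> space M. \<not> g x \<le> liminf (\<lambda>k. H k x)} \<subseteq> N" "N \<in> null_sets M"
    using le unfolding eventually_ae_filter by blast
  have [measurable]: "N \<in> sets M" using N by auto
  define h where "h x = epowr (liminf (\<lambda>k. H k x)) p * weight w x + top * indicator N x" for x
  have [measurable]: "h \<in> borel_measurable M" unfolding h_def by measurable
  have dom: "epowr (g x) p * ennreal (w x) \<le> h x" if "x \<in> space M" for x
  proof (cases "x \<in> N")
    case False
    then have "epowr (g x) p \<le> epowr (liminf (\<lambda>k. H k x)) p" using N that p by (intro epowr_mono) auto
    then show ?thesis using False by (simp add: h_def weight_def mult_right_mono)
  qed (simp add: h_def)
  have "upper_integral M (\<lambda>x. epowr (g x) p * ennreal (w x)) \<le> (\<integral>\<^sup>+x. h x \<partial>M)"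
    unfolding upper_integral_def by (rule INF_lower) (use dom in auto)
  also have "\<dots> = (\<integral>\<^sup>+x. epowr (liminf (\<lambda>k. H k x)) p * weight w x \<partial>M)"
    using AE_not_in[OF N(2)] by (intro nn_integral_cong_AE) (auto elim!: eventually_mono simp: h_def)
  also have "\<dots> \<le> (\<integral>\<^sup>+x. liminf (\<lambda>k. epowr (H k x) p * weight w x) \<partial>M)"
  proof (rule nn_integral_mono)
    fix x
    have "epowr (liminf (\<lambda>k. H k x)) p * weight w x \<le> liminf (\<lambda>k. epowr (H k x) p) * weight w x"
      by (intro mult_right_mono epowr_liminf_le p) simp
    also have "\<dots> \<le> liminf (\<lambda>k. epowr (H k x) p * weight w x)"
      by (rule liminf_mult_const_le) (simp add: weight_def)
    finally show "epowr (liminf (\<lambda>k. H k x)) p * weight w x \<le> liminf (\<lambda>k. epowr (H k x) p * weight w x)" .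
  qed
  also have "\<dots> \<le> liminf (\<lambda>k. \<integral>\<^sup>+x. epowr (H k x) p * weight w x \<partial>M)"
    by (rule nn_integral_liminf) measurable
  also have "\<dots> \<le> liminf (\<lambda>k. epowr R p)"
  proof (rule Liminf_mono, rule always_eventually, rule allI)
    fix k
    show "(\<integral>\<^sup>+x. epowr (H k x) p * weight w x \<partial>M) \<le> epowr R p"
      using bound[of k] p epowr_inverse[of "1 / p" "\<integral>\<^sup>+x. epowr (H k x) p * weight w x \<partial>M" R] by (simp add: wnorm_def)
  qed
  also have "\<dots> = epowr R p" by (rule Liminf_const) simp
  finally have "epowr (upper_integral M (\<lambda>x. epowr (g x) p * ennreal (w x))) (1 / p) \<le> epowr (epowr R p) (1 / p)"
    using p by (intro epowr_mono) auto
  then show ?thesis using p by (simp add: Lp_norm_def epowr_epowr)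
qed

text \<open>
  Fatou's lemma on a fixed ball, applied to the approximations \<open>a k t\<close> of \<open>b\<close>. The system \<open>t\<close> whose cube
  covers the ball may change with \<open>k\<close>, so all of them have to converge at once.
\<close>
lemma max_commutator_le_liminf:
  fixes b f :: "'a \<Rightarrow> complex" and a :: "nat \<Rightarrow> nat \<Rightarrow> 'a \<Rightarrow> complex"
  assumes [measurable]: "b \<in> borel_measurable M" "f \<in> borel_measurable M" "\<And>k t. t < K \<Longrightarrow> a k t \<in> borel_measurable M"
    and conv: "AE y in M. (\<lambda>k. \<Sum>t<K. ennreal (cmod (a k t y - b y))) \<longlonglongrightarrow> 0"
    and x: "(\<lambda>k. \<Sum>t<K. ennreal (cmod (a k t x - b x))) \<longlonglongrightarrow> 0"
    and dom: "\<And>B. B \<in> balls d M \<Longrightarrow> x \<in> B \<Longrightarrow> eventually (\<lambda>k. \<exists>t<K.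
       mean M B (\<lambda>y. ennreal (cmod (a k t x - a k t y)) * ennreal (cmod (f y))) \<le> H k) sequentially"
  shows "max_commutator d M b f x \<le> liminf H"
  unfolding max_commutator_def
proof (rule SUP_least, safe)
  fix B assume B: "B \<in> balls d M" "x \<in> B"
  note ball = ball_measure[OF B(1)]
  have [measurable]: "B \<in> sets M" by (rule ball)
  let ?m = "\<lambda>c t. mean M B (\<lambda>y. ennreal (cmod (c t x - c t y)) * ennreal (cmod (f y)))"
  obtain N where N: "\<And>k. N \<le> k \<Longrightarrow> \<exists>t<K. ?m (a k) t \<le> H k"
    using dom[OF B] by (auto simp: eventually_sequentially)
  then obtain \<tau> where \<tau>: "\<And>k. N \<le> k \<Longrightarrow> \<tau> k < K" "\<And>k. N \<le> k \<Longrightarrow> ?m (a k) (\<tau> k) \<le> H k" by metis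
  have K: "0 < K" using \<tau>(1)[of N] by auto
  \<comment> \<open>Before \<open>N\<close> no system is chosen, and any index below \<open>K\<close> will do.\<close>
  define c where "c k = a k (if N \<le> k then \<tau> k else 0)" for k
  have [measurable]: "c k \<in> borel_measurable M" for k using \<tau>(1)[of k] K by (auto simp: c_def)
  have lim: "(\<lambda>k. c k y) \<longlonglongrightarrow> b y" if "(\<lambda>k. \<Sum>t<K. ennreal (cmod (a k t y - b y))) \<longlonglongrightarrow> 0" for y
  proof -
    have "ennreal (cmod (c k y - b y)) \<le> (\<Sum>t<K. ennreal (cmod (a k t y - b y)))" for k
      unfolding c_def using \<tau>(1)[of k] K
      by (intro member_le_sum[of _ "{..<K}" "\<lambda>t. ennreal (cmod (a k t y - b y))"]) auto
    then have "(\<lambda>k. ennreal (cmod (c k y - b y))) \<longlonglongrightarrow> 0"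
      by (intro tendsto_sandwich[OF _ _ tendsto_const that]) auto
    then have "(\<lambda>k. ennreal (cmod (c k y - b y))) \<longlonglongrightarrow> ennreal 0" by simp
    then have "(\<lambda>k. cmod (c k y - b y)) \<longlonglongrightarrow> 0" by (subst (asm) tendsto_ennreal_iff) auto
    then show ?thesis by (simp add: LIM_zero_iff tendsto_norm_zero_iff)
  qed
  have fatou: "(\<integral>\<^sup>+y\<in>B. ennreal (cmod (b x - b y) * cmod (f y)) \<partial>M)
      \<le> (\<integral>\<^sup>+y. liminf (\<lambda>k. ennreal (cmod (c k x - c k y)) * ennreal (cmod (f y)) * indicator B y) \<partial>M)"
  proof (rule nn_integral_mono_AE)
    show "AE y in M. ennreal (cmod (b x - b y) * cmod (f y)) * indicator B y
        \<le> liminf (\<lambda>k. ennreal (cmod (c k x - c k y)) * ennreal (cmod (f y)) * indicator B y)"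
      using conv
    proof eventually_elim
      case (elim y)
      have "(\<lambda>k. ennreal (cmod (c k x - c k y) * (cmod (f y) * indicator B y))) \<longlonglongrightarrow> ennreal (cmod (b x - b y) * (cmod (f y) * indicator B y))"
        by (intro tendsto_ennrealI tendsto_intros lim x elim)
      moreover have "ennreal (cmod (c k x - c k y) * (cmod (f y) * indicator B y)) = ennreal (cmod (c k x - c k y)) * ennreal (cmod (f y)) * indicator B y" for k
        by (auto simp: indicator_def ennreal_mult)
      moreover have "ennreal (cmod (b x - b y) * (cmod (f y) * indicator B y)) = ennreal (cmod (b x - b y) * cmod (f y)) * indicator B y"
        by (auto simp: indicator_def)
      ultimately have "(\<lambda>k. ennreal (cmod (c k x - c k y)) * ennreal (cmod (f y)) * indicator B y) \<longlonglongrightarrow> ennreal (cmod (b x - b y) * cmod (f y)) * indicator B y"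
        by simp
      then show ?case by (simp add: lim_imp_Liminf)
    qed
  qed
  also have "\<dots> \<le> liminf (\<lambda>k. \<integral>\<^sup>+y. ennreal (cmod (c k x - c k y)) * ennreal (cmod (f y)) * indicator B y \<partial>M)"
    by (rule nn_integral_liminf) measurable
  also have "\<dots> \<le> liminf (\<lambda>k. H k * emeasure M B)"
  proof (rule Liminf_mono)
    show "eventually (\<lambda>k. (\<integral>\<^sup>+y. ennreal (cmod (c k x - c k y)) * ennreal (cmod (f y)) * indicator B y \<partial>M) \<le> H k * emeasure M B) sequentially"
      using eventually_ge_at_top[of N]
    proof eventually_elim
      case (elim k)
      have "(\<integral>\<^sup>+y. ennreal (cmod (c k x - c k y)) * ennreal (cmod (f y)) * indicator B y \<partial>M) / emeasure M B \<le> H k"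
        using \<tau>(2)[OF elim] elim by (simp add: mean_def c_def)
      then have "(\<integral>\<^sup>+y. ennreal (cmod (c k x - c k y)) * ennreal (cmod (f y)) * indicator B y \<partial>M) / emeasure M B * emeasure M B \<le> H k * emeasure M B"
        by (rule mult_right_mono) simp
      then show ?case unfolding ennreal_mult_divide_cancel(2)[OF ball(2,3)] .
    qed
  qed
  finally have "(\<integral>\<^sup>+y\<in>B. ennreal (cmod (b x - b y) * cmod (f y)) \<partial>M) * (1 / emeasure M B) \<le> liminf (\<lambda>k. H k * emeasure M B) * (1 / emeasure M B)"
    by (rule mult_right_mono) simp
  also have "\<dots> \<le> liminf (\<lambda>k. H k * emeasure M B * (1 / emeasure M B))"
    by (rule liminf_mult_const_le) (use ball in \<open>simp add: ennreal_divide_eq_top_iff\<close>)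
  also have "(\<lambda>k. H k * emeasure M B * (1 / emeasure M B)) = H"
    using ball by (simp add: ennreal_times_divide ennreal_mult_divide_cancel)
  finally show "(\<integral>\<^sup>+y\<in>B. ennreal (cmod (b x - b y) * cmod (f y)) \<partial>M) / emeasure M B \<le> liminf H"
    by (simp add: ennreal_times_divide)
qed

definition const_total :: "nat \<Rightarrow> real \<Rightarrow> real \<Rightarrow> ennreal" where
  "const_total K C0 p = ennreal C0 * (epowr (of_nat K) (1 / p) * of_nat K) * adjacent_systems.const_commutator K C0 p
     * epowr (epowr (ennreal C0) p * epowr (ennreal C0) p) (max 1 (1 / (p - 1))) * ennreal (2 * C0)"

text \<open>
  For each \<open>n\<close>, the dyadic model at scale \<open>fine_scale n\<close> is bounded uniformly, and along a subsequence its
  lower limit dominates the maximal commutator almost everywhere.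
\<close>
lemma maximal_commutator_operator_norm:
  fixes cube env :: "nat \<Rightarrow> nat \<Rightarrow> nat \<Rightarrow> 'a \<Rightarrow> 'a set" and b :: "'a \<Rightarrow> complex"
  assumes adj: "\<And>n. adjacent_systems M K (cube n) (env n) C0"
    and small: "\<And>n t x y. t < K \<Longrightarrow> x \<in> space M \<Longrightarrow> y \<in> cube n t 0 x \<Longrightarrow> d x y < 4 * A\<^sup>2 * fine_scale n"
    and ball: "\<And>n t x j. t < K \<Longrightarrow> x \<in> space M \<Longrightarrow> env n t j x \<in> balls d M"
    and cover: "\<And>n z j s. z \<in> space M \<Longrightarrow> fine_scale n * scale_ratio ^ j / scale_ratio < s \<Longrightarrow> s \<le> fine_scale n * scale_ratio ^ j \<Longrightarrow>
        \<exists>t<K. \<forall>x\<in>bl z s. bl z s \<subseteq> cube n t (Suc j) x \<and> emeasure M (cube n t (Suc j) x) \<le> ennreal C0 * emeasure M (bl z s)"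
    and p: "1 < p" and ne: "space M \<noteq> {}"
    and lam1: "lam1 \<in> Ap d M p" and lam2: "lam2 \<in> Ap d M p"
    and b: "b \<in> BMO d M (Bloom_weight p lam1 lam2)"
  shows "operator_norm M p lam1 lam2 (max_commutator d M b)
    \<le> const_total K C0 p * epowr (Ap_const d M p lam1 * Ap_const d M p lam2) (max 1 (1 / (p - 1))) * BMO_norm d M (Bloom_weight p lam1 lam2) b"
    (is "_ \<le> ?bound")
proof (rule operator_norm_le[OF _ Ap_measurable(2)[OF lam1]])
  fix f :: "'a \<Rightarrow> complex" assume f [measurable]: "f \<in> borel_measurable M"
  obtain x0 where x0: "x0 \<in> space M" using ne by blast
  have C0: "1 \<le> C0" using adjacent_systems.C0[OF adj] .
  have bloc: "locally_integrable d M b" using b by (simp add: BMO_def)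
  have bm [measurable]: "b \<in> borel_measurable M" by (rule locally_integrable_measurable[OF bloc])
  let ?\<nu> = "Bloom_weight p lam1 lam2" and ?e = "max 1 (1 / (p - 1))" and ?\<phi> = "\<lambda>y. ennreal (cmod (f y))"
  note Bw = Bloom_weight[OF p lam1 lam2]
  define a where "a n t x = ball_avg M b (cube n t 0 x)" for n t x
  have grid: "nested_partitions M (cube n t)" if "t < K" for n t using adjacent_systems.grid[OF adj that] .
  have am [measurable]: "a n t \<in> borel_measurable M" if "t < K" for n t
    unfolding a_def[abs_def]
    by (rule nested_partitions.adapted_measurable[OF grid[OF that] nested_partitions.adapted_cube[OF grid[OF that]]]) auto
  define err where "err n x = (\<Sum>t<K. ennreal (cmod (a n t x - b x)))" for n x
  have errm: "err n \<in> borel_measurable M" for n unfolding err_def[abs_def] by measurable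
  have "\<exists>r. (\<forall>k. k \<le> r k) \<and> (AE x in M. (\<lambda>k. err (r k) x) \<longlonglongrightarrow> 0)"
  proof (rule AE_subsequence[OF errm x0])
    fix R :: real assume R: "0 < R"
    have [measurable]: "bl x0 R \<in> sets M" by (rule sets_bl[OF x0 R])
    have each: "(\<lambda>n. \<integral>\<^sup>+x. indicator (bl x0 R) x * ennreal (cmod (a n t x - b x)) \<partial>M) \<longlonglongrightarrow> 0" if t: "t < K" for t
      unfolding a_def
      by (rule L1_conv_locally_integrable[where C = "\<lambda>n. cube n t", OF grid[OF t] small[OF t] fine_scale_tendsto bloc x0 R])
    have "(\<lambda>n. \<Sum>t<K. \<integral>\<^sup>+x. indicator (bl x0 R) x * ennreal (cmod (a n t x - b x)) \<partial>M) \<longlonglongrightarrow> (\<Sum>t<K. 0)"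
      by (intro tendsto_sum each) simp
    moreover have "(\<Sum>t<K. \<integral>\<^sup>+x. indicator (bl x0 R) x * ennreal (cmod (a n t x - b x)) \<partial>M) = (\<integral>\<^sup>+x. indicator (bl x0 R) x * err n x \<partial>M)" for n
      unfolding err_def sum_distrib_left by (rule nn_integral_sum[symmetric]) (use am in measurable)
    ultimately show "(\<lambda>n. \<integral>\<^sup>+x. indicator (bl x0 R) x * err n x \<partial>M) \<longlonglongrightarrow> 0" by simp
  qed
  then obtain r where r: "\<And>k. k \<le> r k" and conv: "AE x in M. (\<lambda>k. err (r k) x) \<longlonglongrightarrow> 0" by blast
  have r_top: "filterlim r at_top sequentially"
    by (rule filterlim_at_top_mono[OF filterlim_ident]) (use r in auto)
  \<comment> \<open>Levels up to \<open>Suc (2 n)\<close>: a ball of the scale of level \<open>j \<le> 2 n\<close> is covered by a cube of level \<open>Suc j\<close>.\<close>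
  define h where "h n t x = (SUP j\<in>{..Suc (2 * n)}. mean M (cube n t j x) (\<lambda>y. ennreal (cmod (a n t x - a n t y)) * ?\<phi> y))" for n t x
  have hm: "h n t \<in> borel_measurable M" if t: "t < K" for n t
  proof -
    interpret nested_partitions M "cube n t" by (rule grid[OF t])
    have "adapted 0 (h n t)"
    proof (rule adaptedI)
      fix x y assume x: "x \<in> space M" and y: "y \<in> cube n t 0 x"
      have "cube n t j y = cube n t j x" for j by (rule cube_eq_above[OF x y]) simp
      then show "h n t y = h n t x" by (simp add: h_def a_def)
    qed
    then show ?thesis by (rule adapted_measurable) auto
  qed
  let ?\<beta> = "ennreal (2 * C0) * BMO_norm d M ?\<nu> b"
  let ?W = "\<lambda>lam. epowr (ennreal C0) p * Ap_const d M p lam"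
  let ?N = "wnorm M p (weight lam1) ?\<phi>"
  let ?R = "adjacent_systems.const_commutator K C0 p * epowr (?W lam1 * ?W lam2) ?e * ?\<beta> * ?N"
  have hbound: "wnorm M p (weight lam2) (h n t) \<le> ?R" if t: "t < K" for n t
  proof -
    interpret adjacent_systems M K "cube n" "env n" C0 by (rule adj)
    have "wnorm M p (weight lam2) (\<lambda>x. SUP j\<in>{..Suc (2 * n)}. mean M (cube n t j x)
        (\<lambda>y. ennreal (cmod (ball_avg M b (cube n t 0 x) - ball_avg M b (cube n t 0 y))) * ?\<phi> y)) \<le> ?R"
    proof (rule dyadic_commutator_bound[where B = "\<lambda>i y. ball_avg M b (cube n t i y)" and \<nu> = "weight ?\<nu>" and ?\<sigma>1.0 = "dual_weight p lam1" and ?\<sigma>2.0 = "dual_weight p lam2"])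
      show "nested_partitions.adapted M (cube n t) i (\<lambda>y. ball_avg M b (cube n t i y))" for i
        by (rule nested_partitions.adapted_cube[OF grid[OF t]])
      show "ennreal (cmod (ball_avg M b (cube n t j x) - ball_avg M b (cube n t i x)))
          \<le> mean M (cube n t j x) (\<lambda>y. ennreal (cmod (b y - ball_avg M b (cube n t i y))))"
        if "x \<in> space M" "j \<le> i" for i j x
        by (rule BMO_cube(2)[OF adj ball b Bw(1,2,4) t that])
      show "mean M (cube n t l x) (\<lambda>y. ennreal (cmod (b y - ball_avg M b (cube n t l y)))) \<le> ?\<beta> * mean M (env n t l x) (weight ?\<nu>)"
        if "x \<in> space M" for l x
        by (rule BMO_cube(1)[OF adj ball b Bw(1,2,4) t that])
      show "nested_partitions.dyadic_Ap M (cube n s) p (weight lam1) (dual_weight p lam1) (?W lam1)" if "s < K" for s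
        by (rule dyadic_Ap_weight[OF adj ball lam1 p that ne])
      show "nested_partitions.dyadic_Ap M (cube n s) p (weight lam2) (dual_weight p lam2) (?W lam2)" if "s < K" for s
        by (rule dyadic_Ap_weight[OF adj ball lam2 p that ne])
    qed (use t p bm Ap_measurable(2)[OF lam1] Ap_measurable(2)[OF lam2] Bw(1,3) in auto)
    then show ?thesis by (simp add: h_def[abs_def] a_def)
  qed
  define H where "H k x = ennreal C0 * (\<Sum>t<K. h (r k) t x)" for k x
  have hm': "\<And>t. t \<in> {..<K} \<Longrightarrow> h n t \<in> borel_measurable M" for n using hm by simp
  have sm: "(\<lambda>x. \<Sum>t<K. h n t x) \<in> borel_measurable M" for n by (rule borel_measurable_sum[OF hm'])
  have Hm: "H k \<in> borel_measurable M" for k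
    unfolding H_def[abs_def] by (rule borel_measurable_times_ennreal[OF borel_measurable_const sm])
  have p0: "0 < p" using p by simp
  have Hbound: "wnorm M p (weight lam2) (H k) \<le> ?bound * ?N" for k
  proof -
    have "wnorm M p (weight lam2) (H k) = ennreal C0 * wnorm M p (weight lam2) (\<lambda>x. \<Sum>t<K. h (r k) t x)"
      unfolding H_def[abs_def] by (rule wnorm_cmult[OF p0 sm Ap_measurable(2)[OF lam2]])
    also have "\<dots> \<le> ennreal C0 * (epowr (of_nat (card {..<K})) (1 / p) * of_nat (card {..<K}) * ?R)"
      by (intro mult_left_mono wnorm_sum_le p0 Ap_measurable(2)[OF lam2] hm' hbound) auto
    also have "\<dots> = ?bound * ?N"
      unfolding const_total_def card_lessThan epowr_mult by (simp only: mult_ac)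
    finally show ?thesis .
  qed
  show "Lp_norm M p lam2 (max_commutator d M b f) \<le> ?bound * ?N"
  proof (rule Lp_norm_le_liminf[OF p0 Ap_measurable(2)[OF lam2] Hm _ Hbound])
    show "AE x in M. max_commutator d M b f x \<le> liminf (\<lambda>k. H k x)"
      using conv
    proof eventually_elim
      case (elim x)
      show ?case
      proof (rule max_commutator_le_liminf[where a = "\<lambda>k. a (r k)" and K = K, OF bm f am])
        show "AE y in M. (\<lambda>k. \<Sum>t<K. ennreal (cmod (a (r k) t y - b y))) \<longlonglongrightarrow> 0"
          using conv by (simp add: err_def)
        show "(\<lambda>k. \<Sum>t<K. ennreal (cmod (a (r k) t x - b x))) \<longlonglongrightarrow> 0"
          using elim by (simp add: err_def)
        fix B assume B: "B \<in> balls d M" "x \<in> B"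
        then obtain z s where z: "z \<in> space M" "0 < s" "B = bl z s" by (auto simp: balls_def)
        have "eventually (\<lambda>k. \<exists>j\<le>2 * r k. fine_scale (r k) * scale_ratio ^ j / scale_ratio < s \<and> s \<le> fine_scale (r k) * scale_ratio ^ j) sequentially"
          using level_of_radius[OF z(2)] r_top by (rule eventually_compose_filterlim)
        then show "eventually (\<lambda>k. \<exists>t<K. mean M B (\<lambda>y. ennreal (cmod (a (r k) t x - a (r k) t y)) * ?\<phi> y) \<le> H k x) sequentially"
        proof eventually_elim
          case (elim k)
          then obtain j where j: "j \<le> 2 * r k" "fine_scale (r k) * scale_ratio ^ j / scale_ratio < s" "s \<le> fine_scale (r k) * scale_ratio ^ j" by blast
          obtain t where t: "t < K" "B \<subseteq> cube (r k) t (Suc j) x" "emeasure M (cube (r k) t (Suc j) x) \<le> ennreal C0 * emeasure M B"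
            using cover[OF z(1) j(2,3)] B(2) unfolding z(3) by blast
          interpret nested_partitions M "cube (r k) t" by (rule grid[OF t(1)])
          have xs: "x \<in> space M" using B z(3) by (simp add: mem_bl)
          let ?g = "\<lambda>y. ennreal (cmod (a (r k) t x - a (r k) t y)) * ?\<phi> y"
          have "mean M B ?g \<le> ennreal C0 * mean M (cube (r k) t (Suc j) x) ?g"
            using C0 cube_pos[OF xs] ball_measure[OF B(1)] by (intro mean_subset t) auto
          also have "mean M (cube (r k) t (Suc j) x) ?g \<le> h (r k) t x"
            unfolding h_def using j by (intro SUP_upper2[of "Suc j"]) auto
          also have "h (r k) t x \<le> (\<Sum>t<K. h (r k) t x)"
            using t(1) by (intro member_le_sum[of t "{..<K}" "\<lambda>t. h (r k) t x"]) auto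
          finally have "mean M B ?g \<le> H k x" by (simp add: H_def mult_left_mono)
          then show ?case using t(1) by blast
        qed
      qed
    qed
  qed
qed

lemma const_total_finite: "adjacent_systems M K cube env C0 \<Longrightarrow> const_total K C0 p \<noteq> top"
  using adjacent_systems.const_commutator_finite[of M K cube env C0 p]
  by (simp add: const_total_def ennreal_mult_eq_top_iff)

end

theorem theorem1p2:
  fixes d :: "'a \<Rightarrow> 'a \<Rightarrow> real" and M :: "'a measure" and p :: real
  assumes "space_of_homogeneous_type d M"
    and "emeasure M (space M) = \<infinity>"
    and "\<And>x\<^sub>0. x\<^sub>0 \<in> space M \<Longrightarrow> emeasure M {x\<^sub>0} = 0"
    and "1 < p"
  shows "\<exists>C::real. 0 < C \<and>
    (\<forall>(lam1 :: 'a \<Rightarrow> real) (lam2 :: 'a \<Rightarrow> real) (nu :: 'a \<Rightarrow> real) (b :: 'a \<Rightarrow> complex).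
       lam1 \<in> Ap d M p \<longrightarrow> lam2 \<in> Ap d M p \<longrightarrow>
       nu = (\<lambda>x. lam1 x powr (1 / p) * lam2 x powr (- (1 / p))) \<longrightarrow>
       b \<in> BMO d M nu \<longrightarrow>
       operator_norm M p lam1 lam2 (max_commutator d M b)
         \<le> ennreal C * epowr (Ap_const d M p lam1 * Ap_const d M p lam2) (max 1 (1 / (p - 1)))
            * BMO_norm d M nu b)"
proof -
  interpret space_of_homogeneous_type d M by fact
  obtain A Cd where "homogeneous_space d M A Cd" using homogeneous_space_exists by blast
  then interpret homogeneous_space d M A Cd .
  have ne: "space M \<noteq> {}" using assms(2) by auto
  obtain K C0 where sys: "\<forall>\<rho>>0. \<exists>cube env. adjacent_systems M K cube env C0 \<and>
     (\<forall>t<K. \<forall>x\<in>space M. \<forall>y\<in>cube t 0 x. d x y < 4 * A\<^sup>2 * \<rho>) \<and>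
     (\<forall>t<K. \<forall>x\<in>space M. \<forall>j. env t j x \<in> balls d M) \<and>
     (\<forall>z\<in>space M. \<forall>j s. \<rho> * scale_ratio ^ j / scale_ratio < s \<longrightarrow> s \<le> \<rho> * scale_ratio ^ j \<longrightarrow>
        (\<exists>t<K. \<forall>x\<in>bl z s. bl z s \<subseteq> cube t (Suc j) x \<and>
           emeasure M (cube t (Suc j) x) \<le> ennreal C0 * emeasure M (bl z s)))"
    using adjacent_systems_exist by blast
  have "\<forall>n. \<exists>cube env. adjacent_systems M K cube env C0 \<and>
     (\<forall>t<K. \<forall>x\<in>space M. \<forall>y\<in>cube t 0 x. d x y < 4 * A\<^sup>2 * fine_scale n) \<and>
     (\<forall>t<K. \<forall>x\<in>space M. \<forall>j. env t j x \<in> balls d M) \<and>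
     (\<forall>z\<in>space M. \<forall>j s. fine_scale n * scale_ratio ^ j / scale_ratio < s \<longrightarrow> s \<le> fine_scale n * scale_ratio ^ j \<longrightarrow>
        (\<exists>t<K. \<forall>x\<in>bl z s. bl z s \<subseteq> cube t (Suc j) x \<and>
           emeasure M (cube t (Suc j) x) \<le> ennreal C0 * emeasure M (bl z s)))"
    using sys fine_scale_pos by simp
  then obtain cube env where adj: "\<And>n. adjacent_systems M K (cube n) (env n) C0"
    and small: "\<And>n t x y. t < K \<Longrightarrow> x \<in> space M \<Longrightarrow> y \<in> cube n t 0 x \<Longrightarrow> d x y < 4 * A\<^sup>2 * fine_scale n"
    and ball: "\<And>n t x j. t < K \<Longrightarrow> x \<in> space M \<Longrightarrow> env n t j x \<in> balls d M"
    and cover: "\<And>n z j s. z \<in> space M \<Longrightarrow> fine_scale n * scale_ratio ^ j / scale_ratio < s \<Longrightarrow> s \<le> fine_scale n * scale_ratio ^ j \<Longrightarrow>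
        \<exists>t<K. \<forall>x\<in>bl z s. bl z s \<subseteq> cube n t (Suc j) x \<and> emeasure M (cube n t (Suc j) x) \<le> ennreal C0 * emeasure M (bl z s)"
    unfolding choice_iff by metis
  define C where "C = enn2real (const_total K C0 p) + 1"
  have C: "const_total K C0 p \<le> ennreal C"
    using const_total_finite[OF adj, of p] by (cases "const_total K C0 p") (auto simp: C_def ennreal_leI)
  show ?thesis
  proof (intro exI[of _ C] conjI allI impI)
    show "0 < C" by (simp add: C_def add_nonneg_pos)
    fix lam1 lam2 nu :: "'a \<Rightarrow> real" and b :: "'a \<Rightarrow> complex"
    assume lam: "lam1 \<in> Ap d M p" "lam2 \<in> Ap d M p" and nu: "nu = (\<lambda>x. lam1 x powr (1 / p) * lam2 x powr (- (1 / p)))"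
      and b: "b \<in> BMO d M nu"
    have nu': "nu = Bloom_weight p lam1 lam2" unfolding nu Bloom_weight_def ..
    have "operator_norm M p lam1 lam2 (max_commutator d M b)
        \<le> const_total K C0 p * epowr (Ap_const d M p lam1 * Ap_const d M p lam2) (max 1 (1 / (p - 1))) * BMO_norm d M nu b"
      unfolding nu' by (rule maximal_commutator_operator_norm[OF adj small ball cover assms(4) ne lam b[unfolded nu']])
    also have "\<dots> \<le> ennreal C * epowr (Ap_const d M p lam1 * Ap_const d M p lam2) (max 1 (1 / (p - 1))) * BMO_norm d M nu b"
      by (intro mult_right_mono C) auto
    finally show "operator_norm M p lam1 lam2 (max_commutator d M b)
        \<le> ennreal C * epowr (Ap_const d M p lam1 * Ap_const d M p lam2) (max 1 (1 / (p - 1))) * BMO_norm d M nu b" .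
  qed
qed

end
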